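(* Let $a>0$, $R>0$, and let $V\in C^2([0,\infty))$ be real-valued with $V(x)\to 1$ and $V''(x)\to 0$ as $x\to\infty$. Let $X=H^2(0,\infty)\cap H_0^1(0,\infty)$, $Y=L^2(0,\infty)$ (complex-valued functions), $D(A)=H^4(0,\infty)\cap H_0^2(0,\infty)$, and define $A:D(A)\subset X\to Y$ and $B:X\to Y$ by $$Au=(-D^2+a^2)^2u+iaR\,[V\cdot(-D^2+a^2)u+V''\cdot u],\qquad Bu=(-D^2+a^2)u,\qquad D=\tfrac{d}{dx}.$$ Then the essential spectrum of the problem $Au=\lambda Bu$ is $$\sigma_{\mathrm{ess}}(A,B)=\{\mu+a^2+iaR\,:\,\mu\in[0,\infty)\}.$$
   Context: $X$ carries the $H^2(0,\infty)$ norm and $Y$ the $L^2(0,\infty)$ norm; all spaces are complex Banach spaces, and $i$ is the imaginary unit. $H^1_0(0,\infty)$ and $H_0^2(0,\infty)$ are the usual Sobolev spaces with vanishing traces at $0$ ($u(0)=0$, respectively $u(0)=u'(0)=0$). The operator $A$ is closed as an operator from $X$ to $Y$, and $B$ is bounded and bijective with bounded inverse. For a closed linear operator $A:D(A)\subset X\to Y$ and a bounded linear operator $B:X\to Y$ the essential spectrum is defined as $$\sigma_{\mathrm{ess}}(A,B):=\{\lambda\in\mathbb{C}: A-\lambda B \text{ is not a Fredholm operator of index } 0\}.$$ Here a closed linear operator $T:D(T)\subset X\to Y$ ($D(T)$ not necessarily dense) is called a Fredholm operator if its range is closed and has finite codimension $d(T)$ in $Y$ and its nullspace has finite dimension $n(T)$;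 it has index $0$ if $d(T)=n(T)$. *)

theory Defs
  imports "HOL-Analysis.Analysis"
begin

section \<open>Complex normed spaces\<close>

class complex_normed_vector = real_normed_vector +
  fixes scaleC :: "complex \<Rightarrow> 'a \<Rightarrow> 'a"  (infixr \<open>*\<^sub>C\<close> 75)
  assumes scaleC_add_right: "c *\<^sub>C (x + y) = c *\<^sub>C x + c *\<^sub>C y"
    and scaleC_add_left: "(c + d) *\<^sub>C x = c *\<^sub>C x + d *\<^sub>C x"
    and scaleC_scaleC: "c *\<^sub>C d *\<^sub>C x = (c * d) *\<^sub>C x"
    and scaleC_one: "1 *\<^sub>C x = x"
    and scaleR_scaleC: "r *\<^sub>R x = complex_of_real r *\<^sub>C x"
    and norm_scaleC: "norm (c *\<^sub>C x) = cmod c * norm x"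

interpretation complex_vector:
  vector_space "scaleC :: complex \<Rightarrow> 'a \<Rightarrow> 'a::complex_normed_vector"
  by unfold_locales
    (simp_all add: scaleC_add_right scaleC_add_left scaleC_scaleC scaleC_one)


section \<open>Closed operators, Fredholm operators, essential spectrum of a pair\<close>

text \<open>
  The space in which the operators are defined is a subset \<open>X\<close> of an ambient complex vector space
  with a norm \<open>nX\<close> of its own (which is in general not the norm of the ambient type); the target
  space is the whole type \<open>'y\<close> with its norm. An operator with domain \<open>D\<close> is a
  function of which only the values on \<open>D\<close> are relevant.
\<close>

definition closed_operator ::
  "'x::complex_normed_vector set \<Rightarrow> ('x \<Rightarrow> real) \<Rightarrow> 'x set \<Rightarrow> ('x \<Rightarrow> 'y::complex_normed_vector) \<Rightarrow> bool"
  where "closed_operator X nX D T \<longleftrightarrow>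
    complex_vector.subspace D \<and> D \<subseteq> X \<and>
    (\<forall>u\<in>D. \<forall>v\<in>D. T (u + v) = T u + T v) \<and>
    (\<forall>c. \<forall>u\<in>D. T (c *\<^sub>C u) = c *\<^sub>C T u) \<and>
    (\<forall>u x y. (\<forall>n. u n \<in> D) \<longrightarrow> x \<in> X \<longrightarrow>
       (\<lambda>n. nX (u n - x)) \<longlonglongrightarrow> 0 \<longrightarrow> (\<lambda>n. T (u n)) \<longlonglongrightarrow> y \<longrightarrow> x \<in> D \<and> T x = y)"

definition finite_dim :: "'a::complex_normed_vector set \<Rightarrow> bool"
  where "finite_dim S \<longleftrightarrow> (\<exists>B. finite B \<and> complex_vector.span B = S)"

text \<open>
  \<open>has_codim S n\<close>: the quotient space modulo the subspace \<open>S\<close> has dimension \<open>n\<close>, that is, there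
  are \<open>n\<close> vectors whose classes modulo \<open>S\<close> are linearly independent and span the quotient.
\<close>

definition has_codim :: "'a::complex_normed_vector set \<Rightarrow> nat \<Rightarrow> bool"
  where "has_codim S n \<longleftrightarrow> (\<exists>B. finite B \<and> card B = n \<and>
    (\<forall>c. (\<Sum>b\<in>B. c b *\<^sub>C b) \<in> S \<longrightarrow> (\<forall>b\<in>B. c b = 0)) \<and>
    (\<forall>y. \<exists>c. y - (\<Sum>b\<in>B. c b *\<^sub>C b) \<in> S))"

definition null_space :: "'x set \<Rightarrow> ('x \<Rightarrow> 'y::zero) \<Rightarrow> 'x set"
  where "null_space D T = {u \<in> D. T u = 0}"

definition nullity :: "'x::complex_normed_vector set \<Rightarrow> ('x \<Rightarrow> 'y::complex_normed_vector) \<Rightarrow> nat"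
  where "nullity D T = complex_vector.dim (null_space D T)"

definition deficiency :: "'x set \<Rightarrow> ('x \<Rightarrow> 'y::complex_normed_vector) \<Rightarrow> nat"
  where "deficiency D T = (THE n. has_codim (T ` D) n)"

definition fredholm_operator ::
  "'x::complex_normed_vector set \<Rightarrow> ('x \<Rightarrow> real) \<Rightarrow> 'x set \<Rightarrow> ('x \<Rightarrow> 'y::complex_normed_vector) \<Rightarrow> bool"
  where "fredholm_operator X nX D T \<longleftrightarrow>
    closed_operator X nX D T \<and> closed (T ` D) \<and>
    (\<exists>n. has_codim (T ` D) n) \<and> finite_dim (null_space D T)"

definition ess_spectrum ::
  "'x::complex_normed_vector set \<Rightarrow> ('x \<Rightarrow> real) \<Rightarrow> 'x set \<Rightarrow>
   ('x \<Rightarrow> 'y::complex_normed_vector) \<Rightarrow> ('x \<Rightarrow> 'y) \<Rightarrow> complex set"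
  where "ess_spectrum X nX D A B = {z.
    \<not> (fredholm_operator X nX D (\<lambda>u. A u - z *\<^sub>C B u) \<and>
       deficiency D (\<lambda>u. A u - z *\<^sub>C B u) = nullity D (\<lambda>u. A u - z *\<^sub>C B u))}"


section \<open>The space of square-integrable functions on the half-line\<close>

abbreviation half_line :: "real measure"
  where "half_line \<equiv> lebesgue_on {0<..}"

definition square_integrable :: "(real \<Rightarrow> complex) \<Rightarrow> bool"
  where "square_integrable f \<longleftrightarrow>
    f \<in> borel_measurable half_line \<and> integrable half_line (\<lambda>x. (cmod (f x))\<^sup>2)"

definition l2_rel :: "(real \<Rightarrow> complex) \<Rightarrow> (real \<Rightarrow> complex) \<Rightarrow> bool"
  where "l2_rel f g \<longleftrightarrow> square_integrable f \<and> square_integrable g \<and> (AE x in half_line. f x = g x)"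

lemma square_integrable_zero: "square_integrable (\<lambda>x. 0)"
  by (simp add: square_integrable_def)

lemma square_integrable_add:
  assumes "square_integrable f" "square_integrable g"
  shows "square_integrable (\<lambda>x. f x + g x)"
proof -
  have f: "f \<in> borel_measurable half_line" "integrable half_line (\<lambda>x. (cmod (f x))\<^sup>2)"
    and g: "g \<in> borel_measurable half_line" "integrable half_line (\<lambda>x. (cmod (g x))\<^sup>2)"
    using assms by (auto simp: square_integrable_def)
  have m: "(\<lambda>x. f x + g x) \<in> borel_measurable half_line"
    using f g by measurable
  have "integrable half_line (\<lambda>x. (cmod (f x + g x))\<^sup>2)"
  proof (rule Bochner_Integration.integrable_bound)
    show "integrable half_line (\<lambda>x. 2 * (cmod (f x))\<^sup>2 + 2 * (cmod (g x))\<^sup>2)"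
      using f g by simp
    show "(\<lambda>x. (cmod (f x + g x))\<^sup>2) \<in> borel_measurable half_line"
      using m by measurable
    have "(cmod (f x + g x))\<^sup>2 \<le> 2 * (cmod (f x))\<^sup>2 + 2 * (cmod (g x))\<^sup>2" for x
    proof -
      have "(cmod (f x + g x))\<^sup>2 \<le> (cmod (f x) + cmod (g x))\<^sup>2"
        by (intro power_mono norm_triangle_ineq norm_ge_zero)
      also have "\<dots> \<le> 2 * (cmod (f x))\<^sup>2 + 2 * (cmod (g x))\<^sup>2"
        using zero_le_power2[of "cmod (f x) - cmod (g x)"]
        by (simp add: power2_sum power2_diff)
      finally show ?thesis .
    qed
    then show "AE x in half_line. norm ((cmod (f x + g x))\<^sup>2)
        \<le> norm (2 * (cmod (f x))\<^sup>2 + 2 * (cmod (g x))\<^sup>2)"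
      by simp
  qed
  with m show ?thesis by (simp add: square_integrable_def)
qed

lemma square_integrable_mult_const:
  assumes "square_integrable f"
  shows "square_integrable (\<lambda>x. c * f x)"
  using assms by (auto simp: square_integrable_def norm_mult power_mult_distrib)

lemma square_integrable_minus:
  "square_integrable f \<Longrightarrow> square_integrable (\<lambda>x. - f x)"
  using square_integrable_mult_const[of f "-1"] by simp

lemma square_integrable_diff:
  "square_integrable f \<Longrightarrow> square_integrable g \<Longrightarrow> square_integrable (\<lambda>x. f x - g x)"
  using square_integrable_add[of f "\<lambda>x. - g x"] square_integrable_minus[of g] by simp

quotient_type l2 = "real \<Rightarrow> complex" / partial: l2_rel
  morphisms rep_l2 abs_l2
proof (rule part_equivpI)
  show "\<exists>f. l2_rel f f"
    using square_integrable_zero by (auto simp: l2_rel_def)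
  show "symp l2_rel"
    by (rule sympI) (auto simp: l2_rel_def)
  show "transp l2_rel"
    by (rule transpI) (auto simp: l2_rel_def)
qed

lift_definition l2_norm :: "l2 \<Rightarrow> real" is "\<lambda>f. sqrt (LINT x|half_line. (cmod (f x))\<^sup>2)"
proof -
  fix f g assume "l2_rel f g"
  then have "AE x in half_line. (cmod (f x))\<^sup>2 = (cmod (g x))\<^sup>2"
    and "f \<in> borel_measurable half_line" "g \<in> borel_measurable half_line"
    by (auto simp: l2_rel_def square_integrable_def)
  then have "(LINT x|half_line. (cmod (f x))\<^sup>2) = (LINT x|half_line. (cmod (g x))\<^sup>2)"
    by (intro integral_cong_AE) auto
  then show "sqrt (LINT x|half_line. (cmod (f x))\<^sup>2) = sqrt (LINT x|half_line. (cmod (g x))\<^sup>2)"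
    by simp
qed

instantiation l2 :: complex_normed_vector
begin

lift_definition zero_l2 :: l2 is "\<lambda>x. 0"
  by (simp add: l2_rel_def square_integrable_zero)

lift_definition plus_l2 :: "l2 \<Rightarrow> l2 \<Rightarrow> l2" is "\<lambda>f g x. f x + g x"
  by (auto simp: l2_rel_def intro: square_integrable_add)

lift_definition uminus_l2 :: "l2 \<Rightarrow> l2" is "\<lambda>f x. - f x"
  by (auto simp: l2_rel_def intro: square_integrable_minus)

lift_definition minus_l2 :: "l2 \<Rightarrow> l2 \<Rightarrow> l2" is "\<lambda>f g x. f x - g x"
  by (auto simp: l2_rel_def intro: square_integrable_diff)

lift_definition scaleC_l2 :: "complex \<Rightarrow> l2 \<Rightarrow> l2" is "\<lambda>c f x. c * f x"
  by (auto simp: l2_rel_def intro: square_integrable_mult_const)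

definition scaleR_l2 :: "real \<Rightarrow> l2 \<Rightarrow> l2"
  where "scaleR_l2 r u = complex_of_real r *\<^sub>C u"

definition norm_l2 :: "l2 \<Rightarrow> real"
  where "norm_l2 = l2_norm"

definition sgn_l2 :: "l2 \<Rightarrow> l2"
  where "sgn_l2 u = inverse (norm u) *\<^sub>R u"

definition dist_l2 :: "l2 \<Rightarrow> l2 \<Rightarrow> real"
  where "dist_l2 u v = norm (u - v)"

definition uniformity_l2 :: "(l2 \<times> l2) filter"
  where "uniformity_l2 = (INF e\<in>{0<..}. principal {(x, y). dist x y < e})"

definition open_l2 :: "l2 set \<Rightarrow> bool"
  where "open_l2 U \<longleftrightarrow> (\<forall>x\<in>U. \<forall>\<^sub>F (x', y) in uniformity. x' = x \<longrightarrow> y \<in> U)"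

instance
proof
  fix u v w :: l2 and c d :: complex and r s :: real
  show "u + v + w = u + (v + w)"
    by transfer (auto simp: l2_rel_def add.assoc intro!: square_integrable_add)
  show "u + v = v + u"
    by transfer (auto simp: l2_rel_def add.commute intro!: square_integrable_add)
  show "0 + u = u"
    by transfer (auto simp: l2_rel_def)
  show "- u + u = 0"
    by transfer (auto simp: l2_rel_def square_integrable_zero)
  show "u - v = u + - v"
    by transfer (auto simp: l2_rel_def intro: square_integrable_diff)
  show 1: "c *\<^sub>C (u + v) = c *\<^sub>C u + c *\<^sub>C v" for c :: complex and u v :: l2
    by transfer (auto simp: l2_rel_def algebra_simps
        intro!: square_integrable_add square_integrable_mult_const)
  show 2: "(c + d) *\<^sub>C u = c *\<^sub>C u + d *\<^sub>C u" for c d :: complex and u :: l2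
    by transfer (auto simp: l2_rel_def algebra_simps
        intro!: square_integrable_add square_integrable_mult_const)
  show 3: "c *\<^sub>C d *\<^sub>C u = (c * d) *\<^sub>C u" for c d :: complex and u :: l2
    by transfer (auto simp: l2_rel_def algebra_simps intro!: square_integrable_mult_const)
  show 4: "1 *\<^sub>C u = u" for u :: l2
    by transfer (auto simp: l2_rel_def)
  show "r *\<^sub>R (u + v) = r *\<^sub>R u + r *\<^sub>R v"
    by (simp add: scaleR_l2_def 1)
  show "(r + s) *\<^sub>R u = r *\<^sub>R u + s *\<^sub>R u"
    by (simp add: scaleR_l2_def 2)
  show "r *\<^sub>R s *\<^sub>R u = (r * s) *\<^sub>R u"
    by (simp add: scaleR_l2_def 3)
  show "1 *\<^sub>R u = u"
    by (simp add: scaleR_l2_def 4)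
  show "r *\<^sub>R u = complex_of_real r *\<^sub>C u"
    by (simp add: scaleR_l2_def)
  show 5: "norm (c *\<^sub>C u) = cmod c * norm u" for c :: complex and u :: l2
    unfolding norm_l2_def
    by transfer (simp add: norm_mult power_mult_distrib real_sqrt_mult)
  show "norm (r *\<^sub>R u) = \<bar>r\<bar> * norm u"
    by (simp add: scaleR_l2_def 5)
  show "sgn u = inverse (norm u) *\<^sub>R u"
    by (simp add: sgn_l2_def)
  show "dist u v = norm (u - v)"
    by (simp add: dist_l2_def)
  show "(uniformity :: (l2 \<times> l2) filter) = (INF e\<in>{0<..}. principal {(x, y). dist x y < e})"
    by (simp add: uniformity_l2_def)
  show "open U \<longleftrightarrow> (\<forall>x\<in>U. \<forall>\<^sub>F (x', y) in uniformity. x' = x \<longrightarrow> y \<in> U)" for U :: "l2 set"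
    by (simp add: open_l2_def)
  show norm0: "norm u = 0 \<longleftrightarrow> u = 0" for u :: l2
    unfolding norm_l2_def
  proof transfer
    fix f assume "l2_rel f f"
    then have "square_integrable f" by (simp add: l2_rel_def)
    then have i: "integrable half_line (\<lambda>x. (cmod (f x))\<^sup>2)"
      by (simp add: square_integrable_def)
    show "sqrt (LINT x|half_line. (cmod (f x))\<^sup>2) = 0 \<longleftrightarrow> l2_rel f (\<lambda>x. 0)"
      using integral_nonneg_eq_0_iff_AE[OF i] \<open>square_integrable f\<close>
      by (simp add: l2_rel_def square_integrable_zero)
  qed
  show "norm (u + v) \<le> norm u + norm v"
  proof (cases "u = 0 \<or> v = 0")
    case True
    have z: "0 + w = w" for w :: l2
      by transfer (auto simp: l2_rel_def)
    have z': "w + 0 = w" for w :: l2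
      by transfer (auto simp: l2_rel_def)
    have "norm (0::l2) = 0"
      using norm0 by blast
    then show ?thesis
      using True by (auto simp: z z')
  next
    case False
    have nn: "0 \<le> norm w" for w :: l2
      unfolding norm_l2_def by transfer simp
    have "norm u \<noteq> 0" "norm v \<noteq> 0"
      using False norm0 by blast+
    then have pos: "0 < norm u" "0 < norm v"
      using nn[of u] nn[of v] by linarith+
    from pos show ?thesis
      unfolding norm_l2_def
    proof transfer
      fix f g assume "l2_rel f f" "l2_rel g g"
      then have sq: "square_integrable f" "square_integrable g"
        by (simp_all add: l2_rel_def)
      define s where "s = sqrt (LINT x|half_line. (cmod (f x))\<^sup>2)"
      define t where "t = sqrt (LINT x|half_line. (cmod (g x))\<^sup>2)"
      assume "0 < sqrt (LINT x|half_line. (cmod (f x))\<^sup>2)"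
        "0 < sqrt (LINT x|half_line. (cmod (g x))\<^sup>2)"
      then have st: "0 < s" "0 < t"
        by (simp_all add: s_def t_def)
      have s2: "(LINT x|half_line. (cmod (f x))\<^sup>2) = s\<^sup>2"
        and t2: "(LINT x|half_line. (cmod (g x))\<^sup>2) = t\<^sup>2"
        by (simp_all add: s_def t_def)
      have i: "integrable half_line (\<lambda>x. (cmod (f x))\<^sup>2)" "integrable half_line (\<lambda>x. (cmod (g x))\<^sup>2)"
        "integrable half_line (\<lambda>x. (cmod (f x + g x))\<^sup>2)"
        using sq square_integrable_add[OF sq] by (simp_all add: square_integrable_def)
      have "(cmod (f x + g x))\<^sup>2 \<le> (1 + t / s) * (cmod (f x))\<^sup>2 + (1 + s / t) * (cmod (g x))\<^sup>2" for x
      proof -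
        define p q where "p = cmod (f x)" and "q = cmod (g x)"
        have "0 \<le> (t * p - s * q)\<^sup>2 / (s * t)"
          using st by simp
        also have "\<dots> = t / s * p\<^sup>2 + s / t * q\<^sup>2 - 2 * p * q"
          using st by (simp add: field_simps power2_eq_square)
        finally have "(p + q)\<^sup>2 \<le> (1 + t / s) * p\<^sup>2 + (1 + s / t) * q\<^sup>2"
          by (simp add: power2_sum algebra_simps)
        moreover have "(cmod (f x + g x))\<^sup>2 \<le> (p + q)\<^sup>2"
          unfolding p_def q_def by (intro power_mono norm_triangle_ineq norm_ge_zero)
        ultimately show ?thesis unfolding p_def q_def by linarith
      qed
      then have "(LINT x|half_line. (cmod (f x + g x))\<^sup>2)
          \<le> (LINT x|half_line. (1 + t / s) * (cmod (f x))\<^sup>2 + (1 + s / t) * (cmod (g x))\<^sup>2)"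
        using i by (intro integral_mono) auto
      also have "\<dots> = (1 + t / s) * s\<^sup>2 + (1 + s / t) * t\<^sup>2"
        using i by (simp add: s2 t2)
      also have "\<dots> = (s + t)\<^sup>2"
        using st by (simp add: field_simps power2_eq_square)
      finally have "sqrt (LINT x|half_line. (cmod (f x + g x))\<^sup>2) \<le> s + t"
        using st by (simp add: real_le_lsqrt)
      then show "sqrt (LINT x|half_line. (cmod (f x + g x))\<^sup>2)
          \<le> sqrt (LINT x|half_line. (cmod (f x))\<^sup>2) + sqrt (LINT x|half_line. (cmod (g x))\<^sup>2)"
        by (simp add: s_def t_def)
    qed
  qed
qed

end

text \<open>Meaningful when \<open>g\<close> is bounded and measurable on the half-line.\<close>

definition mult_by :: "(real \<Rightarrow> real) \<Rightarrow> l2 \<Rightarrow> l2"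
  where "mult_by g u = abs_l2 (\<lambda>x. complex_of_real (g x) * rep_l2 u x)"


section \<open>Sobolev spaces on the half-line\<close>

text \<open>
  Real-valued test functions suffice for weak derivatives of complex-valued functions, since
  the defining identity is complex linear in the test function.
\<close>

definition test_function :: "(real \<Rightarrow> real) \<Rightarrow> bool"
  where "test_function \<phi> \<longleftrightarrow>
    (\<forall>k x. (deriv ^^ k) \<phi> field_differentiable (at x)) \<and>
    (\<exists>K. compact K \<and> K \<subseteq> {0<..} \<and> (\<forall>x. x \<notin> K \<longrightarrow> \<phi> x = 0))"

definition is_weak_deriv :: "nat \<Rightarrow> l2 \<Rightarrow> l2 \<Rightarrow> bool"
  where "is_weak_deriv k u v \<longleftrightarrow> (\<forall>\<phi>. test_function \<phi> \<longrightarrow>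
    (LINT x|half_line. rep_l2 u x * complex_of_real ((deriv ^^ k) \<phi> x)) =
    (-1) ^ k * (LINT x|half_line. rep_l2 v x * complex_of_real (\<phi> x)))"

definition weak_deriv :: "nat \<Rightarrow> l2 \<Rightarrow> l2"
  where "weak_deriv k u = (THE v. is_weak_deriv k u v)"

definition sobolev :: "nat \<Rightarrow> l2 set"
  where "sobolev k = {u. \<forall>j\<le>k. \<exists>v. is_weak_deriv j u v}"

definition sobolev_norm :: "nat \<Rightarrow> l2 \<Rightarrow> real"
  where "sobolev_norm k u = sqrt (\<Sum>j\<le>k. (norm (weak_deriv j u))\<^sup>2)"

text \<open>The trace at the origin is the value there of the continuous representative.\<close>

definition zero_trace :: "l2 \<Rightarrow> bool"
  where "zero_trace u \<longleftrightarrow> (\<exists>f. continuous_on {0..} f \<and> (AE x in half_line. rep_l2 u x = f x) \<and> f 0 = 0)"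

definition sobolev0 :: "nat \<Rightarrow> l2 set"
  where "sobolev0 k = {u \<in> sobolev k. \<forall>j<k. zero_trace (weak_deriv j u)}"


section \<open>The Orr--Sommerfeld problem on the half-line\<close>

definition helm :: "real \<Rightarrow> l2 \<Rightarrow> l2"
  where "helm a u = - weak_deriv 2 u + complex_of_real (a\<^sup>2) *\<^sub>C u"

definition OS_X :: "l2 set"
  where "OS_X = sobolev 2 \<inter> sobolev0 1"

definition OS_dom :: "l2 set"
  where "OS_dom = sobolev 4 \<inter> sobolev0 2"

text \<open>The argument \<open>V2\<close> stands for the second derivative of \<open>V\<close>.\<close>

definition OS_A :: "real \<Rightarrow> real \<Rightarrow> (real \<Rightarrow> real) \<Rightarrow> (real \<Rightarrow> real) \<Rightarrow> l2 \<Rightarrow> l2"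
  where "OS_A a R V V2 u = helm a (helm a u) +
    (\<i> * complex_of_real a * complex_of_real R) *\<^sub>C (mult_by V (helm a u) + mult_by V2 u)"

definition OS_B :: "real \<Rightarrow> l2 \<Rightarrow> l2"
  where "OS_B a u = helm a u"

end

theory Submission
  imports Defs
begin

text \<open>
  On the half-line \<open>(\<kappa> + D) u = g\<close>, \<open>u(0) = 0\<close> and \<open>(\<kappa> - D) u = g\<close> with \<open>Re \<kappa> > 0\<close> are solved in \<open>L\<^sup>2\<close> by a
  causal and an anticausal exponential kernel. With \<open>\<nu>\<^sup>2 = a\<^sup>2 + iaR - \<lambda>\<close> and \<open>V = 1\<close>, the operator \<open>A - \<lambda>B\<close> factors as
  \<open>(\<nu> - D) (a - D) (\<nu> + D) (a + D)\<close>, so it is a bijection of the domain onto \<open>L\<^sup>2\<close> as soon as \<open>Re \<nu> > 0\<close>, that is,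
  when \<open>\<lambda>\<close> is off the ray. For general \<open>V\<close> the remainder involves the multipliers \<open>V - 1\<close> and \<open>V''\<close>, which vanish
  at infinity; composed with the inverse it is a norm limit of operators of finite rank, and a bijection plus an
  operator of finite rank has closed range and index 0. On the ray, wave packets \<open>\<rho>(x / L) e\<^sup>i\<^sup>\<theta>\<^sup>x\<close> moving to infinity
  are almost orthogonal to the range, and a lacunary sum of them shows that the range has infinite codimension.
\<close>

section \<open>Smooth functions and test functions\<close>

text \<open>The order of the four factors carries the boundary conditions. Homogeneous solutions of
  \<kappa> + D decay, so uniqueness there needs a zero trace; those of \<kappa> - D grow and leave
  L2, so integrability alone decides. The conditions u(0) = u'(0) = 0 are exactly what the two
  causal factors consume: both u and (a + D) u vanish at 0.

  The perturbation is approximated through anticausal kernels only: any w with derivative w' in L2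
  is an anticausal inverse of w - w', so one approximation result covers both multipliers. If the
  perturbation composed with the inverse is F + E with F of finite rank and E of norm at most 1/2,
  then 1 + E is absorbed into the bijection, and index 0 becomes a dimension count for 1 plus an
  operator of finite rank inside a finite-dimensional space.

  On the ray it is finite codimension, not closedness of the range, that is refuted. For this the
  bounds on pairings with packets must hold with one threshold for the whole domain.\<close>

definition smooth_fun :: "(real \<Rightarrow> real) \<Rightarrow> bool"
  where "smooth_fun f \<longleftrightarrow> (\<forall>k x. (deriv ^^ k) f field_differentiable (at x))"

lemma smooth_fun_iff_deriv:
  "smooth_fun f \<longleftrightarrow> (\<forall>x. f field_differentiable (at x)) \<and> smooth_fun (deriv f)"
proof -
  have "(deriv ^^ Suc k) f = (deriv ^^ k) (deriv f)" for k
    by (simp add: funpow_swap1)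
  then show ?thesis
    unfolding smooth_fun_def using not0_implies_Suc by (metis (no_types, lifting) funpow_0)
qed

lemma smooth_fun_deriv: "smooth_fun f \<Longrightarrow> smooth_fun (deriv f)"
  using smooth_fun_iff_deriv by blast

lemma smooth_fun_has_derivative: "smooth_fun f \<Longrightarrow> (f has_real_derivative deriv f x) (at x)"
  using smooth_fun_iff_deriv field_differentiable_derivI by blast

lemma smooth_fun_continuous: "smooth_fun f \<Longrightarrow> continuous_on S f"
  by (meson smooth_fun_has_derivative DERIV_isCont continuous_at_imp_continuous_on)

lemma smooth_fun_integral:
  assumes "\<And>x. (f has_real_derivative g x) (at x)" "smooth_fun g"
  shows "smooth_fun f"
proof -
  have "deriv f = g"
    using assms(1) DERIV_imp_deriv by blast
  then show ?thesis
    using assms smooth_fun_iff_deriv field_differentiable_def by metis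
qed

text \<open>A class closed under differentiation contains all iterated derivatives of its members,
  and each of these is differentiable. The order of the derivative thus disappears from concrete
  smoothness proofs.\<close>

lemma smooth_fun_coinduct:
  assumes "P f"
    and step: "\<And>f. P f \<Longrightarrow> \<exists>g. (\<forall>x. (f has_real_derivative g x) (at x)) \<and> P g"
  shows "smooth_fun f"
proof -
  have "P ((deriv ^^ k) f)" for k
  proof (induction k)
    case (Suc k)
    then obtain g where "\<forall>x. ((deriv ^^ k) f has_real_derivative g x) (at x)" "P g"
      using step by blast
    moreover from this have "deriv ((deriv ^^ k) f) = g"
      using DERIV_imp_deriv by blast
    ultimately show ?case by simp
  qed (use assms in simp)
  then show ?thesis
    unfolding smooth_fun_def using step field_differentiable_def by metis
qed

text \<open>The classical function exp (-1/x), extended by 0, leaves its own span when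
  differentiated; the powers of 1/x complete it to a family whose derivatives are combinations of
  members.\<close>

definition flat_fun :: "nat \<Rightarrow> real \<Rightarrow> real"
  where "flat_fun k x = (if x > 0 then exp (- inverse x) * inverse x ^ k else 0)"

lemma flat_fun_has_derivative:
  "(flat_fun k has_real_derivative (flat_fun (k + 2) x - real k * flat_fun (k + 1) x)) (at x)"
proof (cases x "0::real" rule: linorder_cases)
  case less
  have "((\<lambda>x. 0) has_real_derivative 0) (at x)" by simp
  then have "(flat_fun k has_real_derivative 0) (at x)"
    by (rule has_field_derivative_transform_within[where d = "-x"])
      (use less in \<open>auto simp: flat_fun_def dist_real_def\<close>)
  then show ?thesis
    using less by (simp add: flat_fun_def)
next
  case greater
  have k: "real k * inverse x ^ (k - 1) * (inverse x)\<^sup>2 = real k * inverse x ^ (k + 1)"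
    by (cases k) (auto simp: power2_eq_square)
  have i: "(inverse has_real_derivative - ((inverse x)\<^sup>2)) (at x)"
    using DERIV_inverse[of x] greater by (simp add: numeral_2_eq_2)
  have "((\<lambda>x. exp (- inverse x) * inverse x ^ k) has_real_derivative
      exp (- inverse x) * (- (- (inverse x)\<^sup>2)) * inverse x ^ k
      + real k * (- (inverse x)\<^sup>2 * inverse x ^ (k - 1)) * exp (- inverse x)) (at x)"
    using DERIV_mult[OF DERIV_fun_exp[OF DERIV_minus[OF i]] DERIV_power[OF i, of k]]
    by (simp add: algebra_simps)
  also have "exp (- inverse x) * (- (- (inverse x)\<^sup>2)) * inverse x ^ k
      + real k * (- (inverse x)\<^sup>2 * inverse x ^ (k - 1)) * exp (- inverse x) =
      exp (- inverse x) * (inverse x ^ k * (inverse x)\<^sup>2)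
      - exp (- inverse x) * (real k * inverse x ^ (k - 1) * (inverse x)\<^sup>2)"
    by (simp add: algebra_simps)
  also have "\<dots> = exp (- inverse x) * inverse x ^ (k + 2)
      - real k * (exp (- inverse x) * inverse x ^ (k + 1))"
    unfolding k by (simp add: power_add algebra_simps power2_eq_square)
  finally have "(flat_fun k has_real_derivative exp (- inverse x) * inverse x ^ (k + 2)
      - real k * (exp (- inverse x) * inverse x ^ (k + 1))) (at x)"
    by (elim has_field_derivative_transform_within[where d = x])
      (use greater in \<open>auto simp: flat_fun_def dist_real_def\<close>)
  then show ?thesis
    using greater by (simp add: flat_fun_def)
next
  case equal
  have "((\<lambda>h. (flat_fun k h - flat_fun k 0) / (h - 0)) \<longlongrightarrow> 0) (at 0)"
  proof (rule filterlim_split_at)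
    have "\<forall>\<^sub>F h in at_left (0::real). (flat_fun k h - flat_fun k 0) / (h - 0) = 0"
      by (auto simp: flat_fun_def eventually_at_filter)
    then show "((\<lambda>h. (flat_fun k h - flat_fun k 0) / (h - 0)) \<longlongrightarrow> 0) (at_left 0)"
      by (simp add: tendsto_eventually)
    \<comment> \<open>With t = 1/h the difference quotient is t^(k+1) / exp t, and the exponential
      beats every power.\<close>
    have "((\<lambda>h::real. inverse h ^ (k + 1) / exp (inverse h)) \<longlongrightarrow> 0) (at_right 0)"
      by (rule filterlim_compose[OF tendsto_power_div_exp_0 filterlim_inverse_at_top_right])
    then show "((\<lambda>h. (flat_fun k h - flat_fun k 0) / (h - 0)) \<longlongrightarrow> 0) (at_right 0)"
      by (rule Lim_transform_eventually)
        (auto simp: flat_fun_def eventually_at_filter exp_minus field_simps)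
  qed
  then show ?thesis
    using equal by (simp add: has_field_derivative_iff flat_fun_def)
qed

text \<open>A syntactic closure, so that one rule induction yields all closure properties:
  differentiation stays inside the class, which by coinduction contains only smooth functions, while
  \<open>base\<close> admits every smooth function. Each constructor thereby becomes a closure rule
  for smoothness itself.\<close>

inductive elementary_smooth :: "(real \<Rightarrow> real) \<Rightarrow> bool" where
  base: "smooth_fun f \<Longrightarrow> elementary_smooth f"
| flat: "elementary_smooth (flat_fun k)"
| const: "elementary_smooth (\<lambda>x. c)"
| ident: "elementary_smooth (\<lambda>x. x)"
| exp: "elementary_smooth exp"
| sin: "elementary_smooth sin"
| cos: "elementary_smooth cos"
| add: "elementary_smooth f \<Longrightarrow> elementary_smooth g \<Longrightarrow> elementary_smooth (\<lambda>x. f x + g x)"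
| mult: "elementary_smooth f \<Longrightarrow> elementary_smooth g \<Longrightarrow> elementary_smooth (\<lambda>x. f x * g x)"
| comp: "elementary_smooth f \<Longrightarrow> elementary_smooth g \<Longrightarrow> elementary_smooth (\<lambda>x. f (g x))"

lemma elementary_smooth_has_derivative:
  assumes "elementary_smooth f"
  shows "\<exists>g. (\<forall>x. (f has_real_derivative g x) (at x)) \<and> elementary_smooth g"
  using assms
proof induction
  case (base f)
  then show ?case
    by (intro exI[of _ "deriv f"] conjI allI smooth_fun_has_derivative elementary_smooth.base
        smooth_fun_deriv)
next
  case (flat k)
  have "elementary_smooth (\<lambda>x. flat_fun (k + 2) x + (- real k) * flat_fun (k + 1) x)"
    by (intro elementary_smooth.add elementary_smooth.mult elementary_smooth.const elementary_smooth.flat)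
  then show ?case
    using flat_fun_has_derivative[of k]
    by (intro exI[of _ "\<lambda>x. flat_fun (k + 2) x + (- real k) * flat_fun (k + 1) x"]) simp
next
  case (const c)
  show ?case using elementary_smooth.const[of 0] by (intro exI[of _ "\<lambda>x. 0"]) simp
next
  case ident
  show ?case using elementary_smooth.const[of 1] by (intro exI[of _ "\<lambda>x. 1"]) simp
next
  case exp
  show ?case by (intro exI[of _ exp] conjI allI DERIV_exp elementary_smooth.exp)
next
  case sin
  show ?case by (intro exI[of _ cos] conjI allI DERIV_sin elementary_smooth.cos)
next
  case cos
  have "elementary_smooth (\<lambda>x. (-1) * sin x)"
    by (intro elementary_smooth.mult elementary_smooth.const elementary_smooth.sin)
  then show ?case by (intro exI[of _ "\<lambda>x. (-1) * sin x"]) simp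
next
  case (add f g)
  then obtain f' g' where "\<forall>x. (f has_real_derivative f' x) (at x)" "elementary_smooth f'"
    "\<forall>x. (g has_real_derivative g' x) (at x)" "elementary_smooth g'" by blast
  then show ?case
    by (intro exI[of _ "\<lambda>x. f' x + g' x"] conjI allI DERIV_add elementary_smooth.add) auto
next
  case (mult f g)
  then obtain f' g' where "\<forall>x. (f has_real_derivative f' x) (at x)" "elementary_smooth f'"
    "\<forall>x. (g has_real_derivative g' x) (at x)" "elementary_smooth g'" by blast
  then show ?case using mult.hyps
    by (intro exI[of _ "\<lambda>x. f' x * g x + g' x * f x"] conjI allI DERIV_mult
        elementary_smooth.add elementary_smooth.mult) auto
next
  case (comp f g)
  then obtain f' g' where "\<forall>x. (f has_real_derivative f' x) (at x)" "elementary_smooth f'"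
    "\<forall>x. (g has_real_derivative g' x) (at x)" "elementary_smooth g'" by blast
  moreover from this have "elementary_smooth (\<lambda>x. f' (g x) * g' x)"
    using comp.hyps by (intro elementary_smooth.mult[OF elementary_smooth.comp[of f' g]])
  ultimately show ?case
    by (intro exI[of _ "\<lambda>x. f' (g x) * g' x"] conjI allI DERIV_chain2) auto
qed

lemma smooth_fun_eq_elementary: "smooth_fun = elementary_smooth"
proof (intro ext iffI)
  fix f assume "elementary_smooth f"
  then show "smooth_fun f"
    by (rule smooth_fun_coinduct) (rule elementary_smooth_has_derivative)
qed (rule elementary_smooth.base)

lemmas smooth_fun_intros =
  elementary_smooth.intros(2-10)[folded smooth_fun_eq_elementary]

lemma smooth_fun_cmult: "smooth_fun f \<Longrightarrow> smooth_fun (\<lambda>x. c * f x)"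
  by (intro smooth_fun_intros(8) smooth_fun_intros(2))

lemma smooth_fun_diff: "smooth_fun f \<Longrightarrow> smooth_fun g \<Longrightarrow> smooth_fun (\<lambda>x. f x - g x)"
  using smooth_fun_intros(7)[of f "\<lambda>x. (-1) * g x"] smooth_fun_cmult[of g "-1"] by simp

lemmas smooth_fun_exp_comp = smooth_fun_intros(9)[OF smooth_fun_intros(4)]
  and smooth_fun_sin_comp = smooth_fun_intros(9)[OF smooth_fun_intros(5)]
  and smooth_fun_cos_comp = smooth_fun_intros(9)[OF smooth_fun_intros(6)]

section \<open>Test functions supported in compact intervals\<close>

lemma test_function_iff:
  "test_function \<phi> \<longleftrightarrow> smooth_fun \<phi> \<and> (\<exists>\<alpha> \<beta>. 0 < \<alpha> \<and> \<alpha> < \<beta> \<and> (\<forall>x. x \<notin> {\<alpha>..\<beta>} \<longrightarrow> \<phi> x = 0))"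
proof -
  have "(\<exists>K. compact K \<and> K \<subseteq> {0<..} \<and> (\<forall>x. x \<notin> K \<longrightarrow> \<phi> x = 0)) \<longleftrightarrow>
      (\<exists>\<alpha> \<beta>. 0 < \<alpha> \<and> \<alpha> < \<beta> \<and> (\<forall>x. x \<notin> {\<alpha>..\<beta>} \<longrightarrow> \<phi> x = 0))" (is "?L \<longleftrightarrow> ?R")
  proof
    assume ?L
    then obtain K where K: "compact K" "K \<subseteq> {0<..}" "\<forall>x. x \<notin> K \<longrightarrow> \<phi> x = 0" by blast
    show ?R
    proof (cases "K = {}")
      case True
      then show ?R using K by (intro exI[of _ 1] exI[of _ 2]) auto
    next
      case False
      obtain m M where mM: "m \<in> K" "\<forall>x\<in>K. m \<le> x" "M \<in> K" "\<forall>x\<in>K. x \<le> M"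
        using compact_attains_inf[OF K(1) False] compact_attains_sup[OF K(1) False] by blast
      \<comment> \<open>The right end is moved to M + 1 because the interval has to be nondegenerate
        even when \<open>K\<close> is a single point.\<close>
      then have "0 < m" "m < M + 1" using K(2) by auto force
      moreover have "\<phi> x = 0" if "x \<notin> {m..M + 1}" for x
      proof -
        have "x \<notin> K" using that mM(2,4) by force
        then show ?thesis using K(3) by blast
      qed
      ultimately show ?R by blast
    qed
  next
    assume ?R
    then obtain \<alpha> \<beta> where "0 < \<alpha>" "\<forall>x. x \<notin> {\<alpha>..\<beta>} \<longrightarrow> \<phi> x = 0" by blast
    then show ?L by (intro exI[of _ "{\<alpha>..\<beta>}"]) auto
  qed
  then show ?thesis by (simp add: test_function_def smooth_fun_def)
qed

lemma test_functionI:
  assumes "smooth_fun \<phi>" "0 < \<alpha>" "\<alpha> < \<beta>" "\<And>x. x \<notin> {\<alpha>..\<beta>} \<Longrightarrow> \<phi> x = 0"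
  shows "test_function \<phi>"
  using assms unfolding test_function_iff by blast

lemma test_function_mult: "test_function \<phi> \<Longrightarrow> smooth_fun f \<Longrightarrow> test_function (\<lambda>x. f x * \<phi> x)"
  unfolding test_function_iff by (auto intro!: smooth_fun_intros(8))

lemma test_function_diff:
  assumes "test_function \<phi>" "test_function \<psi>"
  shows "test_function (\<lambda>x. \<phi> x - \<psi> x)"
proof -
  obtain a b where "smooth_fun \<phi>" "0 < a" "a < b" "\<forall>x. x \<notin> {a..b} \<longrightarrow> \<phi> x = 0"
    using assms(1) unfolding test_function_iff by blast
  moreover obtain c d where "smooth_fun \<psi>" "0 < c" "c < d" "\<forall>x. x \<notin> {c..d} \<longrightarrow> \<psi> x = 0"
    using assms(2) unfolding test_function_iff by blast
  ultimately show ?thesis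
    by (intro test_functionI[of _ "min a c" "max b d"] smooth_fun_diff)
      (auto simp: min_le_iff_disj le_max_iff_disj)
qed

lemma test_function_deriv:
  assumes "test_function \<phi>"
  shows "test_function (deriv \<phi>)"
proof -
  obtain a b where ab: "0 < a" "a < b" "\<forall>x. x \<notin> {a..b} \<longrightarrow> \<phi> x = 0" and sm: "smooth_fun \<phi>"
    using assms unfolding test_function_iff by blast
  have "deriv \<phi> x = 0" if "x \<notin> {a..b}" for x
  proof -
    have "((\<lambda>x. 0) has_real_derivative 0) (at x)" by simp
    then have "(\<phi> has_real_derivative 0) (at x)"
      by (rule has_field_derivative_transform_within_open[of _ _ _ "- {a..b}"]) (use ab that in auto)
    then show ?thesis by (rule DERIV_imp_deriv)
  qed
  then show ?thesis
    using ab smooth_fun_deriv[OF sm] unfolding test_function_iff by blast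
qed

lemma test_function_iterated_deriv: "test_function \<phi> \<Longrightarrow> test_function ((deriv ^^ k) \<phi>)"
  by (induction k) (auto intro: test_function_deriv)

lemma test_function_has_derivative: "test_function \<phi> \<Longrightarrow> (\<phi> has_real_derivative deriv \<phi> x) (at x)"
  using smooth_fun_has_derivative test_function_iff by blast

lemma test_function_continuous: "test_function \<phi> \<Longrightarrow> continuous_on S \<phi>"
  using smooth_fun_continuous test_function_iff by blast

lemma test_function_bounded:
  assumes "test_function \<phi>"
  obtains M where "M > 0" "\<And>x. \<bar>\<phi> x\<bar> \<le> M"
proof -
  obtain a b where ab: "0 < a" "a < b" "\<forall>x. x \<notin> {a..b} \<longrightarrow> \<phi> x = 0"
    using assms unfolding test_function_iff by blast
  have "bounded (\<phi> ` {a..b})"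
    by (intro compact_imp_bounded compact_continuous_image test_function_continuous[OF assms]) simp
  then obtain M where "M > 0" "\<forall>x\<in>{a..b}. \<bar>\<phi> x\<bar> \<le> M"
    by (auto simp: bounded_pos)
  moreover from this have "\<bar>\<phi> x\<bar> \<le> M" for x
    using ab by (cases "x \<in> {a..b}") auto
  ultimately show thesis using that by blast
qed

section \<open>Bumps and smooth approximations of interval indicators\<close>

definition bump :: "real \<Rightarrow> real \<Rightarrow> real \<Rightarrow> real"
  where "bump \<alpha> \<beta> x = flat_fun 0 (x - \<alpha>) * flat_fun 0 (\<beta> - x)"

lemma bump_pos: "\<alpha> < x \<Longrightarrow> x < \<beta> \<Longrightarrow> bump \<alpha> \<beta> x > 0"
  and bump_zero: "\<not> (\<alpha> < x \<and> x < \<beta>) \<Longrightarrow> bump \<alpha> \<beta> x = 0"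
  by (auto simp: bump_def flat_fun_def)

lemma bump_nonneg: "bump \<alpha> \<beta> x \<ge> 0"
  by (auto simp: bump_def flat_fun_def)

lemma smooth_fun_bump: "smooth_fun (bump \<alpha> \<beta>)"
proof -
  have "smooth_fun (\<lambda>x. flat_fun 0 (x + (-\<alpha>)) * flat_fun 0 ((-1) * x + \<beta>))"
    by (intro smooth_fun_intros(8) smooth_fun_intros(9)[OF smooth_fun_intros(1)]
        smooth_fun_intros(2,3,7) smooth_fun_cmult)
  then show ?thesis unfolding bump_def by (simp add: algebra_simps)
qed

lemma test_function_bump: "0 < \<alpha> \<Longrightarrow> \<alpha> < \<beta> \<Longrightarrow> test_function (bump \<alpha> \<beta>)"
  by (rule test_functionI[of _ \<alpha> \<beta>]) (auto intro: smooth_fun_bump bump_zero)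

text \<open>Where the bump is positive the exponential tends to 0 as n grows, elsewhere it stays 1;
  these test functions increase to the indicator of the open interval with values in [0, 1]
  throughout.\<close>

definition smooth_indicator :: "nat \<Rightarrow> real \<Rightarrow> real \<Rightarrow> real \<Rightarrow> real"
  where "smooth_indicator n \<alpha> \<beta> x = 1 - exp (- real n * bump \<alpha> \<beta> x)"

lemma test_function_smooth_indicator:
  assumes "0 < \<alpha>" "\<alpha> < \<beta>"
  shows "test_function (smooth_indicator n \<alpha> \<beta>)"
proof -
  have "smooth_fun (\<lambda>x. 1 - exp (- real n * bump \<alpha> \<beta> x))"
    by (intro smooth_fun_diff smooth_fun_intros(2) smooth_fun_exp_comp smooth_fun_cmult smooth_fun_bump)
  then show ?thesis
    unfolding smooth_indicator_def using assms
    by (intro test_functionI[of _ \<alpha> \<beta>]) (auto simp: bump_zero)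
qed

lemma smooth_indicator_bounds: "0 \<le> smooth_indicator n \<alpha> \<beta> x" "smooth_indicator n \<alpha> \<beta> x \<le> 1"
  using bump_nonneg[of \<alpha> \<beta> x] by (auto simp: smooth_indicator_def)

lemma smooth_indicator_zero: "\<not> (\<alpha> < x \<and> x < \<beta>) \<Longrightarrow> smooth_indicator n \<alpha> \<beta> x = 0"
  by (auto simp: smooth_indicator_def bump_zero)

lemma smooth_indicator_tendsto:
  "(\<lambda>n. smooth_indicator n \<alpha> \<beta> x) \<longlonglongrightarrow> indicator {\<alpha><..<\<beta>} x"
proof (cases "\<alpha> < x \<and> x < \<beta>")
  case True
  have "filterlim (\<lambda>n. bump \<alpha> \<beta> x * real n) at_top sequentially"
    using True bump_pos by (intro filterlim_tendsto_pos_mult_at_top[OF tendsto_const]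
        filterlim_real_sequentially) auto
  then have "(\<lambda>n. exp (- (bump \<alpha> \<beta> x * real n))) \<longlonglongrightarrow> 0"
    by (intro filterlim_compose[OF exp_at_bot]) (simp add: filterlim_uminus_at_bot)
  then have "(\<lambda>n. 1 - exp (- (bump \<alpha> \<beta> x * real n))) \<longlonglongrightarrow> 1 - 0"
    by (intro tendsto_intros)
  then show ?thesis using True by (simp add: smooth_indicator_def mult.commute)
qed (auto simp: smooth_indicator_zero)

section \<open>The fundamental lemma of the calculus of variations\<close>

lemma lebesgue_integral_restrict_half_line:
  fixes f :: "real \<Rightarrow> 'a::{banach, second_countable_topology}"
  shows "integral\<^sup>L half_line f = (LINT x|lebesgue. indicator {0<..} x *\<^sub>R f x)"
  by (subst integral_restrict_space) auto

lemma integrable_half_line_iff: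
  fixes f :: "real \<Rightarrow> 'a::{banach, second_countable_topology}"
  shows "integrable half_line f \<longleftrightarrow> integrable lebesgue (\<lambda>x. indicator {0<..} x *\<^sub>R f x)"
  by (subst integrable_restrict_space) auto

lemma sigma_finite_lebesgue: "sigma_finite_measure (lebesgue :: real measure)"
proof
  obtain A :: "real set set" where A: "countable A" "A \<subseteq> sets lborel" "\<Union>A = space lborel" "\<forall>a\<in>A. emeasure lborel a \<noteq> \<infinity>"
    using lborel.sigma_finite_countable by blast
  then show "\<exists>A. countable A \<and> A \<subseteq> sets (lebesgue :: real measure) \<and> \<Union> A = space lebesgue \<and> (\<forall>a\<in>A. emeasure lebesgue a \<noteq> \<infinity>)"
    by (intro exI[of _ A] conjI) auto
qed

text \<open>Dynkin argument: open intervals generate the Borel sets and are stable under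
  intersection, and the sets with vanishing integral are closed under complements, by
  \<open>total\<close>, and under countable disjoint unions. A function whose integral over every
  set vanishes is null.\<close>

lemma AE_zero_of_interval_integrals:
  fixes f :: "real \<Rightarrow> complex"
  assumes f: "integrable lebesgue f"
    and total: "integral\<^sup>L lebesgue f = 0"
    and intervals: "\<And>a b. a < b \<Longrightarrow> set_lebesgue_integral lebesgue {a<..<b} f = 0"
  shows "AE x in lebesgue. f x = 0"
proof (rule sigma_finite_measure.density_zero[OF sigma_finite_lebesgue f])
  have int: "set_integrable lebesgue B f" if "B \<in> sets lebesgue" for B
    unfolding set_integrable_def using f that integrable_mult_indicator by blast
  have borel: "set_lebesgue_integral lebesgue B f = 0" if "B \<in> sets borel" for B
  proof -
    let ?G = "range (\<lambda>(a, b). {a<..<b::real})"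
    have gen: "sets borel = sigma_sets UNIV ?G"
    proof -
      have "(\<lambda>(a, b). box a b) = (\<lambda>(a, b). {a<..<b::real})" by auto
      then show ?thesis by (simp only: borel_eq_box sets_measure_of_conv) simp
    qed
    have leb: "C \<in> sets lebesgue" if "C \<in> sigma_sets UNIV ?G" for C
      using that unfolding gen[symmetric] by simp
    have sub: "?G \<subseteq> Pow UNIV" by simp
    have stable: "Int_stable ?G"
      by (auto simp: Int_stable_def intro!: image_eqI[of _ _ "(max _ _, min _ _)"])
    have "B \<in> sigma_sets UNIV ?G" using that gen by simp
    then show ?thesis
    proof (induction B rule: sigma_sets_induct_disjoint[OF stable sub, consumes 1, case_names basic empty compl union])
      case (basic A)
      then obtain a b where "A = {a<..<b}" by auto
      then show ?case using intervals[of a b] by (cases "a < b") (auto simp: set_lebesgue_integral_def)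
    next
      case (compl A)
      have "set_lebesgue_integral lebesgue (UNIV - A) f
          = (LINT x|lebesgue. f x - indicator A x *\<^sub>R f x)"
        unfolding set_lebesgue_integral_def
        by (intro Bochner_Integration.integral_cong) (auto simp: indicator_def)
      also have "\<dots> = integral\<^sup>L lebesgue f - set_lebesgue_integral lebesgue A f"
        unfolding set_lebesgue_integral_def
        using f int[OF leb[OF compl.hyps]] unfolding set_integrable_def by simp
      finally show ?case using compl total by simp
    next
      case (union A)
      have m: "A i \<in> sets lebesgue" for i
        using union.hyps leb by blast
      have "(LINT x:(\<Union>i. A i)|lebesgue. f x) = (\<Sum>i. (LINT x:(A i)|lebesgue. f x))"
        using union.hyps(1) m by (intro lebesgue_integral_countable_add int sets.countable_UN)
          (auto simp: disjoint_family_on_def)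
      then show ?case using union by simp
    qed (simp add: set_lebesgue_integral_def)
  qed
  fix A :: "real set" assume "A \<in> sets lebesgue"
  \<comment> \<open>A Lebesgue set is a Borel set up to part of a null set, so the Borel case
    suffices.\<close>
  then obtain S N N' where A: "A = S \<union> N" "N \<subseteq> N'" "N' \<in> null_sets lborel" "S \<in> sets lborel"
    by (elim sets_completionE) auto
  have "AE x in lebesgue. x \<notin> N'"
    using A(3) by (auto intro: AE_not_in null_sets_completionI)
  then have "set_lebesgue_integral lebesgue A f = set_lebesgue_integral lebesgue S f"
    unfolding set_lebesgue_integral_def
    using A \<open>A \<in> sets lebesgue\<close> f
    by (intro integral_cong_AE borel_measurable_scaleR borel_measurable_indicator)
      (auto simp: indicator_def elim!: eventually_mono)
  then show "set_lebesgue_integral lebesgue A f = 0"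
    using borel A by simp
qed

text \<open>Integrability is asked only on compact intervals of the open half-line.
  Square-integrable functions multiplied by growing exponentials still qualify, as the integrating
  factor below requires.\<close>

definition locally_integrable :: "(real \<Rightarrow> complex) \<Rightarrow> bool"
  where "locally_integrable f \<longleftrightarrow> (\<forall>\<alpha> \<beta>. 0 < \<alpha> \<longrightarrow> \<alpha> < \<beta> \<longrightarrow> set_integrable lebesgue {\<alpha>..\<beta>} f)"

lemma locally_integrable_diff:
  "locally_integrable f \<Longrightarrow> locally_integrable g \<Longrightarrow> locally_integrable (\<lambda>x. f x - g x)"
  unfolding locally_integrable_def by (auto intro: set_integral_diff)

lemma locally_integrable_const: "locally_integrable (\<lambda>x. c)"
  unfolding locally_integrable_def set_integrable_def by (auto intro: integrable_completion[THEN iffD2])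

lemma locally_integrable_mult_bounded:
  assumes f: "locally_integrable f" and g: "g \<in> borel_measurable lebesgue"
    and M: "\<And>x. cmod (g x) \<le> M" and supp: "0 < \<alpha>" "\<alpha> < \<beta>" "\<And>x. x \<notin> {\<alpha>..\<beta>} \<Longrightarrow> g x = 0"
  shows "integrable lebesgue (\<lambda>x. f x * g x)"
proof -
  have i: "integrable lebesgue (\<lambda>x. indicator {\<alpha>..\<beta>} x *\<^sub>R f x)"
    using f supp unfolding locally_integrable_def set_integrable_def by blast
  have eq: "f x * g x = (indicator {\<alpha>..\<beta>} x *\<^sub>R f x) * g x" for x
    using supp(3)[of x] by (auto simp: indicator_def)
  have "integrable lebesgue (\<lambda>x. (indicator {\<alpha>..\<beta>} x *\<^sub>R f x) * g x)"
  proof (rule Bochner_Integration.integrable_bound)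
    show "integrable lebesgue (\<lambda>x. M *\<^sub>R (indicator {\<alpha>..\<beta>} x *\<^sub>R f x))"
      using i by (rule integrable_scaleR_right)
    show "(\<lambda>x. (indicator {\<alpha>..\<beta>} x *\<^sub>R f x) * g x) \<in> borel_measurable lebesgue"
      using i g by (intro borel_measurable_times) auto
    have "M \<ge> 0" using M[of 0] norm_ge_zero[of "g 0"] by linarith
    then show "AE x in lebesgue. norm ((indicator {\<alpha>..\<beta>} x *\<^sub>R f x) * g x)
        \<le> norm (M *\<^sub>R (indicator {\<alpha>..\<beta>} x *\<^sub>R f x))"
      using M by (intro AE_I2) (auto simp: norm_mult indicator_def mult.commute[of M] intro!: mult_left_mono)
  qed
  then show ?thesis unfolding eq .
qed

lemma borel_measurable_test_function:
  assumes "test_function \<phi>" shows "(\<lambda>x. complex_of_real (\<phi> x)) \<in> borel_measurable lebesgue"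
  by (intro measurable_completion borel_measurable_of_real)
    (use borel_measurable_continuous_onI[OF test_function_continuous[OF assms]] in auto)

lemma integrable_mult_test_function:
  assumes f: "locally_integrable f" and \<phi>: "test_function \<phi>"
  shows "integrable lebesgue (\<lambda>x. f x * complex_of_real (\<phi> x))"
proof -
  obtain M where M: "\<And>x. \<bar>\<phi> x\<bar> \<le> M" using test_function_bounded[OF \<phi>] by blast
  obtain \<alpha> \<beta> where "0 < \<alpha>" "\<alpha> < \<beta>" "\<forall>x. x \<notin> {\<alpha>..\<beta>} \<longrightarrow> \<phi> x = 0"
    using \<phi> unfolding test_function_iff by blast
  then show ?thesis
    using M by (intro locally_integrable_mult_bounded[OF f borel_measurable_test_function[OF \<phi>], of M \<alpha> \<beta>]) auto
qed

lemma half_line_test_function: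
  assumes "test_function \<phi>"
  shows "(LINT x|half_line. f x * complex_of_real (\<phi> x)) = (LINT x|lebesgue. f x * complex_of_real (\<phi> x))"
proof -
  obtain \<alpha> \<beta> where "0 < \<alpha>" "\<forall>x. x \<notin> {\<alpha>..\<beta>} \<longrightarrow> \<phi> x = 0"
    using assms unfolding test_function_iff by blast
  then have "indicator {0<..} x *\<^sub>R (f x * complex_of_real (\<phi> x)) = f x * complex_of_real (\<phi> x)" for x
    by (cases "x \<in> {\<alpha>..\<beta>}") auto
  then show ?thesis by (simp add: lebesgue_integral_restrict_half_line)
qed

text \<open>Smooth indicators are dominated by the indicator of their interval, so dominated
  convergence turns the hypothesis into vanishing integrals over all intervals away from 0.\<close>

theorem fundamental_lemma:
  assumes f: "locally_integrable f"
    and zero: "\<And>\<phi>. test_function \<phi> \<Longrightarrow> (LINT x|half_line. f x * complex_of_real (\<phi> x)) = 0"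
  shows "AE x in half_line. f x = 0"
proof -
  have int: "set_integrable lebesgue {\<alpha><..<\<beta>} f" if "0 < \<alpha>" "\<alpha> < \<beta>" for \<alpha> \<beta>
    using f that unfolding locally_integrable_def
    by (auto intro: set_integrable_subset[of _ "{\<alpha>..\<beta>}"])
  have intervals: "set_lebesgue_integral lebesgue {\<alpha><..<\<beta>} f = 0" if "0 < \<alpha>" for \<alpha> \<beta>
  proof (cases "\<alpha> < \<beta>")
    case True
    have "(\<lambda>n. LINT x|lebesgue. f x * complex_of_real (smooth_indicator n \<alpha> \<beta> x))
        \<longlonglongrightarrow> (LINT x|lebesgue. indicator {\<alpha><..<\<beta>} x *\<^sub>R f x)"
    proof (rule integral_dominated_convergence)
      show "integrable lebesgue (\<lambda>x. norm (indicator {\<alpha><..<\<beta>} x *\<^sub>R f x))"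
        using int[OF that True] unfolding set_integrable_def by (rule integrable_norm)
      show "(\<lambda>x. indicator {\<alpha><..<\<beta>} x *\<^sub>R f x) \<in> borel_measurable lebesgue"
        using int[OF that True] unfolding set_integrable_def by auto
      show "(\<lambda>x. f x * complex_of_real (smooth_indicator n \<alpha> \<beta> x)) \<in> borel_measurable lebesgue" for n
        using integrable_mult_test_function[OF f test_function_smooth_indicator[OF that True]] by auto
      have "(\<lambda>n. f x * complex_of_real (smooth_indicator n \<alpha> \<beta> x))
          \<longlonglongrightarrow> f x * complex_of_real (indicator {\<alpha><..<\<beta>} x)" for x
        by (intro tendsto_intros smooth_indicator_tendsto)
      then show "AE x in lebesgue. (\<lambda>n. f x * complex_of_real (smooth_indicator n \<alpha> \<beta> x))
          \<longlonglongrightarrow> indicator {\<alpha><..<\<beta>} x *\<^sub>R f x"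
        by (simp add: scaleR_conv_of_real mult.commute)
      show "AE x in lebesgue. norm (f x * complex_of_real (smooth_indicator n \<alpha> \<beta> x))
          \<le> norm (indicator {\<alpha><..<\<beta>} x *\<^sub>R f x)" for n
        using smooth_indicator_bounds[of n \<alpha> \<beta>] smooth_indicator_zero[of \<alpha> _ \<beta> n]
        by (intro AE_I2) (auto simp: norm_mult indicator_def intro: mult_left_le)
    qed
    moreover have "(LINT x|lebesgue. f x * complex_of_real (smooth_indicator n \<alpha> \<beta> x)) = 0" for n
      using zero half_line_test_function test_function_smooth_indicator[OF that True] by metis
    ultimately show ?thesis
      by (simp add: set_lebesgue_integral_def LIMSEQ_const_iff)
  qed (simp add: set_lebesgue_integral_def)
  \<comment> \<open>Countably many bounded intervals exhaust the half-line; cut off to one of them,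
    the function is integrable on the whole line and the previous criterion applies.\<close>
  have "AE x in lebesgue. \<forall>n::nat. indicator {1 / (n + 1)<..<n + 2} x *\<^sub>R f x = 0"
  proof (subst AE_all_countable, intro allI)
    fix n :: nat
    let ?I = "{1 / (real n + 1)<..<real n + 2}"
    have n: "0 < 1 / (real n + 1)" "1 / (real n + 1) < real n + 2"
      by (auto intro: le_less_trans[of _ 1])
    show "AE x in lebesgue. indicator ?I x *\<^sub>R f x = 0"
    proof (rule AE_zero_of_interval_integrals)
      show "integrable lebesgue (\<lambda>x. indicator ?I x *\<^sub>R f x)"
        using int[OF n] unfolding set_integrable_def .
      show "(LINT x|lebesgue. indicator ?I x *\<^sub>R f x) = 0"
        using intervals[OF n(1)] unfolding set_lebesgue_integral_def .
      fix a b :: real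
      have "indicator {a<..<b} x *\<^sub>R (indicator ?I x *\<^sub>R f x)
          = indicator {max a (1 / (real n + 1))<..<min b (real n + 2)} x *\<^sub>R f x" for x
        by (auto simp: indicator_def)
      then show "set_lebesgue_integral lebesgue {a<..<b} (\<lambda>x. indicator ?I x *\<^sub>R f x) = 0"
        using intervals[of "max a (1 / (real n + 1))"] n unfolding set_lebesgue_integral_def
        by (simp add: less_max_iff_disj del: scaleR_scaleR)
    qed
  qed
  then show ?thesis
  proof (subst AE_restrict_space_iff, goal_cases)
    case 2
    then show ?case
    proof eventually_elim
      case (elim x)
      show ?case
      proof
        assume "x \<in> {0<..}"
        then obtain n where "1 / (real n + 1) < x" "x < real n + 2"
        proof -
          obtain m where m: "1 / x < real m" using reals_Archimedean2 by blast
          obtain k where k: "x < real k" using reals_Archimedean2 by blast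
          have "1 / x < real (max m k) + 1" "x < real (max m k) + 2" using m k by (auto simp: max_def)
          then show thesis using that[of "max m k"] \<open>x \<in> {0<..}\<close> by (auto simp: field_simps)
        qed
        then show "f x = 0" using elim[rule_format, of n] by (auto simp: add.commute)
      qed
    qed
  qed auto
qed

text \<open>The primitive from 0 vanishes to the left of the support; to the right it equals the
  total integral, and mean zero makes it vanish there as well.\<close>

lemma smooth_antiderivative:
  assumes g: "test_function g" and zero: "(LINT x|half_line. g x) = 0"
  obtains \<psi> where "test_function \<psi>" "deriv \<psi> = g"
proof -
  obtain \<alpha> \<beta> where ab: "0 < \<alpha>" "\<alpha> < \<beta>" "\<forall>x. x \<notin> {\<alpha>..\<beta>} \<longrightarrow> g x = 0" and sm: "smooth_fun g"
    using g unfolding test_function_iff by blast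
  define \<psi> where "\<psi> x = integral {0..x} g" for x
  have cont: "continuous_on S g" for S using test_function_continuous[OF g] .
  have int: "g integrable_on {a..b}" for a b by (rule integrable_continuous_real[OF cont])
  have low: "\<psi> x = 0" if "x < \<alpha>" for x
    unfolding \<psi>_def using that ab by (intro integral_unique has_integral_is_0) auto
  have "(g has_integral integral {\<alpha>..\<beta>} g) {\<alpha>..\<beta>}" using int by blast
  then have ab_int: "(g has_integral integral {\<alpha>..\<beta>} g) S" if "{\<alpha>..\<beta>} \<subseteq> S" for S
    by (rule has_integral_on_superset) (use ab that in auto)
  have "integrable half_line (\<lambda>x. g x)"
  proof -
    have "integrable lebesgue (\<lambda>x. (1::complex) * complex_of_real (g x))"
      by (rule integrable_mult_test_function[OF locally_integrable_const g])
    then have "integrable lebesgue g" by (simp add: complex_of_real_integrable_eq)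
    then show ?thesis unfolding integrable_half_line_iff by (intro integrable_mult_indicator) auto
  qed
  then have "integral {0<..} g = 0"
    using zero by (subst (asm) lebesgue_integral_eq_integral) auto
  moreover have "integral {0<..} g = integral {\<alpha>..\<beta>} g"
    by (rule integral_unique[OF ab_int]) (use ab in auto)
  ultimately have "integral {\<alpha>..\<beta>} g = 0" by simp
  then have high: "\<psi> x = 0" if "x > \<beta>" for x
    unfolding \<psi>_def using integral_unique[OF ab_int, of "{0..x}"] that ab by auto
  have deriv: "(\<psi> has_real_derivative g x) (at x)" for x
  proof (cases "x < \<alpha>")
    case True
    have "((\<lambda>x. 0) has_real_derivative 0) (at x)" by simp
    then have "(\<psi> has_real_derivative 0) (at x)"
      by (rule has_field_derivative_transform_within_open[of _ _ _ "{..<\<alpha>}"]) (use True low in auto)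
    then show ?thesis using True ab by auto
  next
    case False
    have "(\<psi> has_real_derivative g x) (at x within {0..x + 1})"
      unfolding \<psi>_def by (rule integral_has_real_derivative[OF cont]) (use False ab in auto)
    then show ?thesis
      using at_within_interior[of x "{0..x + 1}"] False ab by (simp add: interior_atLeastAtMost_real)
  qed
  have "test_function \<psi>"
    by (rule test_functionI[OF smooth_fun_integral[OF deriv sm] ab(1,2)]) (use low high in force)
  then show thesis using that deriv DERIV_imp_deriv by blast
qed

text \<open>Modulo derivatives of test functions, every test function \<phi> is a multiple of one
  fixed \<rho> of integral 1: with J the integral of \<phi>, the difference \<phi> - J \<rho> has
  mean zero. So f acts on \<phi> like the constant c, the integral of f \<rho>.\<close>

theorem du_Bois_Reymond:
  assumes f: "locally_integrable f"
    and zero: "\<And>\<psi>. test_function \<psi> \<Longrightarrow> (LINT x|half_line. f x * complex_of_real (deriv \<psi> x)) = 0"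
  obtains c where "AE x in half_line. f x = c"
proof -
  have li: "locally_integrable (\<lambda>x. 1)" by (rule locally_integrable_const)
  have int1: "integrable lebesgue \<phi>" if "test_function \<phi>" for \<phi>
    using integrable_mult_test_function[OF li that] by (simp add: complex_of_real_integrable_eq)
  have half: "integral\<^sup>L half_line \<phi> = integral\<^sup>L lebesgue \<phi>" if "test_function \<phi>" for \<phi>
    using half_line_test_function[OF that, of "\<lambda>x. 1"] by simp
  define \<rho>0 where "\<rho>0 = bump 1 2"
  have t0: "test_function \<rho>0" unfolding \<rho>0_def by (rule test_function_bump) auto
  define I where "I = integral\<^sup>L lebesgue \<rho>0"
  have "I \<noteq> 0"
  proof
    assume "I = 0"
    then have "AE x in lebesgue. \<rho>0 x = 0"
      unfolding I_def using integral_nonneg_eq_0_iff_AE[OF int1[OF t0]]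
      by (auto simp: \<rho>0_def bump_nonneg)
    then have "AE x in lebesgue. x \<notin> {1<..<2::real}"
      by eventually_elim (use bump_pos[of 1 _ 2] in \<open>force simp: \<rho>0_def\<close>)
    then have "emeasure lebesgue {1<..<2::real} = 0"
      by (subst (asm) AE_iff_measurable[of "{1<..<2}"]) auto
    then show False by simp
  qed
  define \<rho> where "\<rho> x = inverse I * \<rho>0 x" for x
  have t\<rho>: "test_function \<rho>"
    unfolding \<rho>_def by (rule test_function_mult[OF t0 smooth_fun_intros(2)])
  have \<rho>1: "integral\<^sup>L lebesgue \<rho> = 1"
    unfolding \<rho>_def using \<open>I \<noteq> 0\<close> by (simp add: I_def)
  define c where "c = (LINT x|lebesgue. f x * complex_of_real (\<rho> x))"
  have "AE x in half_line. f x - c = 0"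
  proof (rule fundamental_lemma[OF locally_integrable_diff[OF f locally_integrable_const]])
    fix \<phi> assume \<phi>: "test_function \<phi>"
    define J where "J = integral\<^sup>L lebesgue \<phi>"
    have tJ: "test_function (\<lambda>x. J * \<rho> x)"
      by (rule test_function_mult[OF t\<rho> smooth_fun_intros(2)])
    have t: "test_function (\<lambda>x. \<phi> x - J * \<rho> x)"
      by (rule test_function_diff[OF \<phi> tJ])
    have "(LINT x|half_line. \<phi> x - J * \<rho> x) = 0"
      using half[OF t] int1[OF \<phi>] int1[OF t\<rho>] \<rho>1 by (simp add: J_def)
    then obtain \<psi> where \<psi>: "test_function \<psi>" "deriv \<psi> = (\<lambda>x. \<phi> x - J * \<rho> x)"
      using smooth_antiderivative[OF t] by blast
    note i = integrable_mult_test_function[OF f \<phi>] integrable_mult_test_function[OF f t\<rho>]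
      integrable_mult_test_function[OF locally_integrable_const \<phi>, of c]
    have "0 = (LINT x|lebesgue. f x * complex_of_real (deriv \<psi> x))"
      using zero[OF \<psi>(1)] half_line_test_function[OF test_function_deriv[OF \<psi>(1)], of f] by simp
    also have "\<dots> = (LINT x|lebesgue. f x * complex_of_real (\<phi> x) - of_real J * (f x * complex_of_real (\<rho> x)))"
      by (simp add: \<psi>(2) algebra_simps)
    also have "\<dots> = (LINT x|lebesgue. f x * complex_of_real (\<phi> x)) - of_real J * c"
      using i by (simp add: c_def)
    also have "of_real J * c = (LINT x|lebesgue. c * complex_of_real (\<phi> x))"
      using int1[OF \<phi>] by (simp add: J_def)
    finally show "(LINT x|half_line. (f x - c) * complex_of_real (\<phi> x)) = 0"
      unfolding half_line_test_function[OF \<phi>] using i by (simp add: left_diff_distrib)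
  qed
  then show thesis using that[of c] by simp
qed

section \<open>The Hilbert space of square-integrable functions\<close>

lemma square_integrable_rep_l2: "square_integrable (rep_l2 u)"
  using Quotient3_rep_reflp[OF Quotient3_l2, of u] by (simp add: l2_rel_def)

lemma AE_rep_abs_l2: "square_integrable f \<Longrightarrow> AE x in half_line. rep_l2 (abs_l2 f) x = f x"
  using Quotient3_rep_abs[OF Quotient3_l2, of f] by (auto simp: l2_rel_def)

lemma l2_eqI:
  assumes "AE x in half_line. rep_l2 u x = rep_l2 v x"
  shows "u = v"
  using assms Quotient3_rel_rep[OF Quotient3_l2, of u v] square_integrable_rep_l2
  by (simp add: l2_rel_def)

lemma abs_l2_eqI:
  assumes "square_integrable f" "square_integrable g" "AE x in half_line. f x = g x"
  shows "abs_l2 f = abs_l2 g"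
  using assms Quotient3_rel_abs[OF Quotient3_l2, of f g] by (simp add: l2_rel_def)

lemma abs_rep_l2: "abs_l2 (rep_l2 u) = u"
  using Quotient3_abs_rep[OF Quotient3_l2] .

lemma abs_l2_cong_rep:
  assumes "square_integrable f" "AE x in half_line. f x = rep_l2 u x"
  shows "abs_l2 f = u"
  using abs_l2_eqI[OF assms(1) square_integrable_rep_l2 assms(2)] abs_rep_l2 by simp

lemma measurable_rep_l2 [measurable]: "rep_l2 u \<in> borel_measurable half_line"
  using square_integrable_rep_l2 by (auto simp: square_integrable_def)

lemma integrable_rep_l2_sq: "integrable half_line (\<lambda>x. (cmod (rep_l2 u x))\<^sup>2)"
  using square_integrable_rep_l2 by (auto simp: square_integrable_def)

lemma AE_rep_l2_add: "AE x in half_line. rep_l2 (u + v) x = rep_l2 u x + rep_l2 v x"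
  and AE_rep_l2_diff: "AE x in half_line. rep_l2 (u - v) x = rep_l2 u x - rep_l2 v x"
  and AE_rep_l2_scaleC: "AE x in half_line. rep_l2 (c *\<^sub>C u) x = c * rep_l2 u x"
  and AE_rep_l2_zero: "AE x in half_line. rep_l2 0 x = 0"
  unfolding plus_l2_def minus_l2_def scaleC_l2_def zero_l2_def
  by (auto simp: map_fun_def intro!: AE_rep_abs_l2 square_integrable_rep_l2 square_integrable_add
      square_integrable_diff square_integrable_mult_const square_integrable_minus square_integrable_zero)

lemma norm_l2_sq: "(norm u)\<^sup>2 = (LINT x|half_line. (cmod (rep_l2 u x))\<^sup>2)"
  unfolding norm_l2_def l2_norm_def by simp

lemma norm_abs_l2_sq:
  assumes "square_integrable f"
  shows "(norm (abs_l2 f))\<^sup>2 = (LINT x|half_line. (cmod (f x))\<^sup>2)"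
  unfolding norm_l2_sq using AE_rep_abs_l2[OF assms] assms
  by (intro integral_cong_AE) (auto simp: square_integrable_def)

lemma square_integrable_iff_nn:
  "square_integrable f \<longleftrightarrow> f \<in> borel_measurable half_line \<and>
     (\<integral>\<^sup>+x. ennreal ((cmod (f x))\<^sup>2) \<partial>half_line) < \<infinity>"
  unfolding square_integrable_def by (auto simp: integrable_iff_bounded)

lemma nn_integral_rep_l2: "(\<integral>\<^sup>+x. ennreal ((cmod (rep_l2 u x))\<^sup>2) \<partial>half_line) = ennreal ((norm u)\<^sup>2)"
  unfolding norm_l2_sq by (intro nn_integral_eq_integral integrable_rep_l2_sq) auto

lemma nn_integral_abs_l2:
  "square_integrable f \<Longrightarrow>
    (\<integral>\<^sup>+x. ennreal ((cmod (f x))\<^sup>2) \<partial>half_line) = ennreal ((norm (abs_l2 f))\<^sup>2)"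
  unfolding norm_abs_l2_sq by (intro nn_integral_eq_integral) (auto simp: square_integrable_def)

lemma nn_integral_rep_l2_diff:
  "(\<integral>\<^sup>+x. ennreal ((cmod (rep_l2 u x - rep_l2 v x))\<^sup>2) \<partial>half_line) = ennreal ((norm (u - v))\<^sup>2)"
  unfolding nn_integral_rep_l2[symmetric]
  by (rule nn_integral_cong_AE) (use AE_rep_l2_diff[of u v] in eventually_elim, simp)

lemma norm_l2_leI:
  assumes f: "f \<in> borel_measurable half_line"
    and le: "(\<integral>\<^sup>+x. ennreal ((cmod (f x))\<^sup>2) \<partial>half_line) \<le> ennreal (C\<^sup>2)" and C: "C \<ge> 0"
  shows "square_integrable f" "norm (abs_l2 f) \<le> C"
proof -
  show sq: "square_integrable f"
    unfolding square_integrable_iff_nn using f le_less_trans[OF le ennreal_less_top] by simp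
  have "(norm (abs_l2 f))\<^sup>2 \<le> C\<^sup>2"
    using le unfolding nn_integral_abs_l2[OF sq] by (simp add: ennreal_le_iff)
  then show "norm (abs_l2 f) \<le> C"
    using C by (rule power2_le_imp_le)
qed

section \<open>Completeness (Riesz-Fischer)\<close>

lemma Cauchy_fast_subsequence:
  fixes X :: "nat \<Rightarrow> 'a::metric_space"
  assumes "Cauchy X"
  obtains r where "strict_mono r" "\<And>n m. m \<ge> n \<Longrightarrow> dist (X (r n)) (X (r m)) < (1/4) ^ n"
proof -
  have "\<exists>N. \<forall>m\<ge>N. \<forall>k\<ge>N. dist (X m) (X k) < (1/4) ^ n" for n :: nat
    using assms unfolding Cauchy_def by (meson zero_less_divide_1_iff zero_less_numeral zero_less_power)
  then obtain N where N: "\<And>n m k. m \<ge> N n \<Longrightarrow> k \<ge> N n \<Longrightarrow> dist (X m) (X k) < (1/4) ^ (n::nat)"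
    by metis
  define r where "r = rec_nat (N 0) (\<lambda>n p. Suc (max p (N (Suc n))))"
  have r: "r n \<ge> N n" for n by (cases n) (auto simp: r_def)
  have "strict_mono r" by (auto simp: strict_mono_Suc_iff r_def)
  moreover have "dist (X (r n)) (X (r m)) < (1/4) ^ n" if "m \<ge> n" for n m
    using N[OF r[of n], of "r m"] r[of n] strict_mono_less_eq[OF \<open>strict_mono r\<close>, of n m] that by simp
  ultimately show thesis using that by blast
qed

text \<open>Along the fast subsequence the squared increments have integrals at most 16^-n, which
  leaves room for weights 2^n. A finite weighted sum almost everywhere gives geometric pointwise
  increments, hence a pointwise limit; Fatou's lemma makes it a limit in norm.\<close>

instance l2 :: complete_space
proof
  fix X :: "nat \<Rightarrow> l2" assume "Cauchy X"
  obtain r where r: "strict_mono r" "\<And>n m. m \<ge> n \<Longrightarrow> dist (X (r n)) (X (r m)) < (1/4) ^ n"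
    using Cauchy_fast_subsequence[OF \<open>Cauchy X\<close>] by blast
  define f where "f n = rep_l2 (X (r n))" for n
  have [measurable]: "f n \<in> borel_measurable half_line" for n
    unfolding f_def by measurable
  have nn: "(\<integral>\<^sup>+x. ennreal ((cmod (f n x - f m x))\<^sup>2) \<partial>half_line) \<le> ennreal (((1/4) ^ n)\<^sup>2)" if "m \<ge> n" for n m
    unfolding f_def nn_integral_rep_l2_diff using r(2)[OF that]
    by (intro ennreal_leI power_mono) (auto simp: dist_norm)
  have "(\<integral>\<^sup>+x. (\<Sum>n. ennreal (2 ^ n) * ennreal ((cmod (f n x - f (Suc n) x))\<^sup>2)) \<partial>half_line)
      = (\<Sum>n. ennreal (2 ^ n) * (\<integral>\<^sup>+x. ennreal ((cmod (f n x - f (Suc n) x))\<^sup>2) \<partial>half_line))"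
    by (subst nn_integral_suminf) (auto simp: nn_integral_cmult)
  also have "\<dots> \<le> (\<Sum>n. ennreal (2 ^ n) * ennreal (((1/4) ^ n)\<^sup>2))"
    by (intro suminf_le mult_left_mono nn) auto
  also have "\<dots> = (\<Sum>n. ennreal ((1/8) ^ n))"
  proof -
    have "(2::real) ^ n * ((1/4) ^ n)\<^sup>2 = (1/8) ^ n" for n
      by (simp add: power2_eq_square flip: power_mult_distrib)
    then show ?thesis by (simp flip: ennreal_mult)
  qed
  also have "\<dots> = ennreal (\<Sum>n. (1/8) ^ n)"
    by (intro suminf_ennreal2) auto
  also have "\<dots> < \<infinity>" by simp
  finally have "AE x in half_line. (\<Sum>n. ennreal (2 ^ n) * ennreal ((cmod (f n x - f (Suc n) x))\<^sup>2)) \<noteq> \<infinity>"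
    by (intro nn_integral_noteq_infinite) auto
  then have conv: "AE x in half_line. convergent (\<lambda>n. f n x)"
  proof eventually_elim
    case (elim x)
    define d where "d n = cmod (f n x - f (Suc n) x)" for n
    have "(\<Sum>n. ennreal (2 ^ n * (d n)\<^sup>2)) \<noteq> \<infinity>"
      using elim by (simp add: d_def ennreal_mult)
    then have "summable (\<lambda>n. 2 ^ n * (d n)\<^sup>2)"
      by (intro summable_suminf_not_top) auto
    then have "Bseq (\<lambda>n. 2 ^ n * (d n)\<^sup>2)"
      by (intro convergent_imp_Bseq) (auto simp: convergent_def dest: summable_LIMSEQ_zero)
    then obtain K where K: "K > 0" "\<And>n. 2 ^ n * (d n)\<^sup>2 \<le> K"
      by (auto simp: Bseq_def)
    \<comment> \<open>Boundedness of 2^n d_n^2 is all that is kept from summability: its square root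
      is already a geometric bound for the increments themselves.\<close>
    have "d n \<le> sqrt K * (1 / sqrt 2) ^ n" for n
    proof -
      have "(d n)\<^sup>2 \<le> K / 2 ^ n" using K(2)[of n] by (simp add: field_simps)
      also have "\<dots> = (sqrt K * (1 / sqrt 2) ^ n)\<^sup>2"
      proof -
        have "((1 / sqrt 2) ^ n)\<^sup>2 = ((1 / sqrt 2)\<^sup>2) ^ n"
          by (simp only: mult.commute flip: power_mult)
        also have "\<dots> = 1 / 2 ^ n" by (simp add: power_divide)
        finally show ?thesis using K(1) by (simp add: power_mult_distrib)
      qed
      finally show ?thesis by (rule power2_le_imp_le) (use K(1) in simp)
    qed
    moreover have "summable (\<lambda>n. sqrt K * (1 / sqrt 2) ^ n)"
      by (intro summable_mult summable_geometric) simp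
    ultimately have "summable d"
      by (intro summable_comparison_test[of d "\<lambda>n. sqrt K * (1 / sqrt 2) ^ n"]) (auto simp: d_def)
    then have "summable (\<lambda>n. norm (f (Suc n) x - f n x))"
      by (simp add: d_def[abs_def] norm_minus_commute)
    then have "summable (\<lambda>n. f (Suc n) x - f n x)"
      by (rule summable_norm_cancel)
    then have "convergent (\<lambda>n. (\<Sum>i<n. f (Suc i) x - f i x) + f 0 x)"
      by (intro convergent_add convergent_const) (simp add: summable_iff_convergent)
    moreover have "(\<Sum>i<n. f (Suc i) x - f i x) + f 0 x = f n x" for n
      by (induction n) (auto simp: algebra_simps)
    ultimately show ?case by simp
  qed
  define g where "g x = lim (\<lambda>n. f n x)" for x
  have [measurable]: "g \<in> borel_measurable half_line"
    unfolding g_def by (rule borel_measurable_lim_metric) measurable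
  have fg: "AE x in half_line. (\<lambda>m. f m x) \<longlonglongrightarrow> g x"
    using conv by eventually_elim (simp add: g_def convergent_LIMSEQ_iff)
  have close: "(\<integral>\<^sup>+x. ennreal ((cmod (f n x - g x))\<^sup>2) \<partial>half_line) \<le> ennreal (((1/4) ^ n)\<^sup>2)" for n
  proof -
    have "(\<integral>\<^sup>+x. ennreal ((cmod (f n x - g x))\<^sup>2) \<partial>half_line)
        = (\<integral>\<^sup>+x. liminf (\<lambda>m. ennreal ((cmod (f n x - f m x))\<^sup>2)) \<partial>half_line)"
    proof (rule nn_integral_cong_AE, use fg in eventually_elim)
      case (elim x)
      then have "(\<lambda>m. ennreal ((cmod (f n x - f m x))\<^sup>2)) \<longlonglongrightarrow> ennreal ((cmod (f n x - g x))\<^sup>2)"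
        by (intro tendsto_intros)
      then show ?case using lim_imp_Liminf[OF sequentially_bot] by metis
    qed
    also have "\<dots> \<le> liminf (\<lambda>m. \<integral>\<^sup>+x. ennreal ((cmod (f n x - f m x))\<^sup>2) \<partial>half_line)"
      by (rule nn_integral_liminf) measurable
    also have "\<dots> \<le> limsup (\<lambda>m. \<integral>\<^sup>+x. ennreal ((cmod (f n x - f m x))\<^sup>2) \<partial>half_line)"
      by (rule Liminf_le_Limsup) simp
    also have "\<dots> \<le> ennreal (((1/4) ^ n)\<^sup>2)"
      using nn[of n] by (intro Limsup_bounded) (auto simp: eventually_sequentially)
    finally show ?thesis .
  qed
  have sqd: "square_integrable (\<lambda>x. f n x - g x)" "norm (abs_l2 (\<lambda>x. f n x - g x)) \<le> (1/4) ^ n" for n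
    using norm_l2_leI[OF _ close[of n]] by auto
  \<comment> \<open>The limit inherits square integrability from its difference to one member of the
    sequence.\<close>
  have "square_integrable (\<lambda>x. f 0 x - (f 0 x - g x))"
    by (rule square_integrable_diff[OF _ sqd(1)]) (simp add: f_def square_integrable_rep_l2)
  then have g: "square_integrable g" by simp
  have "abs_l2 (\<lambda>x. f n x - g x) = X (r n) - abs_l2 g" for n
    by (rule abs_l2_cong_rep[OF sqd(1)])
      (use AE_rep_abs_l2[OF g] AE_rep_l2_diff[of "X (r n)" "abs_l2 g"] in eventually_elim, simp add: f_def)
  then have "\<forall>n. norm ((X \<circ> r) n - abs_l2 g) \<le> (1/4) ^ n"
    using sqd(2) by simp
  then have "(\<lambda>n. (X \<circ> r) n - abs_l2 g) \<longlonglongrightarrow> 0"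
    by (rule Lim_null_comparison[OF always_eventually]) (simp add: LIMSEQ_power_zero)
  then have "(X \<circ> r) \<longlonglongrightarrow> abs_l2 g"
    by (rule LIM_zero_cancel)
  then show "convergent X"
    using Cauchy_converges_subseq[OF \<open>Cauchy X\<close> \<open>strict_mono r\<close>] convergentI by blast
qed

instance l2 :: banach ..

text \<open>Bilinear, without conjugation: weak derivatives and kernel transposes then cross the
  pairing with no conjugates. It is not the inner product; conjugates reappear only for the vectors
  dual to the wave packets.\<close>

definition pair :: "l2 \<Rightarrow> l2 \<Rightarrow> complex"
  where "pair u v = (LINT x|half_line. rep_l2 u x * rep_l2 v x)"

lemma integrable_mult_square_integrable:
  assumes "square_integrable f" "square_integrable g"
  shows "integrable half_line (\<lambda>x. f x * g x)"
proof (rule Bochner_Integration.integrable_bound)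
  show "integrable half_line (\<lambda>x. (cmod (f x))\<^sup>2 + (cmod (g x))\<^sup>2)"
    using assms by (auto simp: square_integrable_def)
  have [measurable]: "f \<in> borel_measurable half_line" "g \<in> borel_measurable half_line"
    using assms by (auto simp: square_integrable_def)
  show "(\<lambda>x. f x * g x) \<in> borel_measurable half_line" by measurable
  have "a * b \<le> a\<^sup>2 + b\<^sup>2" if "a \<ge> 0" "b \<ge> 0" for a b :: real
    using sum_squares_bound[of a b] mult_nonneg_nonneg[OF that] by linarith
  then show "AE x in half_line. norm (f x * g x) \<le> norm ((cmod (f x))\<^sup>2 + (cmod (g x))\<^sup>2)"
    by (auto simp: norm_mult)
qed

lemma integrable_pair: "integrable half_line (\<lambda>x. rep_l2 u x * rep_l2 v x)"
  by (intro integrable_mult_square_integrable square_integrable_rep_l2)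

lemma pair_commute: "pair u v = pair v u"
  unfolding pair_def by (simp add: mult.commute)

lemma pair_abs:
  assumes "square_integrable f" "square_integrable g"
  shows "pair (abs_l2 f) (abs_l2 g) = (LINT x|half_line. f x * g x)"
  unfolding pair_def
proof (rule integral_cong_AE)
  show "AE x in half_line. rep_l2 (abs_l2 f) x * rep_l2 (abs_l2 g) x = f x * g x"
    using AE_rep_abs_l2[OF assms(1)] AE_rep_abs_l2[OF assms(2)] by eventually_elim simp
qed (use assms in \<open>auto simp: square_integrable_def\<close>)

lemma pair_abs_right:
  assumes "square_integrable g"
  shows "pair u (abs_l2 g) = (LINT x|half_line. rep_l2 u x * g x)"
  using pair_abs[OF square_integrable_rep_l2 assms, of u] by (simp add: abs_rep_l2)

lemma pair_add_right: "pair u (v + w) = pair u v + pair u w"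
proof -
  have "pair u (v + w) = (LINT x|half_line. rep_l2 u x * rep_l2 v x + rep_l2 u x * rep_l2 w x)"
    unfolding pair_def
  proof (rule integral_cong_AE)
    show "AE x in half_line. rep_l2 u x * rep_l2 (v + w) x = rep_l2 u x * rep_l2 v x + rep_l2 u x * rep_l2 w x"
      using AE_rep_l2_add[of v w] by eventually_elim (simp add: algebra_simps)
  qed auto
  then show ?thesis using integrable_pair by (simp add: pair_def)
qed

lemma pair_scaleC_right: "pair u (c *\<^sub>C v) = c * pair u v"
proof -
  have "pair u (c *\<^sub>C v) = (LINT x|half_line. c * (rep_l2 u x * rep_l2 v x))"
    unfolding pair_def
  proof (rule integral_cong_AE)
    show "AE x in half_line. rep_l2 u x * rep_l2 (c *\<^sub>C v) x = c * (rep_l2 u x * rep_l2 v x)"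
      using AE_rep_l2_scaleC[of c v] by eventually_elim simp
  qed auto
  then show ?thesis by (simp add: pair_def)
qed

lemma pair_add_left: "pair (v + w) u = pair v u + pair w u"
  using pair_add_right pair_commute by metis

lemma pair_scaleC_left: "pair (c *\<^sub>C v) u = c * pair v u"
  using pair_scaleC_right pair_commute by metis

lemma pair_zero_right: "pair u 0 = 0"
  using pair_scaleC_right[of u 0 0] by simp

lemma pair_zero_left: "pair 0 u = 0"
  using pair_scaleC_left[of 0 0 u] by simp

lemma uminus_scaleC: "- v = (- 1) *\<^sub>C (v :: 'a::complex_normed_vector)"
  using complex_vector.scale_minus_left[of 1 v] by simp

lemma pair_minus_right: "pair u (- v) = - pair u v"
  by (subst uminus_scaleC) (simp only: pair_scaleC_right mult_minus1)

lemma pair_diff_right: "pair u (v - w) = pair u v - pair u w"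
  using pair_add_right[of u v "- w"] pair_minus_right[of u w] by simp

lemma pair_diff_left: "pair (v - w) u = pair v u - pair w u"
  using pair_diff_right pair_commute by metis

text \<open>Pointwise Young inequality with weights t/(2s) and s/(2t), where s and t are the two
  norms; this choice makes both integrated terms equal to s t / 2.\<close>

lemma Cauchy_Schwarz_l2: "cmod (pair u v) \<le> norm u * norm v"
proof (cases "u = 0 \<or> v = 0")
  case True
  then show ?thesis by (auto simp: pair_zero_left pair_zero_right)
next
  case False
  define s t where "s = norm u" and "t = norm v"
  have st: "s > 0" "t > 0" using False by (auto simp: s_def t_def)
  have "cmod (pair u v) \<le> (LINT x|half_line. norm (rep_l2 u x * rep_l2 v x))"
    unfolding pair_def by (rule integral_norm_bound)
  also have "\<dots> \<le> (LINT x|half_line. t / (2 * s) * (cmod (rep_l2 u x))\<^sup>2 + s / (2 * t) * (cmod (rep_l2 v x))\<^sup>2)"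
  proof (rule integral_mono)
    fix x
    have "0 \<le> (t * cmod (rep_l2 u x) - s * cmod (rep_l2 v x))\<^sup>2 / (2 * s * t)"
      using st by simp
    then show "norm (rep_l2 u x * rep_l2 v x)
        \<le> t / (2 * s) * (cmod (rep_l2 u x))\<^sup>2 + s / (2 * t) * (cmod (rep_l2 v x))\<^sup>2"
      using st by (simp add: norm_mult field_simps power2_eq_square)
  qed (use integrable_pair integrable_rep_l2_sq in auto)
  also have "\<dots> = t / (2 * s) * s\<^sup>2 + s / (2 * t) * t\<^sup>2"
    using integrable_rep_l2_sq by (simp add: s_def t_def norm_l2_sq)
  also have "\<dots> = s * t"
    using st by (simp add: field_simps power2_eq_square)
  finally show ?thesis by (simp add: s_def t_def)
qed

lemma bounded_linear_pair: "bounded_linear (\<lambda>v. pair u v)"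
proof (rule bounded_linear_intro)
  show "cmod (pair u v) \<le> norm v * norm u" for v
    using Cauchy_Schwarz_l2[of u v] by (simp only: mult.commute)
qed (simp_all only: pair_add_right scaleR_scaleC pair_scaleC_right scaleR_conv_of_real)

section \<open>Integral operators with exponentially decaying kernels\<close>

lemma abs_l2_add:
  assumes "square_integrable f" "square_integrable g"
  shows "abs_l2 (\<lambda>x. f x + g x) = abs_l2 f + abs_l2 g"
proof (rule abs_l2_cong_rep)
  show "AE x in half_line. f x + g x = rep_l2 (abs_l2 f + abs_l2 g) x"
    using AE_rep_l2_add[of "abs_l2 f" "abs_l2 g"] AE_rep_abs_l2[OF assms(1)] AE_rep_abs_l2[OF assms(2)]
    by eventually_elim simp
qed (rule square_integrable_add[OF assms])

lemma abs_l2_scaleC: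
  assumes "square_integrable f"
  shows "abs_l2 (\<lambda>x. c * f x) = c *\<^sub>C abs_l2 f"
proof (rule abs_l2_cong_rep)
  show "AE x in half_line. c * f x = rep_l2 (c *\<^sub>C abs_l2 f) x"
    using AE_rep_l2_scaleC[of c "abs_l2 f"] AE_rep_abs_l2[OF assms] by eventually_elim simp
qed (rule square_integrable_mult_const[OF assms])

lemma abs_l2_diff:
  assumes "square_integrable f" "square_integrable g"
  shows "abs_l2 (\<lambda>x. f x - g x) = abs_l2 f - abs_l2 g"
proof (rule abs_l2_cong_rep)
  show "AE x in half_line. f x - g x = rep_l2 (abs_l2 f - abs_l2 g) x"
    using AE_rep_l2_diff[of "abs_l2 f" "abs_l2 g"] AE_rep_abs_l2[OF assms(1)] AE_rep_abs_l2[OF assms(2)]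
    by eventually_elim simp
qed (rule square_integrable_diff[OF assms])

lemma sigma_finite_half_line: "sigma_finite_measure half_line"
  by (rule sigma_finite_measure_restrict_space[OF sigma_finite_lebesgue]) simp

interpretation half_line: sigma_finite_measure half_line
  by (rule sigma_finite_half_line)

interpretation half_line_pair: pair_sigma_finite half_line half_line ..

lemma measurable_ident_half_line [measurable]: "(\<lambda>x. x) \<in> borel_measurable half_line"
  by (intro measurable_restrict_space1 measurable_completion) auto

lemma measurable_fst_half_line [measurable]: "fst \<in> borel_measurable (half_line \<Otimes>\<^sub>M half_line)"
  using measurable_compose[OF measurable_fst measurable_ident_half_line] by simp

lemma measurable_snd_half_line [measurable]: "snd \<in> borel_measurable (half_line \<Otimes>\<^sub>M half_line)"
  using measurable_compose[OF measurable_snd measurable_ident_half_line] by simp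

lemma AE_half_lineI:
  assumes "AE x in lborel. x > 0 \<longrightarrow> P x"
  shows "AE x in half_line. P x"
  using AE_completion[OF assms] by (subst AE_restrict_space_iff) auto

lemma AE_half_line_pos: "AE x in half_line. x > 0"
  by (rule AE_half_lineI) auto

lemma AE_half_line_neq: "AE x in half_line. x \<noteq> c"
  by (rule AE_half_lineI) (use AE_lborel_singleton[of c] in eventually_elim, simp)

text \<open>Each side of x contributes at most 1/\<sigma>. The bound is uniform in x, as the Schur
  test requires.\<close>

lemma nn_integral_exp_decay:
  assumes \<sigma>: "\<sigma> > 0" and x: "x \<ge> 0"
  shows "(\<integral>\<^sup>+t. ennreal (exp (- \<sigma> * \<bar>x - t\<bar>)) \<partial>half_line) \<le> ennreal (2 / \<sigma>)"
proof -
  have "(\<integral>\<^sup>+t. ennreal (exp (- \<sigma> * \<bar>x - t\<bar>)) \<partial>half_line)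
      = (\<integral>\<^sup>+t. ennreal (exp (- \<sigma> * \<bar>x - t\<bar>)) * indicator {0<..} t \<partial>lborel)"
    by (simp add: nn_integral_restrict_space nn_integral_completion)
  also have "\<dots> \<le> (\<integral>\<^sup>+t. ennreal (exp (\<sigma> * (t - x))) * indicator {0..x} t
      + ennreal (exp (- \<sigma> * (t - x))) * indicator {x..} t \<partial>lborel)"
  proof (rule nn_integral_mono)
    fix t :: real
    have "exp (- \<sigma> * \<bar>x - t\<bar>) = (if t \<le> x then exp (\<sigma> * (t - x)) else exp (- \<sigma> * (t - x)))"
      by (auto simp: algebra_simps)
    then show "ennreal (exp (- \<sigma> * \<bar>x - t\<bar>)) * indicator {0<..} t
      \<le> ennreal (exp (\<sigma> * (t - x))) * indicator {0..x} t + ennreal (exp (- \<sigma> * (t - x))) * indicator {x..} t"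
      by (auto simp: indicator_def)
  qed
  also have "\<dots> = (\<integral>\<^sup>+t. ennreal (exp (\<sigma> * (t - x))) * indicator {0..x} t \<partial>lborel)
      + (\<integral>\<^sup>+t. ennreal (exp (- \<sigma> * (t - x))) * indicator {x..} t \<partial>lborel)"
    by (rule nn_integral_add) auto
  also have "(\<integral>\<^sup>+t. ennreal (exp (\<sigma> * (t - x))) * indicator {0..x} t \<partial>lborel)
      = ennreal (exp (\<sigma> * (x - x)) / \<sigma> - exp (\<sigma> * (0 - x)) / \<sigma>)"
    by (rule nn_integral_FTC_Icc[where F = "\<lambda>t. exp (\<sigma> * (t - x)) / \<sigma>"])
      (use \<sigma> x in \<open>auto intro!: derivative_eq_intros\<close>)
  also have "(\<integral>\<^sup>+t. ennreal (exp (- \<sigma> * (t - x))) * indicator {x..} t \<partial>lborel)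
      = ennreal (0 - (- exp (- \<sigma> * (x - x)) / \<sigma>))"
  proof (rule nn_integral_FTC_atLeast[where F = "\<lambda>t. - exp (- \<sigma> * (t - x)) / \<sigma>"])
    show "((\<lambda>t. - exp (- \<sigma> * (t - x)) / \<sigma>) \<longlongrightarrow> 0) at_top"
    proof -
      have "filterlim (\<lambda>t. \<sigma> * ((- x) + t)) at_top at_top"
        by (intro filterlim_tendsto_pos_mult_at_top[OF tendsto_const \<sigma>]
            filterlim_tendsto_add_at_top[OF tendsto_const filterlim_ident])
      then have "filterlim (\<lambda>t. - (\<sigma> * ((- x) + t))) at_bot at_top"
        by (simp add: filterlim_uminus_at_bot)
      then have "((\<lambda>t. exp (- (\<sigma> * ((- x) + t)))) \<longlongrightarrow> 0) at_top"
        by (rule filterlim_compose[OF exp_at_bot])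
      then have "((\<lambda>t. exp (- (\<sigma> * ((- x) + t))) * (- 1 / \<sigma>)) \<longlongrightarrow> 0 * (- 1 / \<sigma>)) at_top"
        by (intro tendsto_mult_right)
      then show ?thesis by simp
    qed
  qed (use \<sigma> in \<open>auto intro!: derivative_eq_intros\<close>)
  also have "ennreal (exp (\<sigma> * (x - x)) / \<sigma> - exp (\<sigma> * (0 - x)) / \<sigma>) \<le> ennreal (1 / \<sigma>)"
    using \<sigma> by (intro ennreal_leI) simp
  finally show ?thesis
    using \<sigma> by (simp add: ennreal_plus[symmetric] del: ennreal_plus)
qed

text \<open>Tailored to exponential kernels with a jump on the diagonal: continuity in the first
  variable is asked only off the diagonal, while the decay bound includes x = 0, where traces are
  read off. Joint measurability serves Fubini; measurability of slices turns them into elements of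
  \<open>l2\<close>.\<close>

definition decaying_kernel :: "real \<Rightarrow> (real \<Rightarrow> real \<Rightarrow> complex) \<Rightarrow> bool"
  where "decaying_kernel \<sigma> k \<longleftrightarrow> \<sigma> > 0 \<and>
    (\<lambda>(x, t). k x t) \<in> borel_measurable (half_line \<Otimes>\<^sub>M half_line) \<and>
    (\<forall>x. k x \<in> borel_measurable half_line) \<and>
    (\<forall>x\<ge>0. \<forall>t>0. cmod (k x t) \<le> exp (- \<sigma> * \<bar>x - t\<bar>)) \<and>
    (\<forall>x t. x \<noteq> t \<longrightarrow> isCont (\<lambda>y. k y t) x)"

text \<open>A genuine function, defined at every point, whose class is \<open>kernel_op\<close>; for
  decaying kernels it is the continuous representative that traces refer to. Written as a pairing
  with a slice of the kernel, it inherits continuity from the slices and linearity from the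
  pairing.\<close>

definition kernel_fun :: "(real \<Rightarrow> real \<Rightarrow> complex) \<Rightarrow> l2 \<Rightarrow> real \<Rightarrow> complex"
  where "kernel_fun k g x = pair (abs_l2 (k x)) g"

definition kernel_op :: "(real \<Rightarrow> real \<Rightarrow> complex) \<Rightarrow> l2 \<Rightarrow> l2"
  where "kernel_op k g = abs_l2 (kernel_fun k g)"

context
  fixes \<sigma> :: real and k :: "real \<Rightarrow> real \<Rightarrow> complex"
  assumes k: "decaying_kernel \<sigma> k"
begin

lemma decay_pos: "\<sigma> > 0"
  and decay_bound: "x \<ge> 0 \<Longrightarrow> t > 0 \<Longrightarrow> cmod (k x t) \<le> exp (- \<sigma> * \<bar>x - t\<bar>)"
  and decay_isCont: "x \<noteq> t \<Longrightarrow> isCont (\<lambda>y. k y t) x"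
  and decay_measurable1: "k x \<in> borel_measurable half_line"
  using k by (auto simp: decaying_kernel_def)

lemma decay_measurable2: "(\<lambda>p. k (fst p) (snd p)) \<in> borel_measurable (half_line \<Otimes>\<^sub>M half_line)"
  using k by (auto simp: decaying_kernel_def case_prod_beta)

lemma square_integrable_decay:
  assumes x: "x \<ge> 0"
  shows "square_integrable (k x)"
proof -
  have "(\<integral>\<^sup>+t. ennreal ((cmod (k x t))\<^sup>2) \<partial>half_line)
      \<le> (\<integral>\<^sup>+t. ennreal (exp (- (2 * \<sigma>) * \<bar>x - t\<bar>)) \<partial>half_line)"
  proof (rule nn_integral_mono_AE, use AE_half_line_pos in eventually_elim)
    case (elim t)
    have "(cmod (k x t))\<^sup>2 \<le> (exp (- \<sigma> * \<bar>x - t\<bar>))\<^sup>2"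
      using decay_bound[OF x elim] by (intro power_mono) auto
    also have "\<dots> = exp (- (2 * \<sigma>) * \<bar>x - t\<bar>)"
      by (simp add: power2_eq_square flip: exp_add)
    finally show ?case by (rule ennreal_leI)
  qed
  also have "\<dots> \<le> ennreal (2 / (2 * \<sigma>))"
    by (rule nn_integral_exp_decay) (use decay_pos x in auto)
  also have "\<dots> < \<infinity>" by simp
  finally show ?thesis
    using decay_measurable1 by (simp add: square_integrable_iff_nn)
qed

lemma kernel_fun_integral:
  "x \<ge> 0 \<Longrightarrow> kernel_fun k g x = (LINT t|half_line. k x t * rep_l2 g t)"
  unfolding kernel_fun_def using pair_abs[OF square_integrable_decay square_integrable_rep_l2[of g]]
  by (simp add: abs_rep_l2)

lemma kernel_fun_measurable: "kernel_fun k g \<in> borel_measurable half_line"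
proof -
  have [measurable]: "(\<lambda>p. k (fst p) (snd p)) \<in> borel_measurable (half_line \<Otimes>\<^sub>M half_line)"
    by (rule decay_measurable2)
  have "(\<lambda>x. LINT t|half_line. k x t * rep_l2 g t) \<in> borel_measurable half_line"
  proof (rule half_line.borel_measurable_lebesgue_integral)
    show "(\<lambda>(x, t). k x t * rep_l2 g t) \<in> borel_measurable (half_line \<Otimes>\<^sub>M half_line)"
      unfolding case_prod_beta by measurable
  qed
  then show ?thesis
    by (rule measurable_cong[THEN iffD1, rotated]) (auto simp: kernel_fun_integral)
qed

lemma Tonelli_decay:
  fixes f :: "real \<Rightarrow> ennreal"
  assumes [measurable]: "f \<in> borel_measurable half_line"
  shows "(\<integral>\<^sup>+x. (\<integral>\<^sup>+t. ennreal (exp (- \<sigma> * \<bar>x - t\<bar>)) * f t \<partial>half_line) \<partial>half_line)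
    \<le> ennreal (2 / \<sigma>) * (\<integral>\<^sup>+t. f t \<partial>half_line)"
proof -
  have "(\<integral>\<^sup>+x. (\<integral>\<^sup>+t. ennreal (exp (- \<sigma> * \<bar>x - t\<bar>)) * f t \<partial>half_line) \<partial>half_line)
      = (\<integral>\<^sup>+t. (\<integral>\<^sup>+x. ennreal (exp (- \<sigma> * \<bar>x - t\<bar>)) * f t \<partial>half_line) \<partial>half_line)"
    by (rule half_line_pair.Fubini'[symmetric]) measurable
  also have "\<dots> \<le> (\<integral>\<^sup>+t. ennreal (2 / \<sigma>) * f t \<partial>half_line)"
  proof (rule nn_integral_mono_AE, use AE_half_line_pos in eventually_elim)
    case (elim t)
    have "(\<integral>\<^sup>+x. ennreal (exp (- \<sigma> * \<bar>x - t\<bar>)) * f t \<partial>half_line)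
        = (\<integral>\<^sup>+x. ennreal (exp (- \<sigma> * \<bar>t - x\<bar>)) \<partial>half_line) * f t"
      by (subst nn_integral_multc[symmetric]) (auto simp: abs_minus_commute)
    also have "\<dots> \<le> ennreal (2 / \<sigma>) * f t"
      using elim decay_pos by (intro mult_right_mono nn_integral_exp_decay) auto
    finally show ?case .
  qed
  also have "\<dots> = ennreal (2 / \<sigma>) * (\<integral>\<^sup>+t. f t \<partial>half_line)"
    by (rule nn_integral_cmult) measurable
  finally show ?thesis .
qed

text \<open>Schur test, first half: exp (-\<sigma> |x - t|) is written as h(t) h(t), and
  Cauchy-Schwarz keeps one factor h with \<open>g\<close> while the square of the other integrates
  to at most 2/\<sigma>.\<close>

lemma kernel_fun_le:
  assumes x: "x > 0"
  shows "ennreal ((cmod (kernel_fun k g x))\<^sup>2)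
    \<le> ennreal (2 / \<sigma>) * (\<integral>\<^sup>+t. ennreal (exp (- \<sigma> * \<bar>x - t\<bar>)) * ennreal ((cmod (rep_l2 g t))\<^sup>2) \<partial>half_line)"
proof -
  define h where "h t = exp (- \<sigma> / 2 * \<bar>x - t\<bar>)" for t
  have h2: "(ennreal (h t))\<^sup>2 = ennreal (exp (- \<sigma> * \<bar>x - t\<bar>))" for t
    unfolding h_def by (simp add: ennreal_power power2_eq_square flip: exp_add ennreal_mult)
  have [measurable]: "(\<lambda>t. ennreal (h t)) \<in> borel_measurable half_line"
    unfolding h_def by measurable
  have "ennreal (cmod (kernel_fun k g x)) \<le> (\<integral>\<^sup>+t. ennreal (cmod (k x t * rep_l2 g t)) \<partial>half_line)"
    unfolding kernel_fun_integral[OF less_imp_le[OF x]]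
    by (rule integral_norm_bound_ennreal)
      (intro integrable_mult_square_integrable square_integrable_decay square_integrable_rep_l2 less_imp_le[OF x])
  also have "\<dots> \<le> (\<integral>\<^sup>+t. ennreal (h t) * (ennreal (h t) * ennreal (cmod (rep_l2 g t))) \<partial>half_line)"
  proof (rule nn_integral_mono_AE, use AE_half_line_pos in eventually_elim)
    case (elim t)
    have "cmod (k x t * rep_l2 g t) \<le> exp (- \<sigma> * \<bar>x - t\<bar>) * cmod (rep_l2 g t)"
      unfolding norm_mult using decay_bound[of x t] x elim by (intro mult_right_mono) auto
    also have "exp (- \<sigma> * \<bar>x - t\<bar>) = h t * h t"
      unfolding h_def by (simp flip: exp_add)
    finally have "ennreal (cmod (k x t * rep_l2 g t)) \<le> ennreal (h t * h t * cmod (rep_l2 g t))"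
      by (rule ennreal_leI)
    also have "\<dots> = ennreal (h t) * (ennreal (h t) * ennreal (cmod (rep_l2 g t)))"
      by (simp add: ennreal_mult h_def mult.assoc)
    finally show ?case .
  qed
  finally have "(ennreal (cmod (kernel_fun k g x)))\<^sup>2
      \<le> (\<integral>\<^sup>+t. ennreal (h t) * (ennreal (h t) * ennreal (cmod (rep_l2 g t))) \<partial>half_line)\<^sup>2"
    by (rule power_mono) simp
  also have "\<dots> \<le> (\<integral>\<^sup>+t. (ennreal (h t))\<^sup>2 \<partial>half_line) *
      (\<integral>\<^sup>+t. (ennreal (h t) * ennreal (cmod (rep_l2 g t)))\<^sup>2 \<partial>half_line)"
    by (rule Cauchy_Schwarz_nn_integral) measurable
  also have "\<dots> \<le> ennreal (2 / \<sigma>) *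
      (\<integral>\<^sup>+t. (ennreal (h t) * ennreal (cmod (rep_l2 g t)))\<^sup>2 \<partial>half_line)"
    unfolding h2 using decay_pos x by (intro mult_right_mono nn_integral_exp_decay) auto
  finally show ?thesis
    by (simp add: power_mult_distrib h2 ennreal_power)
qed

text \<open>Schur test, second half: Tonelli contributes another factor 2/\<sigma>, and the square
  root of the product is the operator bound.\<close>

lemma kernel_op_bound:
  shows square_integrable_kernel_fun: "square_integrable (kernel_fun k g)"
    and norm_kernel_op: "norm (kernel_op k g) \<le> 2 / \<sigma> * norm g"
proof -
  have "(\<integral>\<^sup>+x. ennreal ((cmod (kernel_fun k g x))\<^sup>2) \<partial>half_line)
      \<le> (\<integral>\<^sup>+x. ennreal (2 / \<sigma>) *
          (\<integral>\<^sup>+t. ennreal (exp (- \<sigma> * \<bar>x - t\<bar>)) * ennreal ((cmod (rep_l2 g t))\<^sup>2) \<partial>half_line) \<partial>half_line)"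
    by (rule nn_integral_mono_AE, use AE_half_line_pos in eventually_elim) (rule kernel_fun_le)
  also have "\<dots> = ennreal (2 / \<sigma>) * (\<integral>\<^sup>+x.
          (\<integral>\<^sup>+t. ennreal (exp (- \<sigma> * \<bar>x - t\<bar>)) * ennreal ((cmod (rep_l2 g t))\<^sup>2) \<partial>half_line) \<partial>half_line)"
    by (rule nn_integral_cmult) measurable
  also have "\<dots> \<le> ennreal (2 / \<sigma>) * (ennreal (2 / \<sigma>) * (\<integral>\<^sup>+t. ennreal ((cmod (rep_l2 g t))\<^sup>2) \<partial>half_line))"
    by (intro mult_left_mono Tonelli_decay) auto
  also have "\<dots> = ennreal ((2 / \<sigma> * norm g)\<^sup>2)"
    unfolding nn_integral_rep_l2 using decay_pos
    by (simp add: power2_eq_square mult_ac flip: ennreal_mult)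
  finally have "(\<integral>\<^sup>+x. ennreal ((cmod (kernel_fun k g x))\<^sup>2) \<partial>half_line) \<le> ennreal ((2 / \<sigma> * norm g)\<^sup>2)" .
  from norm_l2_leI[OF kernel_fun_measurable this] decay_pos
  show "square_integrable (kernel_fun k g)" "norm (kernel_op k g) \<le> 2 / \<sigma> * norm g"
    by (auto simp: kernel_op_def)
qed

lemma kernel_op_add: "kernel_op k (g + h) = kernel_op k g + kernel_op k h"
proof -
  have "kernel_fun k (g + h) = (\<lambda>x. kernel_fun k g x + kernel_fun k h x)"
    by (simp add: fun_eq_iff kernel_fun_def pair_add_right)
  then show ?thesis
    unfolding kernel_op_def by (simp only: abs_l2_add[OF square_integrable_kernel_fun square_integrable_kernel_fun])
qed

lemma kernel_op_scaleC: "kernel_op k (c *\<^sub>C g) = c *\<^sub>C kernel_op k g"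
proof -
  have "kernel_fun k (c *\<^sub>C g) = (\<lambda>x. c * kernel_fun k g x)"
    by (simp add: fun_eq_iff kernel_fun_def pair_scaleC_right)
  then show ?thesis
    unfolding kernel_op_def by (simp only: abs_l2_scaleC[OF square_integrable_kernel_fun])
qed

text \<open>Dominated convergence along a convergent sequence of points: the slices converge except
  at the single point t = x, and all slices at points in [0, M] are dominated by exp (\<sigma> M)
  exp (-\<sigma> t), which is square integrable on the half-line.\<close>

lemma continuous_kernel: "continuous_on {0..} (\<lambda>x. abs_l2 (k x))"
proof (rule continuous_on_sequentiallyI)
  fix y :: "nat \<Rightarrow> real" and x
  assume y: "\<forall>n. y n \<in> {0..}" "x \<in> {0..}" "y \<longlonglongrightarrow> x"
  then have y0: "y n \<ge> 0" "x \<ge> 0" for n by auto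
  obtain M where M: "\<And>n. \<bar>y n\<bar> \<le> M"
    using convergent_imp_Bseq[OF convergentI[OF y(3)]] by (auto simp: Bseq_def)
  have Mx: "x \<le> M"
    using LIMSEQ_le_const2[OF y(3)] M by (metis abs_le_D1)
  have le: "cmod (k z t) \<le> exp (\<sigma> * M) * exp (- \<sigma> * t)" if "0 \<le> z" "z \<le> M" "0 < t" for z t
  proof -
    have "- \<sigma> * \<bar>z - t\<bar> \<le> \<sigma> * (z - t)"
      using mult_left_mono[of "t - z" "\<bar>z - t\<bar>" \<sigma>] decay_pos by (simp add: algebra_simps)
    also have "\<dots> \<le> \<sigma> * M + (- \<sigma> * t)"
      using that decay_pos by (simp add: algebra_simps)
    finally show ?thesis
      using decay_bound[OF that(1,3)] by (simp flip: exp_add add: order_trans)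
  qed
  have "(\<lambda>n. LINT t|half_line. (cmod (k (y n) t - k x t))\<^sup>2) \<longlonglongrightarrow> (LINT t|half_line. 0)"
  proof (rule integral_dominated_convergence)
    have "integrable half_line (\<lambda>t. exp (- (2 * \<sigma>) * \<bar>0 - t\<bar>))"
    proof (rule integrableI_bounded)
      have "(\<integral>\<^sup>+t. ennreal (norm (exp (- (2 * \<sigma>) * \<bar>0 - t\<bar>))) \<partial>half_line) \<le> ennreal (2 / (2 * \<sigma>))"
        using nn_integral_exp_decay[of "2 * \<sigma>" 0] decay_pos by simp
      also have "\<dots> < \<infinity>" by simp
      finally show "(\<integral>\<^sup>+t. ennreal (norm (exp (- (2 * \<sigma>) * \<bar>0 - t\<bar>))) \<partial>half_line) < \<infinity>" .
    qed measurable
    then show "integrable half_line (\<lambda>t. 4 * (exp (\<sigma> * M))\<^sup>2 * exp (- (2 * \<sigma>) * \<bar>0 - t\<bar>))"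
      by (rule integrable_mult_right)
    have [measurable]: "k z \<in> borel_measurable half_line" for z by (rule decay_measurable1)
    show "(\<lambda>t. (cmod (k (y n) t - k x t))\<^sup>2) \<in> borel_measurable half_line" for n by measurable
    show "AE t in half_line. norm ((cmod (k (y n) t - k x t))\<^sup>2)
        \<le> 4 * (exp (\<sigma> * M))\<^sup>2 * exp (- (2 * \<sigma>) * \<bar>0 - t\<bar>)" for n
      using AE_half_line_pos
    proof eventually_elim
      case (elim t)
      have "cmod (k (y n) t - k x t) \<le> cmod (k (y n) t) + cmod (k x t)"
        by (rule norm_triangle_ineq4)
      also have "\<dots> \<le> 2 * (exp (\<sigma> * M) * exp (- \<sigma> * t))"
        using le[of "y n" t] le[of x t] y0 M[of n] Mx elim by auto
      finally have "(cmod (k (y n) t - k x t))\<^sup>2 \<le> (2 * (exp (\<sigma> * M) * exp (- \<sigma> * t)))\<^sup>2"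
        by (rule power_mono) simp
      also have "\<dots> = 4 * (exp (\<sigma> * M))\<^sup>2 * (exp (- \<sigma> * t) * exp (- \<sigma> * t))"
        by (simp add: power2_eq_square)
      also have "exp (- \<sigma> * t) * exp (- \<sigma> * t) = exp (- (2 * \<sigma>) * \<bar>0 - t\<bar>)"
        using elim by (simp flip: exp_add)
      finally show ?case by simp
    qed
    show "AE t in half_line. (\<lambda>n. (cmod (k (y n) t - k x t))\<^sup>2) \<longlonglongrightarrow> 0"
      using AE_half_line_neq[of x]
    proof eventually_elim
      case (elim t)
      have "(\<lambda>n. k (y n) t) \<longlonglongrightarrow> k x t"
        using isCont_tendsto_compose[OF decay_isCont y(3)] elim by metis
      then have "(\<lambda>n. (cmod (k (y n) t - k x t))\<^sup>2) \<longlonglongrightarrow> (cmod (k x t - k x t))\<^sup>2"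
        by (intro tendsto_intros)
      then show ?case by simp
    qed
  qed simp
  moreover have "(LINT t|half_line. (cmod (k (y n) t - k x t))\<^sup>2) = (norm (abs_l2 (k (y n)) - abs_l2 (k x)))\<^sup>2" for n
    using norm_abs_l2_sq[OF square_integrable_diff[OF square_integrable_decay square_integrable_decay]]
      abs_l2_diff[OF square_integrable_decay square_integrable_decay] y0 by metis
  ultimately have "(\<lambda>n. (norm (abs_l2 (k (y n)) - abs_l2 (k x)))\<^sup>2) \<longlonglongrightarrow> 0" by simp
  then have "(\<lambda>n. sqrt ((norm (abs_l2 (k (y n)) - abs_l2 (k x)))\<^sup>2)) \<longlonglongrightarrow> sqrt 0"
    by (rule tendsto_real_sqrt)
  then have "(\<lambda>n. norm (abs_l2 (k (y n)) - abs_l2 (k x))) \<longlonglongrightarrow> 0" by simp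
  then show "(\<lambda>n. abs_l2 (k (y n))) \<longlonglongrightarrow> abs_l2 (k x)"
    by (rule LIM_zero_cancel[OF tendsto_norm_zero_cancel])
qed

lemma continuous_kernel_fun: "continuous_on {0..} (kernel_fun k g)"
proof -
  have "continuous_on {0..} (\<lambda>x. pair g (abs_l2 (k x)))"
    by (rule bounded_linear.continuous_on[OF bounded_linear_pair continuous_kernel])
  then show ?thesis unfolding kernel_fun_def[abs_def] by (simp add: pair_commute)
qed

lemma AE_rep_kernel_op: "AE x in half_line. rep_l2 (kernel_op k g) x = kernel_fun k g x"
  unfolding kernel_op_def by (rule AE_rep_abs_l2[OF square_integrable_kernel_fun])

end

text \<open>Fubini. Absolute integrability comes from a b \<le> a^2 + b^2, which separates
  \<open>g\<close> from \<open>h\<close> so that Tonelli, in one or the other order, controls each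
  term.\<close>

lemma pair_kernel_op:
  assumes k: "decaying_kernel \<sigma> k" and k': "decaying_kernel \<sigma>' (\<lambda>x t. k t x)"
  shows "pair (kernel_op k g) h = pair g (kernel_op (\<lambda>x t. k t x) h)"
proof -
  have [measurable]: "(\<lambda>p. k (fst p) (snd p)) \<in> borel_measurable (half_line \<Otimes>\<^sub>M half_line)"
    by (rule decay_measurable2[OF k])
  have int: "integrable (half_line \<Otimes>\<^sub>M half_line) (\<lambda>(x, t). k x t * rep_l2 g t * rep_l2 h x)"
  proof (rule integrableI_bounded)
    have "(\<integral>\<^sup>+p. ennreal (norm (case p of (x, t) \<Rightarrow> k x t * rep_l2 g t * rep_l2 h x)) \<partial>(half_line \<Otimes>\<^sub>M half_line))
        = (\<integral>\<^sup>+x. \<integral>\<^sup>+t. ennreal (norm (k x t * rep_l2 g t * rep_l2 h x)) \<partial>half_line \<partial>half_line)"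
      by (subst half_line.nn_integral_fst[symmetric]) (auto simp: case_prod_beta)
    also have "\<dots> \<le> (\<integral>\<^sup>+x. \<integral>\<^sup>+t. ennreal (exp (- \<sigma> * \<bar>x - t\<bar>)) * ennreal ((cmod (rep_l2 g t))\<^sup>2)
        + ennreal (exp (- \<sigma> * \<bar>x - t\<bar>)) * ennreal ((cmod (rep_l2 h x))\<^sup>2) \<partial>half_line \<partial>half_line)"
    proof (rule nn_integral_mono_AE, use AE_half_line_pos in eventually_elim)
      case (elim x)
      show ?case
      proof (rule nn_integral_mono_AE, use AE_half_line_pos in eventually_elim)
        case (elim t)
        have ab: "a * b \<le> a\<^sup>2 + b\<^sup>2" if "a \<ge> 0" "b \<ge> 0" for a b :: real
          using sum_squares_bound[of a b] mult_nonneg_nonneg[OF that] by linarith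
        have "norm (k x t * rep_l2 g t * rep_l2 h x)
            \<le> exp (- \<sigma> * \<bar>x - t\<bar>) * ((cmod (rep_l2 g t))\<^sup>2 + (cmod (rep_l2 h x))\<^sup>2)"
          unfolding norm_mult mult.assoc using decay_bound[OF k, of x t] elim \<open>x > 0\<close>
          by (intro mult_mono ab) auto
        then have "ennreal (norm (k x t * rep_l2 g t * rep_l2 h x))
            \<le> ennreal (exp (- \<sigma> * \<bar>x - t\<bar>) * (cmod (rep_l2 g t))\<^sup>2 + exp (- \<sigma> * \<bar>x - t\<bar>) * (cmod (rep_l2 h x))\<^sup>2)"
          by (intro ennreal_leI) (simp add: distrib_left)
        then show ?case by (simp add: ennreal_mult)
      qed
    qed
    also have "\<dots> = (\<integral>\<^sup>+x. (\<integral>\<^sup>+t. ennreal (exp (- \<sigma> * \<bar>x - t\<bar>)) * ennreal ((cmod (rep_l2 g t))\<^sup>2) \<partial>half_line)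
        + (\<integral>\<^sup>+t. ennreal (exp (- \<sigma> * \<bar>x - t\<bar>)) * ennreal ((cmod (rep_l2 h x))\<^sup>2) \<partial>half_line) \<partial>half_line)"
      by (intro nn_integral_cong nn_integral_add) measurable
    also have "\<dots> = (\<integral>\<^sup>+x. (\<integral>\<^sup>+t. ennreal (exp (- \<sigma> * \<bar>x - t\<bar>)) * ennreal ((cmod (rep_l2 g t))\<^sup>2) \<partial>half_line) \<partial>half_line)
        + (\<integral>\<^sup>+x. (\<integral>\<^sup>+t. ennreal (exp (- \<sigma> * \<bar>x - t\<bar>)) * ennreal ((cmod (rep_l2 h x))\<^sup>2) \<partial>half_line) \<partial>half_line)"
      by (rule nn_integral_add) measurable
    also have "(\<integral>\<^sup>+x. (\<integral>\<^sup>+t. ennreal (exp (- \<sigma> * \<bar>x - t\<bar>)) * ennreal ((cmod (rep_l2 h x))\<^sup>2) \<partial>half_line) \<partial>half_line)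
        = (\<integral>\<^sup>+t. (\<integral>\<^sup>+x. ennreal (exp (- \<sigma> * \<bar>t - x\<bar>)) * ennreal ((cmod (rep_l2 h x))\<^sup>2) \<partial>half_line) \<partial>half_line)"
      by (subst half_line_pair.Fubini') (auto simp: abs_minus_commute)
    also have "(\<integral>\<^sup>+x. (\<integral>\<^sup>+t. ennreal (exp (- \<sigma> * \<bar>x - t\<bar>)) * ennreal ((cmod (rep_l2 g t))\<^sup>2) \<partial>half_line) \<partial>half_line)
        + (\<integral>\<^sup>+t. (\<integral>\<^sup>+x. ennreal (exp (- \<sigma> * \<bar>t - x\<bar>)) * ennreal ((cmod (rep_l2 h x))\<^sup>2) \<partial>half_line) \<partial>half_line)
        \<le> ennreal (2 / \<sigma>) * ennreal ((norm g)\<^sup>2) + ennreal (2 / \<sigma>) * ennreal ((norm h)\<^sup>2)"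
      unfolding nn_integral_rep_l2[symmetric] by (intro add_mono Tonelli_decay[OF k]) measurable
    also have "\<dots> < \<infinity>" by (simp add: ennreal_mult_less_top)
    finally show "(\<integral>\<^sup>+p. ennreal (norm (case p of (x, t) \<Rightarrow> k x t * rep_l2 g t * rep_l2 h x))
        \<partial>(half_line \<Otimes>\<^sub>M half_line)) < \<infinity>" .
  qed (unfold case_prod_beta, measurable)
  have "pair (kernel_op k g) h = (LINT x|half_line. kernel_fun k g x * rep_l2 h x)"
    unfolding kernel_op_def using pair_abs[OF square_integrable_kernel_fun[OF k] square_integrable_rep_l2[of h]]
    by (simp add: abs_rep_l2)
  also have "\<dots> = (LINT x|half_line. LINT t|half_line. k x t * rep_l2 g t * rep_l2 h x)"
    by (rule Bochner_Integration.integral_cong) (auto simp: kernel_fun_integral[OF k])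
  also have "\<dots> = (LINT t|half_line. LINT x|half_line. k x t * rep_l2 g t * rep_l2 h x)"
    by (rule half_line_pair.Fubini_integral[symmetric, OF int])
  also have "\<dots> = (LINT t|half_line. rep_l2 g t * (LINT x|half_line. k x t * rep_l2 h x))"
    by (simp add: mult_ac flip: integral_mult_right_zero)
  also have "\<dots> = pair g (kernel_op (\<lambda>x t. k t x) h)"
  proof -
    have "pair g (kernel_op (\<lambda>x t. k t x) h) = (LINT t|half_line. rep_l2 g t * kernel_fun (\<lambda>x t. k t x) h t)"
      unfolding kernel_op_def by (rule pair_abs_right[OF square_integrable_kernel_fun[OF k']])
    also have "\<dots> = (LINT t|half_line. rep_l2 g t * (LINT x|half_line. k x t * rep_l2 h x))"
      by (rule Bochner_Integration.integral_cong) (auto simp: kernel_fun_integral[OF k'])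
    finally show ?thesis ..
  qed
  finally show ?thesis .
qed

section \<open>Weak derivatives\<close>

text \<open>Right neighbourhoods of 0 are not null; this is how an identity valid almost everywhere
  gets to constrain a value at the origin.\<close>

lemma AE_half_line_not_interval:
  assumes "AE x in half_line. x \<notin> {0<..<\<delta>}"
  shows "\<delta> \<le> 0"
proof (rule ccontr)
  assume "\<not> \<delta> \<le> 0"
  have "AE x in lebesgue. x \<in> {0<..} \<longrightarrow> x \<notin> {0<..<\<delta>}"
    using assms by (subst (asm) AE_restrict_space_iff) auto
  then have "AE x in lebesgue. x \<notin> {0<..<\<delta>}"
    by eventually_elim auto
  then have "emeasure lebesgue {0<..<\<delta>} = 0"
    by (subst (asm) AE_iff_measurable[of "{0<..<\<delta>}"]) auto
  then show False using \<open>\<not> \<delta> \<le> 0\<close> by simp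
qed

lemma borel_measurable_half_line_continuous:
  fixes f :: "real \<Rightarrow> 'a::real_normed_vector"
  assumes "continuous_on {0<..} f"
  shows "f \<in> borel_measurable half_line"
  by (rule continuous_imp_measurable_on_sets_lebesgue[OF assms]) simp

lemma norm_l2_bounded_support:
  assumes f: "f \<in> borel_measurable half_line" and M: "\<And>x. x > 0 \<Longrightarrow> cmod (f x) \<le> M" "M \<ge> 0"
    and supp: "\<And>x. x > 0 \<Longrightarrow> x \<notin> {a..b} \<Longrightarrow> f x = 0" and ab: "a \<le> b"
  shows "square_integrable f" "norm (abs_l2 f) \<le> M * sqrt (b - a)"
proof -
  have "(\<integral>\<^sup>+x. ennreal ((cmod (f x))\<^sup>2) \<partial>half_line)
      = (\<integral>\<^sup>+x. ennreal ((cmod (f x))\<^sup>2) * indicator {0<..} x \<partial>lebesgue)"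
    by (simp add: nn_integral_restrict_space)
  also have "\<dots> \<le> (\<integral>\<^sup>+x. ennreal (M\<^sup>2) * indicator {a..b} x \<partial>lebesgue)"
    using M supp by (intro nn_integral_mono) (auto simp: indicator_def intro!: ennreal_leI power_mono)
  also have "\<dots> = ennreal (M\<^sup>2) * ennreal (b - a)"
    using ab by (subst nn_integral_cmult_indicator) auto
  also have "\<dots> = ennreal ((M * sqrt (b - a))\<^sup>2)"
    using ab M by (simp add: power_mult_distrib ennreal_mult)
  finally have "(\<integral>\<^sup>+x. ennreal ((cmod (f x))\<^sup>2) \<partial>half_line) \<le> ennreal ((M * sqrt (b - a))\<^sup>2)" .
  from norm_l2_leI[OF f this] M ab
  show "square_integrable f" "norm (abs_l2 f) \<le> M * sqrt (b - a)" by auto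
qed

section \<open>Weak derivatives through the pairing with test functions\<close>

definition emb :: "(real \<Rightarrow> real) \<Rightarrow> l2"
  where "emb \<phi> = abs_l2 (\<lambda>x. complex_of_real (\<phi> x))"

lemma measurable_test_function:
  assumes "test_function \<phi>" shows "(\<lambda>x. complex_of_real (\<phi> x)) \<in> borel_measurable half_line"
  by (intro borel_measurable_half_line_continuous continuous_on_of_real test_function_continuous[OF assms])

lemma square_integrable_test_function:
  assumes "test_function \<phi>"
  shows "square_integrable (\<lambda>x. complex_of_real (\<phi> x))"
proof -
  obtain M where M: "M > 0" "\<And>x. \<bar>\<phi> x\<bar> \<le> M" using test_function_bounded[OF assms] by blast
  obtain \<alpha> \<beta> where "\<alpha> < \<beta>" "\<forall>x. x \<notin> {\<alpha>..\<beta>} \<longrightarrow> \<phi> x = 0"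
    using assms unfolding test_function_iff by blast
  then show ?thesis
    using M by (intro norm_l2_bounded_support(1)[of _ M \<alpha> \<beta>] measurable_test_function[OF assms]) auto
qed

lemma pair_emb:
  "test_function \<phi> \<Longrightarrow> pair u (emb \<phi>) = (LINT x|half_line. rep_l2 u x * complex_of_real (\<phi> x))"
  unfolding emb_def by (rule pair_abs_right[OF square_integrable_test_function])

lemma is_weak_deriv_pair:
  "is_weak_deriv k u v \<longleftrightarrow>
    (\<forall>\<phi>. test_function \<phi> \<longrightarrow> pair u (emb ((deriv ^^ k) \<phi>)) = (-1) ^ k * pair v (emb \<phi>))"
  unfolding is_weak_deriv_def by (simp add: pair_emb test_function_iterated_deriv cong: imp_cong)

lemma locally_integrable_rep_l2: "locally_integrable (rep_l2 u)"
  unfolding locally_integrable_def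
proof (intro allI impI)
  fix \<alpha> \<beta> :: real assume ab: "0 < \<alpha>" "\<alpha> < \<beta>"
  have "square_integrable (\<lambda>x. complex_of_real (indicator {\<alpha>..\<beta>} x))"
  proof (rule norm_l2_bounded_support(1)[of _ 1 \<alpha> \<beta>])
    have "(\<lambda>x. indicator {\<alpha>..\<beta>} x :: real) \<in> borel_measurable half_line"
      by (intro measurable_restrict_space1 borel_measurable_indicator) simp
    then show "(\<lambda>x. complex_of_real (indicator {\<alpha>..\<beta>} x)) \<in> borel_measurable half_line"
      by measurable
  qed (use ab in \<open>auto simp: indicator_def\<close>)
  then have "integrable half_line (\<lambda>x. rep_l2 u x * complex_of_real (indicator {\<alpha>..\<beta>} x))"
    by (rule integrable_mult_square_integrable[OF square_integrable_rep_l2])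
  then have "integrable lebesgue (\<lambda>x. indicator {0<..} x *\<^sub>R (rep_l2 u x * complex_of_real (indicator {\<alpha>..\<beta>} x)))"
    by (simp add: integrable_half_line_iff)
  moreover have "indicator {0<..} x *\<^sub>R (rep_l2 u x * complex_of_real (indicator {\<alpha>..\<beta>} x))
      = indicator {\<alpha>..\<beta>} x *\<^sub>R rep_l2 u x" for x
    using ab by (auto simp: indicator_def)
  ultimately show "set_integrable lebesgue {\<alpha>..\<beta>} (rep_l2 u)"
    by (simp add: set_integrable_def)
qed

lemma l2_zeroI:
  assumes "AE x in half_line. rep_l2 u x = 0"
  shows "u = 0"
proof (rule l2_eqI)
  show "AE x in half_line. rep_l2 u x = rep_l2 0 x"
    using assms AE_rep_l2_zero by eventually_elim simp
qed

text \<open>Test functions separate points of \<open>l2\<close> by the fundamental lemma. Besides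
  uniqueness of weak derivatives this reduces identities between vectors to identities between
  complex numbers.\<close>

lemma l2_eq_if_pair_emb_eq:
  assumes "\<And>\<phi>. test_function \<phi> \<Longrightarrow> pair u (emb \<phi>) = pair v (emb \<phi>)"
  shows "u = v"
proof -
  have "AE x in half_line. rep_l2 (u - v) x = 0"
  proof (rule fundamental_lemma[OF locally_integrable_rep_l2])
    fix \<phi> assume "test_function \<phi>"
    then show "(LINT x|half_line. rep_l2 (u - v) x * complex_of_real (\<phi> x)) = 0"
      using assms by (simp add: pair_diff_left flip: pair_emb)
  qed
  then have "u - v = 0"
    by (rule l2_zeroI)
  then show ?thesis by simp
qed

lemma weak_deriv_unique:
  assumes "is_weak_deriv k u v" "is_weak_deriv k u w"
  shows "v = w"
proof (rule l2_eq_if_pair_emb_eq)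
  fix \<phi> assume "test_function \<phi>"
  then have "(-1) ^ k * pair v (emb \<phi>) = (-1) ^ k * pair w (emb \<phi>)"
    using assms unfolding is_weak_deriv_pair by metis
  then show "pair v (emb \<phi>) = pair w (emb \<phi>)" by simp
qed

lemma weak_deriv_eqI: "is_weak_deriv k u v \<Longrightarrow> weak_deriv k u = v"
  unfolding weak_deriv_def using weak_deriv_unique by blast

lemma is_weak_deriv_add:
  "is_weak_deriv k u v \<Longrightarrow> is_weak_deriv k u' v' \<Longrightarrow> is_weak_deriv k (u + u') (v + v')"
  unfolding is_weak_deriv_pair by (simp add: pair_add_left distrib_left)

lemma is_weak_deriv_scaleC: "is_weak_deriv k u v \<Longrightarrow> is_weak_deriv k (c *\<^sub>C u) (c *\<^sub>C v)"
  unfolding is_weak_deriv_pair by (simp add: pair_scaleC_left mult.left_commute)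

lemma is_weak_deriv_diff:
  "is_weak_deriv k u v \<Longrightarrow> is_weak_deriv k u' v' \<Longrightarrow> is_weak_deriv k (u - u') (v - v')"
  unfolding is_weak_deriv_pair by (simp add: pair_diff_left right_diff_distrib)

lemma is_weak_deriv_0: "is_weak_deriv 0 u v \<longleftrightarrow> v = u"
proof -
  have "is_weak_deriv 0 u u" by (simp add: is_weak_deriv_def)
  then show ?thesis using weak_deriv_unique by blast
qed

lemma weak_deriv_0: "weak_deriv 0 u = u"
  by (rule weak_deriv_eqI) (simp add: is_weak_deriv_0)

text \<open>Derivatives of test functions are test functions, so one differentiation can be peeled
  off. Repeated use turns membership in Sobolev spaces into chains of first-order
  derivatives.\<close>

lemma is_weak_deriv_Suc:
  assumes "is_weak_deriv 1 u v"
  shows "is_weak_deriv (Suc k) u w \<longleftrightarrow> is_weak_deriv k v w"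
proof -
  have "pair u (emb ((deriv ^^ Suc k) \<phi>)) = - pair v (emb ((deriv ^^ k) \<phi>))" if "test_function \<phi>" for \<phi>
    using assms test_function_iterated_deriv[OF that, of k] unfolding is_weak_deriv_pair by force
  then show ?thesis
    unfolding is_weak_deriv_pair by (simp del: funpow.simps cong: imp_cong)
qed

lemma weak_deriv_Suc:
  assumes "is_weak_deriv 1 u v" shows "weak_deriv (Suc k) u = weak_deriv k v"
proof -
  have "is_weak_deriv (Suc k) u = is_weak_deriv k v"
    by (rule ext, rule is_weak_deriv_Suc[OF assms])
  then show ?thesis by (simp add: weak_deriv_def)
qed

lemma sobolev_0: "sobolev 0 = UNIV"
  by (auto simp: sobolev_def is_weak_deriv_0)

lemma sobolev_Suc: "u \<in> sobolev (Suc k) \<longleftrightarrow> (\<exists>v. is_weak_deriv 1 u v \<and> v \<in> sobolev k)"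
proof
  assume u: "u \<in> sobolev (Suc k)"
  then have "\<forall>j\<le>Suc k. \<exists>v. is_weak_deriv j u v" by (simp add: sobolev_def)
  then have "\<exists>v. is_weak_deriv (Suc 0) u v" by simp
  then obtain v where v: "is_weak_deriv 1 u v" by auto
  have "\<exists>w. is_weak_deriv j v w" if "j \<le> k" for j
    using u that is_weak_deriv_Suc[OF v, of j] unfolding sobolev_def by auto
  then show "\<exists>v. is_weak_deriv 1 u v \<and> v \<in> sobolev k"
    using v unfolding sobolev_def by blast
next
  assume "\<exists>v. is_weak_deriv 1 u v \<and> v \<in> sobolev k"
  then obtain v where v: "is_weak_deriv 1 u v" "v \<in> sobolev k" by blast
  have "\<exists>w. is_weak_deriv j u w" if "j \<le> Suc k" for j
  proof (cases j)
    case 0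
    then show ?thesis by (simp add: is_weak_deriv_0)
  next
    case (Suc i)
    then show ?thesis
      using v(2) that is_weak_deriv_Suc[OF v(1), of i] unfolding sobolev_def by auto
  qed
  then show "u \<in> sobolev (Suc k)" unfolding sobolev_def by blast
qed

section \<open>Traces at the origin\<close>

lemma zero_trace_add:
  assumes "zero_trace u" "zero_trace v" shows "zero_trace (u + v)"
proof -
  obtain f g where f: "continuous_on {0..} f" "AE x in half_line. rep_l2 u x = f x" "f 0 = 0"
    and g: "continuous_on {0..} g" "AE x in half_line. rep_l2 v x = g x" "g 0 = 0"
    using assms unfolding zero_trace_def by blast
  have "AE x in half_line. rep_l2 (u + v) x = f x + g x"
    using f(2) g(2) AE_rep_l2_add[of u v] by eventually_elim simp
  then show ?thesis
    unfolding zero_trace_def using f g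
    by (intro exI[of _ "\<lambda>x. f x + g x"]) (auto intro: continuous_on_add)
qed

lemma zero_trace_scaleC:
  assumes "zero_trace u" shows "zero_trace (c *\<^sub>C u)"
proof -
  obtain f where f: "continuous_on {0..} f" "AE x in half_line. rep_l2 u x = f x" "f 0 = 0"
    using assms unfolding zero_trace_def by blast
  have "AE x in half_line. rep_l2 (c *\<^sub>C u) x = c * f x"
    using f(2) AE_rep_l2_scaleC[of c u] by eventually_elim simp
  then show ?thesis
    unfolding zero_trace_def using f
    by (intro exI[of _ "\<lambda>x. c * f x"]) (auto intro: continuous_on_mult_left)
qed

lemma zero_trace_diff:
  assumes "zero_trace u" "zero_trace v" shows "zero_trace (u - v)"
proof -
  have "u - v = u + (-1) *\<^sub>C v"
    by (metis diff_conv_add_uminus uminus_scaleC)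
  then show ?thesis using assms zero_trace_add zero_trace_scaleC by metis
qed

text \<open>Weak derivatives are tested against real functions only, whereas integrating factors and
  oscillating packets are complex; the identity is extended to them through real and imaginary
  parts.\<close>

definition complex_test_function :: "(real \<Rightarrow> complex) \<Rightarrow> bool"
  where "complex_test_function \<Phi> \<longleftrightarrow> test_function (\<lambda>x. Re (\<Phi> x)) \<and> test_function (\<lambda>x. Im (\<Phi> x))"

lemma complex_test_function_emb:
  assumes "complex_test_function \<Phi>"
  shows "square_integrable \<Phi>"
    "abs_l2 \<Phi> = emb (\<lambda>x. Re (\<Phi> x)) + \<i> *\<^sub>C emb (\<lambda>x. Im (\<Phi> x))"
proof -
  have re: "square_integrable (\<lambda>x. complex_of_real (Re (\<Phi> x)))"
    and im: "square_integrable (\<lambda>x. complex_of_real (Im (\<Phi> x)))"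
    using assms square_integrable_test_function unfolding complex_test_function_def by auto
  have eq: "\<Phi> = (\<lambda>x. complex_of_real (Re (\<Phi> x)) + \<i> * complex_of_real (Im (\<Phi> x)))"
    by (simp add: fun_eq_iff complex_eq_iff)
  show "square_integrable \<Phi>"
    by (subst eq) (intro square_integrable_add square_integrable_mult_const re im)
  show "abs_l2 \<Phi> = emb (\<lambda>x. Re (\<Phi> x)) + \<i> *\<^sub>C emb (\<lambda>x. Im (\<Phi> x))"
    unfolding emb_def
    by (subst eq) (simp only: abs_l2_add[OF re square_integrable_mult_const[OF im]] abs_l2_scaleC[OF im])
qed

lemma complex_test_function_derivative:
  assumes \<Phi>: "complex_test_function \<Phi>" and d: "\<And>x. (\<Phi> has_vector_derivative \<Phi>' x) (at x)"
  shows "complex_test_function \<Phi>'"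
    "deriv (\<lambda>x. Re (\<Phi> x)) = (\<lambda>x. Re (\<Phi>' x))" "deriv (\<lambda>x. Im (\<Phi> x)) = (\<lambda>x. Im (\<Phi>' x))"
proof -
  have "((\<lambda>x. Re (\<Phi> x)) has_real_derivative Re (\<Phi>' x)) (at x)"
    "((\<lambda>x. Im (\<Phi> x)) has_real_derivative Im (\<Phi>' x)) (at x)" for x
    using bounded_linear.has_vector_derivative[OF bounded_linear_Re d]
      bounded_linear.has_vector_derivative[OF bounded_linear_Im d]
    by (simp_all add: has_real_derivative_iff_has_vector_derivative)
  then show *: "deriv (\<lambda>x. Re (\<Phi> x)) = (\<lambda>x. Re (\<Phi>' x))" "deriv (\<lambda>x. Im (\<Phi> x)) = (\<lambda>x. Im (\<Phi>' x))"
    by (auto simp: fun_eq_iff intro: DERIV_imp_deriv)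
  show "complex_test_function \<Phi>'"
    using \<Phi> test_function_deriv unfolding complex_test_function_def *[symmetric] by blast
qed

lemma weak_deriv_complex_test:
  assumes W: "is_weak_deriv 1 u v"
    and \<Phi>: "complex_test_function \<Phi>" and d: "\<And>x. (\<Phi> has_vector_derivative \<Phi>' x) (at x)"
  shows "pair u (abs_l2 \<Phi>') = - pair v (abs_l2 \<Phi>)"
proof -
  have "pair u (emb (deriv \<phi>)) = - pair v (emb \<phi>)" if "test_function \<phi>" for \<phi>
    using W that unfolding is_weak_deriv_pair by force
  then show ?thesis
    using \<Phi> complex_test_function_derivative(1)[OF \<Phi> d]
      complex_test_function_derivative(2,3)[OF \<Phi> d, symmetric]
    by (simp add: complex_test_function_emb pair_add_right pair_scaleC_right complex_test_function_def)
qed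

section \<open>The first-order equation z' = c z\<close>

lemma complex_test_function_exp:
  assumes "test_function \<psi>"
  shows "complex_test_function (\<lambda>x. exp (c * complex_of_real x) * complex_of_real (\<psi> x))"
proof -
  have sm: "smooth_fun (\<lambda>x. exp (Re c * x) * cos (Im c * x))" "smooth_fun (\<lambda>x. exp (Re c * x) * sin (Im c * x))"
    by (intro smooth_fun_intros(8) smooth_fun_exp_comp smooth_fun_cos_comp smooth_fun_sin_comp
        smooth_fun_cmult smooth_fun_intros(3))+
  have "Re (exp (c * complex_of_real x) * complex_of_real (\<psi> x)) = exp (Re c * x) * cos (Im c * x) * \<psi> x"
    "Im (exp (c * complex_of_real x) * complex_of_real (\<psi> x)) = exp (Re c * x) * sin (Im c * x) * \<psi> x" for x
    by (simp_all add: Re_exp Im_exp)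
  then show ?thesis
    unfolding complex_test_function_def
    using test_function_mult[OF assms sm(1)] test_function_mult[OF assms sm(2)] by (simp only: simp_thms)
qed

lemma exp_test_function_has_derivative:
  assumes "test_function \<psi>"
  shows "((\<lambda>x. exp (c * complex_of_real x) * complex_of_real (\<psi> x)) has_vector_derivative
    c * (exp (c * complex_of_real x) * complex_of_real (\<psi> x))
    + exp (c * complex_of_real x) * complex_of_real (deriv \<psi> x)) (at x)"
proof -
  have 1: "((\<lambda>x. complex_of_real (\<psi> x)) has_vector_derivative complex_of_real (deriv \<psi> x)) (at x)"
    using test_function_has_derivative[OF assms]
    by (auto intro: has_vector_derivative_of_real simp: has_real_derivative_iff_has_vector_derivative)
  have "((\<lambda>z. exp (c * z)) has_field_derivative c * exp (c * complex_of_real x)) (at (complex_of_real x))"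
    by (auto intro!: derivative_eq_intros)
  then have 2: "((\<lambda>x. exp (c * complex_of_real x)) has_vector_derivative c * exp (c * complex_of_real x)) (at x)"
    by (rule has_vector_derivative_real_field)
  show ?thesis
    using has_vector_derivative_mult[OF 2 1] by (simp add: algebra_simps)
qed

text \<open>After multiplication by the integrating factor exp (-c x) the weak derivative vanishes.
  The product need not be square integrable, which is why constancy is drawn from the locally
  integrable version of du Bois-Reymond.\<close>

lemma weak_ode_solution:
  assumes z: "is_weak_deriv 1 z (c *\<^sub>C z)"
  obtains C where "AE x in half_line. rep_l2 z x = C * exp (c * complex_of_real x)"
proof -
  define f where "f x = rep_l2 z x * exp (- c * complex_of_real x)" for x
  have cont: "continuous_on S (\<lambda>x. exp (- c * complex_of_real x))" for S
    by (intro continuous_intros)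
  have li: "locally_integrable f"
    unfolding locally_integrable_def
  proof (intro allI impI)
    fix \<alpha> \<beta> :: real assume ab: "0 < \<alpha>" "\<alpha> < \<beta>"
    have "bounded ((\<lambda>x. exp (- c * complex_of_real x)) ` {\<alpha>..\<beta>})"
      by (intro compact_imp_bounded compact_continuous_image cont) simp
    then obtain M where M: "M > 0" "\<forall>x\<in>{\<alpha>..\<beta>}. cmod (exp (- c * complex_of_real x)) \<le> M"
      unfolding bounded_pos by blast
    have "integrable lebesgue (\<lambda>x. rep_l2 z x * (indicator {\<alpha>..\<beta>} x *\<^sub>R exp (- c * complex_of_real x)))"
    proof (rule locally_integrable_mult_bounded[OF locally_integrable_rep_l2, of _ M \<alpha> \<beta>])
      show "(\<lambda>x. indicator {\<alpha>..\<beta>} x *\<^sub>R exp (- c * complex_of_real x)) \<in> borel_measurable lebesgue"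
        by (intro borel_measurable_scaleR borel_measurable_indicator measurable_completion) auto
    qed (use M ab in \<open>auto simp: indicator_def\<close>)
    then show "set_integrable lebesgue {\<alpha>..\<beta>} f"
      unfolding set_integrable_def f_def by (simp only: mult_scaleR_right)
  qed
  obtain C where C: "AE x in half_line. f x = C"
  proof (rule du_Bois_Reymond[OF li])
    fix \<psi> assume \<psi>: "test_function \<psi>"
    \<comment> \<open>The test function \<psi> times the integrating factor: the part -c \<Phi> of
      its derivative cancels against c z, and only \<Psi> remains.\<close>
    define \<Phi> where "\<Phi> x = exp (- c * complex_of_real x) * complex_of_real (\<psi> x)" for x
    define \<Psi> where "\<Psi> x = exp (- c * complex_of_real x) * complex_of_real (deriv \<psi> x)" for x
    have t: "complex_test_function \<Phi>" "complex_test_function \<Psi>"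
      unfolding \<Phi>_def \<Psi>_def by (rule complex_test_function_exp[OF \<psi>] complex_test_function_exp[OF test_function_deriv[OF \<psi>]])+
    note sq = complex_test_function_emb(1)[OF t(1)] complex_test_function_emb(1)[OF t(2)]
    have "(\<Phi> has_vector_derivative - c * \<Phi> x + \<Psi> x) (at x)" for x
      unfolding \<Phi>_def \<Psi>_def by (rule exp_test_function_has_derivative[OF \<psi>])
    from weak_deriv_complex_test[OF z t(1) this]
    have "pair z (abs_l2 (\<lambda>x. - c * \<Phi> x + \<Psi> x)) = - pair (c *\<^sub>C z) (abs_l2 \<Phi>)" .
    then have "pair z (abs_l2 \<Psi>) = 0"
      by (simp only: abs_l2_add[OF square_integrable_mult_const[OF sq(1)] sq(2)] abs_l2_scaleC[OF sq(1)]
          pair_add_right pair_scaleC_right pair_scaleC_left) simp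
    then show "(LINT x|half_line. f x * complex_of_real (deriv \<psi> x)) = 0"
      by (simp add: pair_abs_right[OF sq(2)] f_def \<Psi>_def mult.assoc)
  qed blast
  have "AE x in half_line. rep_l2 z x = C * exp (c * complex_of_real x)"
    using C
  proof eventually_elim
    case (elim x)
    have "exp (- c * complex_of_real x) * exp (c * complex_of_real x) = 1"
      by (simp flip: exp_add)
    then show ?case using elim unfolding f_def by (metis mult.assoc mult.right_neutral)
  qed
  then show thesis using that by blast
qed

text \<open>z equals C exp (c x) almost everywhere, and it has a continuous representative vanishing
  at 0. If C were nonzero, the two functions would differ on a whole right neighbourhood of 0, which
  is not null.\<close>

lemma weak_ode_zero_trace:
  assumes z: "is_weak_deriv 1 z (c *\<^sub>C z)" and tr: "zero_trace z"
  shows "z = 0"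
proof -
  obtain C where C: "AE x in half_line. rep_l2 z x = C * exp (c * complex_of_real x)"
    using weak_ode_solution[OF z] by blast
  obtain f where f: "continuous_on {0..} f" "AE x in half_line. rep_l2 z x = f x" "f 0 = 0"
    using tr unfolding zero_trace_def by blast
  have "C = 0"
  proof (rule ccontr)
    assume "C \<noteq> 0"
    define h where "h x = cmod (f x - C * exp (c * complex_of_real x))" for x
    have "continuous_on {0..} h" unfolding h_def by (intro continuous_intros f)
    moreover have "h 0 > 0" using \<open>C \<noteq> 0\<close> f(3) by (simp add: h_def)
    ultimately obtain \<delta> where \<delta>: "\<delta> > 0" "\<forall>x\<in>{0..}. dist x 0 < \<delta> \<longrightarrow> dist (h x) (h 0) < h 0"
      unfolding continuous_on_iff by (metis atLeast_iff order_refl)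
    have "AE x in half_line. x \<notin> {0<..<\<delta>}"
      using C f(2)
    proof eventually_elim
      case (elim x)
      then have "h x = 0" by (simp add: h_def)
      then show ?case using \<delta>(2) by (auto simp: dist_real_def)
    qed
    then show False using AE_half_line_not_interval \<delta>(1) by fastforce
  qed
  then show ?thesis
    using C by (intro l2_zeroI) simp
qed

text \<open>C exp (c x) has modulus at least |C| on (0, N), so the squared norm is at least |C|^2 N
  for every N. Square integrability takes the place of a boundary condition.\<close>

lemma weak_ode_growing:
  assumes z: "is_weak_deriv 1 z (c *\<^sub>C z)" and c: "Re c > 0"
  shows "z = 0"
proof -
  obtain C where C: "AE x in half_line. rep_l2 z x = C * exp (c * complex_of_real x)"
    using weak_ode_solution[OF z] by blast
  have "C = 0"
  proof (rule ccontr)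
    assume "C \<noteq> 0"
    have le: "(cmod C)\<^sup>2 * N \<le> (norm z)\<^sup>2" if "N \<ge> 0" for N
    proof -
      have "ennreal ((cmod C)\<^sup>2) * ennreal N = (\<integral>\<^sup>+x. ennreal ((cmod C)\<^sup>2) * indicator {0<..N} x \<partial>lebesgue)"
        using that by (subst nn_integral_cmult_indicator) auto
      also have "\<dots> = (\<integral>\<^sup>+x. (ennreal ((cmod C)\<^sup>2) * indicator {0<..N} x) * indicator {0<..} x \<partial>lebesgue)"
        by (rule nn_integral_cong) (auto simp: indicator_def)
      also have "\<dots> = (\<integral>\<^sup>+x. ennreal ((cmod C)\<^sup>2) * indicator {0<..N} x \<partial>half_line)"
        by (simp add: nn_integral_restrict_space)
      also have "\<dots> \<le> (\<integral>\<^sup>+x. ennreal ((cmod (rep_l2 z x))\<^sup>2) \<partial>half_line)"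
      proof (rule nn_integral_mono_AE, use C AE_half_line_pos in eventually_elim)
        case (elim x)
        have "cmod C \<le> cmod C * exp (Re c * x)"
          using elim c by (intro mult_le_cancel_left1[THEN iffD2]) auto
        also have "\<dots> = cmod (rep_l2 z x)"
          using elim by (simp add: norm_mult norm_exp_eq_Re)
        finally show ?case
          by (auto simp: indicator_def intro!: ennreal_leI power_mono)
      qed
      also have "\<dots> = ennreal ((norm z)\<^sup>2)" by (rule nn_integral_rep_l2)
      finally show ?thesis using that by (simp flip: ennreal_mult)
    qed
    \<comment> \<open>Chosen so that |C|^2 N exceeds the squared norm of z by 1.\<close>
    define N where "N = ((norm z)\<^sup>2 + 1) / (cmod C)\<^sup>2"
    have "(cmod C)\<^sup>2 * N = (norm z)\<^sup>2 + 1" using \<open>C \<noteq> 0\<close> by (simp add: N_def)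
    moreover have "N \<ge> 0" by (simp add: N_def)
    ultimately show False using le[of N] by simp
  qed
  then show ?thesis
    using C by (intro l2_zeroI) simp
qed

section \<open>Inverses of first-order operators\<close>

text \<open>Green's function of \<kappa> + D with value 0 at the origin; its transpose
  \<open>anticausal\<close> is the one of \<kappa> - D among square-integrable functions.\<close>

definition causal :: "complex \<Rightarrow> real \<Rightarrow> real \<Rightarrow> complex"
  where "causal \<kappa> x t = (if t < x then exp (- \<kappa> * complex_of_real (x - t)) else 0)"

definition anticausal :: "complex \<Rightarrow> real \<Rightarrow> real \<Rightarrow> complex"
  where "anticausal \<kappa> x t = (if x < t then exp (- \<kappa> * complex_of_real (t - x)) else 0)"

lemma causal_transpose: "(\<lambda>x t. causal \<kappa> t x) = anticausal \<kappa>"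
  by (simp add: fun_eq_iff causal_def anticausal_def)

lemma isCont_if_less:
  fixes f g :: "real \<Rightarrow> complex"
  assumes "isCont f x" "isCont g x" "x \<noteq> t"
  shows "isCont (\<lambda>y. if t < y then f y else g y) x"
proof (cases "t < x")
  case True
  then have "\<forall>\<^sub>F y in nhds x. (if t < y then f y else g y) = f y"
    by (intro eventually_mono[OF eventually_nhds_in_open[of "{t<..}"]]) auto
  then show ?thesis using isCont_cong[of "\<lambda>y. if t < y then f y else g y" f x] assms(1) by simp
next
  case False
  then have "\<forall>\<^sub>F y in nhds x. (if t < y then f y else g y) = g y"
    using assms(3) by (intro eventually_mono[OF eventually_nhds_in_open[of "{..<t}"]]) auto
  then show ?thesis using isCont_cong[of "\<lambda>y. if t < y then f y else g y" g x] assms(2) by simp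
qed

lemma decaying_causal:
  assumes "Re \<kappa> > 0"
  shows "decaying_kernel (Re \<kappa>) (causal \<kappa>)"
  unfolding decaying_kernel_def
proof (intro conjI allI impI)
  have [measurable]: "(\<lambda>t. t) \<in> borel_measurable half_line" by (rule measurable_ident_half_line)
  show "(\<lambda>(x, t). causal \<kappa> x t) \<in> borel_measurable (half_line \<Otimes>\<^sub>M half_line)"
    unfolding causal_def case_prod_beta by measurable
  show "causal \<kappa> x \<in> borel_measurable half_line" for x
    unfolding causal_def[abs_def] by measurable
  show "cmod (causal \<kappa> x t) \<le> exp (- Re \<kappa> * \<bar>x - t\<bar>)" for x t
    by (simp add: causal_def norm_exp_eq_Re)
  show "isCont (\<lambda>y. causal \<kappa> y t) x" if "x \<noteq> t" for x t
    unfolding causal_def by (rule isCont_if_less) (use that in \<open>auto intro!: continuous_intros\<close>)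
qed (rule assms)

lemma decaying_anticausal:
  assumes "Re \<kappa> > 0"
  shows "decaying_kernel (Re \<kappa>) (anticausal \<kappa>)"
  unfolding decaying_kernel_def
proof (intro conjI allI impI)
  have [measurable]: "(\<lambda>t. t) \<in> borel_measurable half_line" by (rule measurable_ident_half_line)
  show "(\<lambda>(x, t). anticausal \<kappa> x t) \<in> borel_measurable (half_line \<Otimes>\<^sub>M half_line)"
    unfolding anticausal_def case_prod_beta by measurable
  show "anticausal \<kappa> x \<in> borel_measurable half_line" for x
    unfolding anticausal_def[abs_def] by measurable
  show "cmod (anticausal \<kappa> x t) \<le> exp (- Re \<kappa> * \<bar>x - t\<bar>)" for x t
    by (simp add: anticausal_def norm_exp_eq_Re)
  show "isCont (\<lambda>y. anticausal \<kappa> y t) x" if "x \<noteq> t" for x t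
  proof -
    have "isCont (\<lambda>y. if t < y then 0 else exp (- \<kappa> * complex_of_real (t - y))) x"
      by (rule isCont_if_less) (use that in \<open>auto intro!: continuous_intros\<close>)
    then show ?thesis
    proof (rule isCont_cong[THEN iffD1, rotated])
      have "\<forall>\<^sub>F y in nhds x. y \<in> - {t}"
        by (rule eventually_nhds_in_open) (use that in auto)
      then show "\<forall>\<^sub>F y in nhds x. (if t < y then 0 else exp (- \<kappa> * complex_of_real (t - y))) = anticausal \<kappa> y t"
        by eventually_elim (auto simp: anticausal_def)
    qed
  qed
qed (rule assms)

definition causal_inv :: "complex \<Rightarrow> l2 \<Rightarrow> l2" where "causal_inv \<kappa> = kernel_op (causal \<kappa>)"
definition anticausal_inv :: "complex \<Rightarrow> l2 \<Rightarrow> l2" where "anticausal_inv \<kappa> = kernel_op (anticausal \<kappa>)"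

text \<open>The fundamental theorem of calculus delivers gauge integrals; this turns them into
  Lebesgue integrals over the half-line.\<close>

lemma half_line_integral_unique:
  fixes f :: "real \<Rightarrow> complex"
  assumes "integrable half_line f" "(f has_integral I) {0<..}"
  shows "integral\<^sup>L half_line f = I"
  using lebesgue_integral_eq_integral[OF assms(1)] integral_unique[OF assms(2)] by simp

lemma kernel_fun_emb:
  assumes k: "decaying_kernel \<sigma> k" and \<phi>: "test_function \<phi>" and x: "x \<ge> 0"
  shows "kernel_fun k (emb \<phi>) x = (LINT t|half_line. k x t * complex_of_real (\<phi> t))"
  unfolding kernel_fun_def emb_def
  by (rule pair_abs[OF square_integrable_decay[OF k x] square_integrable_test_function[OF \<phi>]])

lemma integrable_kernel_test:
  assumes k: "decaying_kernel \<sigma> k" and \<phi>: "test_function \<phi>" and x: "x \<ge> 0"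
  shows "integrable half_line (\<lambda>t. k x t * complex_of_real (\<phi> t))"
  by (rule integrable_mult_square_integrable[OF square_integrable_decay[OF k x] square_integrable_test_function[OF \<phi>]])

text \<open>Integration by parts: the fundamental theorem on [0, x] for exp (-\<kappa> (x - t))
  \<phi>(t) as a function of t, which vanishes at t = 0 because \<phi> is supported away from
  0.\<close>

lemma kernel_fun_causal_deriv:
  assumes \<kappa>: "Re \<kappa> > 0" and \<phi>: "test_function \<phi>" and x: "x > 0"
  shows "kernel_fun (causal \<kappa>) (emb (deriv \<phi>)) x = complex_of_real (\<phi> x) - \<kappa> * kernel_fun (causal \<kappa>) (emb \<phi>) x"
proof -
  note k = decaying_causal[OF \<kappa>]
  note x0 = less_imp_le[OF x]
  note d\<phi> = test_function_deriv[OF \<phi>]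
  have \<phi>0: "\<phi> 0 = 0" using \<phi> unfolding test_function_iff by force
  define G where "G t = exp (- \<kappa> * complex_of_real x) * (exp (\<kappa> * complex_of_real t) * complex_of_real (\<phi> t))" for t
  define g where "g t = exp (- \<kappa> * complex_of_real x) * (\<kappa> * (exp (\<kappa> * complex_of_real t) * complex_of_real (\<phi> t))
      + exp (\<kappa> * complex_of_real t) * complex_of_real (deriv \<phi> t))" for t
  have "(G has_vector_derivative g t) (at t)" for t
    unfolding G_def g_def by (rule has_vector_derivative_mult_right[OF exp_test_function_has_derivative[OF \<phi>]])
  then have "(g has_integral (G x - G 0)) {0..x}"
    by (intro fundamental_theorem_of_calculus x0) (rule has_vector_derivative_at_within)
  moreover have "G x - G 0 = complex_of_real (\<phi> x)"
    by (simp add: G_def \<phi>0 flip: exp_add mult.assoc)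
  ultimately have "(g has_integral complex_of_real (\<phi> x)) {0<..<x}"
    using has_integral_open_interval[of g "complex_of_real (\<phi> x)" 0 x] by simp
  then have "((\<lambda>t. if t \<in> {0<..<x} then g t else 0) has_integral complex_of_real (\<phi> x)) {0<..}"
    by (subst has_integral_restrict) auto
  moreover have "(if t \<in> {0<..<x} then g t else 0)
      = causal \<kappa> x t * complex_of_real (deriv \<phi> t) + \<kappa> * (causal \<kappa> x t * complex_of_real (\<phi> t))" if "t \<in> {0<..}" for t
  proof -
    have "exp (- \<kappa> * complex_of_real x) * exp (\<kappa> * complex_of_real t) = exp (- \<kappa> * complex_of_real (x - t))"
      by (simp add: algebra_simps flip: exp_add)
    moreover have "g t = (exp (- \<kappa> * complex_of_real x) * exp (\<kappa> * complex_of_real t)) * complex_of_real (deriv \<phi> t)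
        + \<kappa> * ((exp (- \<kappa> * complex_of_real x) * exp (\<kappa> * complex_of_real t)) * complex_of_real (\<phi> t))"
      unfolding g_def by (simp only: algebra_simps)
    ultimately have "g t = exp (- \<kappa> * complex_of_real (x - t)) * complex_of_real (deriv \<phi> t)
        + \<kappa> * (exp (- \<kappa> * complex_of_real (x - t)) * complex_of_real (\<phi> t))"
      by (simp only:)
    then show ?thesis using that by (auto simp: causal_def)
  qed
  ultimately have "((\<lambda>t. causal \<kappa> x t * complex_of_real (deriv \<phi> t) + \<kappa> * (causal \<kappa> x t * complex_of_real (\<phi> t)))
      has_integral complex_of_real (\<phi> x)) {0<..}"
    by (rule has_integral_eq[rotated])
  then have "(LINT t|half_line. causal \<kappa> x t * complex_of_real (deriv \<phi> t) + \<kappa> * (causal \<kappa> x t * complex_of_real (\<phi> t)))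
      = complex_of_real (\<phi> x)"
    by (intro half_line_integral_unique Bochner_Integration.integrable_add integrable_mult_right
        integrable_kernel_test[OF k _ x0] d\<phi> \<phi>)
  then have "kernel_fun (causal \<kappa>) (emb (deriv \<phi>)) x + \<kappa> * kernel_fun (causal \<kappa>) (emb \<phi>) x = complex_of_real (\<phi> x)"
    unfolding kernel_fun_emb[OF k d\<phi> x0] kernel_fun_emb[OF k \<phi> x0]
    by (simp add: integrable_kernel_test[OF k \<phi> x0] integrable_kernel_test[OF k d\<phi> x0])
  then show ?thesis by (simp add: algebra_simps)
qed

lemma kernel_fun_anticausal_deriv:
  assumes \<kappa>: "Re \<kappa> > 0" and \<phi>: "test_function \<phi>" and x: "x > 0"
  shows "kernel_fun (anticausal \<kappa>) (emb (deriv \<phi>)) x = \<kappa> * kernel_fun (anticausal \<kappa>) (emb \<phi>) x - complex_of_real (\<phi> x)"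
proof -
  note k = decaying_anticausal[OF \<kappa>]
  note x0 = less_imp_le[OF x]
  note d\<phi> = test_function_deriv[OF \<phi>]
  obtain \<alpha> \<beta> where supp: "\<forall>t. t \<notin> {\<alpha>..\<beta>} \<longrightarrow> \<phi> t = 0" using \<phi> unfolding test_function_iff by blast
  obtain \<alpha>' \<beta>' where supp': "\<forall>t. t \<notin> {\<alpha>'..\<beta>'} \<longrightarrow> deriv \<phi> t = 0" using d\<phi> unfolding test_function_iff by blast
  \<comment> \<open>A point beyond x and beyond the supports of \<phi> and its derivative: the
    boundary term at b vanishes and cutting the integral there loses nothing.\<close>
  define b where "b = max x (max \<beta> \<beta>') + 1"
  have b1: "x \<le> b" by (simp add: b_def)
  have b2: "\<phi> t = 0 \<and> deriv \<phi> t = 0" if "t \<ge> b" for t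
  proof -
    have "t \<notin> {\<alpha>..\<beta>}" "t \<notin> {\<alpha>'..\<beta>'}" using that by (auto simp: b_def)
    then show "\<phi> t = 0 \<and> deriv \<phi> t = 0" using supp supp' by blast
  qed
  define G where "G t = exp (\<kappa> * complex_of_real x) * (exp (- \<kappa> * complex_of_real t) * complex_of_real (\<phi> t))" for t
  define g where "g t = exp (\<kappa> * complex_of_real x) * (- \<kappa> * (exp (- \<kappa> * complex_of_real t) * complex_of_real (\<phi> t))
      + exp (- \<kappa> * complex_of_real t) * complex_of_real (deriv \<phi> t))" for t
  have "(G has_vector_derivative g t) (at t)" for t
    unfolding G_def g_def by (rule has_vector_derivative_mult_right[OF exp_test_function_has_derivative[OF \<phi>]])
  then have "(g has_integral (G b - G x)) {x..b}"
    by (intro fundamental_theorem_of_calculus b1) (rule has_vector_derivative_at_within)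
  moreover have "G b - G x = - complex_of_real (\<phi> x)"
    using b2[of b] by (simp add: G_def flip: exp_add mult.assoc)
  ultimately have "(g has_integral - complex_of_real (\<phi> x)) {x<..<b}"
    using has_integral_open_interval[of g "- complex_of_real (\<phi> x)" x b] by simp
  then have "((\<lambda>t. if t \<in> {x<..<b} then g t else 0) has_integral - complex_of_real (\<phi> x)) {0<..}"
    using x by (subst has_integral_restrict) auto
  moreover have "(if t \<in> {x<..<b} then g t else 0)
      = anticausal \<kappa> x t * complex_of_real (deriv \<phi> t) - \<kappa> * (anticausal \<kappa> x t * complex_of_real (\<phi> t))" if "t \<in> {0<..}" for t
  proof -
    have "exp (\<kappa> * complex_of_real x) * exp (- \<kappa> * complex_of_real t) = exp (- \<kappa> * complex_of_real (t - x))"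
      by (simp add: algebra_simps flip: exp_add)
    moreover have "g t = (exp (\<kappa> * complex_of_real x) * exp (- \<kappa> * complex_of_real t)) * complex_of_real (deriv \<phi> t)
        - \<kappa> * ((exp (\<kappa> * complex_of_real x) * exp (- \<kappa> * complex_of_real t)) * complex_of_real (\<phi> t))"
      unfolding g_def by (simp add: algebra_simps)
    ultimately have "g t = exp (- \<kappa> * complex_of_real (t - x)) * complex_of_real (deriv \<phi> t)
        - \<kappa> * (exp (- \<kappa> * complex_of_real (t - x)) * complex_of_real (\<phi> t))"
      by (simp only:)
    then show ?thesis using that b2[of t] by (auto simp: anticausal_def)
  qed
  ultimately have "((\<lambda>t. anticausal \<kappa> x t * complex_of_real (deriv \<phi> t) - \<kappa> * (anticausal \<kappa> x t * complex_of_real (\<phi> t)))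
      has_integral - complex_of_real (\<phi> x)) {0<..}"
    by (rule has_integral_eq[rotated])
  then have "(LINT t|half_line. anticausal \<kappa> x t * complex_of_real (deriv \<phi> t) - \<kappa> * (anticausal \<kappa> x t * complex_of_real (\<phi> t)))
      = - complex_of_real (\<phi> x)"
    by (intro half_line_integral_unique Bochner_Integration.integrable_diff integrable_mult_right
        integrable_kernel_test[OF k _ x0] d\<phi> \<phi>)
  then have "kernel_fun (anticausal \<kappa>) (emb (deriv \<phi>)) x - \<kappa> * kernel_fun (anticausal \<kappa>) (emb \<phi>) x = - complex_of_real (\<phi> x)"
    unfolding kernel_fun_emb[OF k d\<phi> x0] kernel_fun_emb[OF k \<phi> x0]
    by (simp add: integrable_kernel_test[OF k \<phi> x0] integrable_kernel_test[OF k d\<phi> x0])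
  then show ?thesis by (simp add: algebra_simps)
qed

section \<open>The two first-order inverses: boundedness, duality, derivatives, uniqueness\<close>

context
  fixes \<kappa> :: complex
  assumes \<kappa>: "Re \<kappa> > 0"
begin

lemma norm_causal_inv: "norm (causal_inv \<kappa> g) \<le> 2 / Re \<kappa> * norm g"
  and causal_inv_add: "causal_inv \<kappa> (g + h) = causal_inv \<kappa> g + causal_inv \<kappa> h"
  and causal_inv_scaleC: "causal_inv \<kappa> (c *\<^sub>C g) = c *\<^sub>C causal_inv \<kappa> g"
  unfolding causal_inv_def
  by (rule norm_kernel_op[OF decaying_causal[OF \<kappa>]] kernel_op_add[OF decaying_causal[OF \<kappa>]]
      kernel_op_scaleC[OF decaying_causal[OF \<kappa>]])+

lemma norm_anticausal_inv: "norm (anticausal_inv \<kappa> g) \<le> 2 / Re \<kappa> * norm g"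
  and anticausal_inv_add: "anticausal_inv \<kappa> (g + h) = anticausal_inv \<kappa> g + anticausal_inv \<kappa> h"
  and anticausal_inv_scaleC: "anticausal_inv \<kappa> (c *\<^sub>C g) = c *\<^sub>C anticausal_inv \<kappa> g"
  unfolding anticausal_inv_def
  by (rule norm_kernel_op[OF decaying_anticausal[OF \<kappa>]] kernel_op_add[OF decaying_anticausal[OF \<kappa>]]
      kernel_op_scaleC[OF decaying_anticausal[OF \<kappa>]])+

lemma pair_causal_inv: "pair (causal_inv \<kappa> g) h = pair g (anticausal_inv \<kappa> h)"
  unfolding causal_inv_def anticausal_inv_def
  using pair_kernel_op[OF decaying_causal[OF \<kappa>], of "Re \<kappa>" g h] decaying_anticausal[OF \<kappa>]
  by (simp only: causal_transpose)

lemma pair_anticausal_inv: "pair (anticausal_inv \<kappa> g) h = pair g (causal_inv \<kappa> h)"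
  using pair_causal_inv[of h g] by (simp only: pair_commute)

lemma causal_inv_emb_deriv:
  assumes \<phi>: "test_function \<phi>"
  shows "causal_inv \<kappa> (emb (deriv \<phi>)) = emb \<phi> - \<kappa> *\<^sub>C causal_inv \<kappa> (emb \<phi>)"
proof (rule l2_eqI)
  note k = decaying_causal[OF \<kappa>]
  show "AE x in half_line. rep_l2 (causal_inv \<kappa> (emb (deriv \<phi>))) x = rep_l2 (emb \<phi> - \<kappa> *\<^sub>C causal_inv \<kappa> (emb \<phi>)) x"
    using AE_half_line_pos AE_rep_kernel_op[OF k, of "emb (deriv \<phi>)"] AE_rep_kernel_op[OF k, of "emb \<phi>"]
      AE_rep_l2_diff[of "emb \<phi>" "\<kappa> *\<^sub>C causal_inv \<kappa> (emb \<phi>)"] AE_rep_l2_scaleC[of \<kappa> "causal_inv \<kappa> (emb \<phi>)"]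
      AE_rep_abs_l2[OF square_integrable_test_function[OF \<phi>], folded emb_def]
    by eventually_elim (simp add: causal_inv_def kernel_fun_causal_deriv[OF \<kappa> \<phi>])
qed

lemma anticausal_inv_emb_deriv:
  assumes \<phi>: "test_function \<phi>"
  shows "anticausal_inv \<kappa> (emb (deriv \<phi>)) = \<kappa> *\<^sub>C anticausal_inv \<kappa> (emb \<phi>) - emb \<phi>"
proof (rule l2_eqI)
  note k = decaying_anticausal[OF \<kappa>]
  show "AE x in half_line. rep_l2 (anticausal_inv \<kappa> (emb (deriv \<phi>))) x = rep_l2 (\<kappa> *\<^sub>C anticausal_inv \<kappa> (emb \<phi>) - emb \<phi>) x"
    using AE_half_line_pos AE_rep_kernel_op[OF k, of "emb (deriv \<phi>)"] AE_rep_kernel_op[OF k, of "emb \<phi>"]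
      AE_rep_l2_diff[of "\<kappa> *\<^sub>C anticausal_inv \<kappa> (emb \<phi>)" "emb \<phi>"] AE_rep_l2_scaleC[of \<kappa> "anticausal_inv \<kappa> (emb \<phi>)"]
      AE_rep_abs_l2[OF square_integrable_test_function[OF \<phi>], folded emb_def]
    by eventually_elim (simp add: anticausal_inv_def kernel_fun_anticausal_deriv[OF \<kappa> \<phi>])
qed

text \<open>By duality the causal inverse passes to the test function as the anticausal one, where
  the derivative has been computed by parts; \<open>g\<close> may thus be any element of
  \<open>l2\<close>.\<close>

lemma weak_deriv_causal_inv: "is_weak_deriv 1 (causal_inv \<kappa> g) (g - \<kappa> *\<^sub>C causal_inv \<kappa> g)"
  unfolding is_weak_deriv_pair
  by (simp add: pair_causal_inv anticausal_inv_emb_deriv pair_diff_left pair_diff_right pair_scaleC_left pair_scaleC_right)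

lemma weak_deriv_anticausal_inv: "is_weak_deriv 1 (anticausal_inv \<kappa> g) (\<kappa> *\<^sub>C anticausal_inv \<kappa> g - g)"
  unfolding is_weak_deriv_pair
  by (simp add: pair_anticausal_inv causal_inv_emb_deriv pair_diff_left pair_diff_right pair_scaleC_left pair_scaleC_right)

text \<open>At x = 0 the causal kernel integrates over an empty interval, and the kernel function is
  the continuous representative.\<close>

lemma zero_trace_causal_inv: "zero_trace (causal_inv \<kappa> g)"
  unfolding zero_trace_def
proof (intro exI conjI)
  note k = decaying_causal[OF \<kappa>]
  show "continuous_on {0..} (kernel_fun (causal \<kappa>) g)" by (rule continuous_kernel_fun[OF k])
  show "AE x in half_line. rep_l2 (causal_inv \<kappa> g) x = kernel_fun (causal \<kappa>) g x"
    unfolding causal_inv_def by (rule AE_rep_kernel_op[OF k])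
  have "kernel_fun (causal \<kappa>) g 0 = (LINT t|half_line. causal \<kappa> 0 t * rep_l2 g t)"
    by (rule kernel_fun_integral[OF k]) simp
  also have "\<dots> = (LINT t|half_line. 0)"
    by (rule Bochner_Integration.integral_cong) (auto simp: causal_def)
  finally show "kernel_fun (causal \<kappa>) g 0 = 0" by simp
qed

text \<open>u and the causal inverse solve the same first-order equation with zero trace, so their
  difference z satisfies z' = -\<kappa> z with zero trace and vanishes.\<close>

lemma causal_inv_weak_deriv:
  assumes u: "is_weak_deriv 1 u v" and tr: "zero_trace u"
  shows "causal_inv \<kappa> (v + \<kappa> *\<^sub>C u) = u"
proof -
  let ?z = "u - causal_inv \<kappa> (v + \<kappa> *\<^sub>C u)"
  have "is_weak_deriv 1 ?z (v - (v + \<kappa> *\<^sub>C u - \<kappa> *\<^sub>C causal_inv \<kappa> (v + \<kappa> *\<^sub>C u)))"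
    by (rule is_weak_deriv_diff[OF u weak_deriv_causal_inv])
  moreover have "v - (v + \<kappa> *\<^sub>C u - \<kappa> *\<^sub>C causal_inv \<kappa> (v + \<kappa> *\<^sub>C u)) = (- \<kappa>) *\<^sub>C ?z"
    by (simp add: complex_vector.scale_right_diff_distrib)
  ultimately have "?z = 0"
    using weak_ode_zero_trace zero_trace_diff[OF tr zero_trace_causal_inv] by metis
  then show ?thesis by simp
qed

text \<open>The difference z of the two solutions satisfies z' = \<kappa> z, and a nonzero growing
  exponential is not square integrable.\<close>

lemma anticausal_inv_weak_deriv:
  assumes u: "is_weak_deriv 1 u v"
  shows "anticausal_inv \<kappa> (\<kappa> *\<^sub>C u - v) = u"
proof -
  let ?z = "u - anticausal_inv \<kappa> (\<kappa> *\<^sub>C u - v)"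
  have "is_weak_deriv 1 ?z (v - (\<kappa> *\<^sub>C anticausal_inv \<kappa> (\<kappa> *\<^sub>C u - v) - (\<kappa> *\<^sub>C u - v)))"
    by (rule is_weak_deriv_diff[OF u weak_deriv_anticausal_inv])
  moreover have "v - (\<kappa> *\<^sub>C anticausal_inv \<kappa> (\<kappa> *\<^sub>C u - v) - (\<kappa> *\<^sub>C u - v)) = \<kappa> *\<^sub>C ?z"
    by (simp add: complex_vector.scale_right_diff_distrib)
  ultimately have "?z = 0"
    using weak_ode_growing \<kappa> by metis
  then show ?thesis by simp
qed

end

section \<open>Finite-rank perturbations\<close>

definition bounded_clinear :: "('a::complex_normed_vector \<Rightarrow> 'b::complex_normed_vector) \<Rightarrow> bool"
  where "bounded_clinear f \<longleftrightarrow> (\<forall>u v. f (u + v) = f u + f v) \<and> (\<forall>c u. f (c *\<^sub>C u) = c *\<^sub>C f u) \<and>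
    (\<exists>K. \<forall>u. norm (f u) \<le> K * norm u)"

definition bounded_functional :: "('a::complex_normed_vector \<Rightarrow> complex) \<Rightarrow> bool"
  where "bounded_functional f \<longleftrightarrow> (\<forall>u v. f (u + v) = f u + f v) \<and> (\<forall>c u. f (c *\<^sub>C u) = c * f u) \<and>
    (\<exists>K. \<forall>u. cmod (f u) \<le> K * norm u)"

text \<open>A list of pairs of functional and vector, with no independence asked, makes sums,
  multiples and compositions plain list operations. Boundedness of the functionals makes their
  common kernel closed.\<close>

definition finite_rank :: "('a::complex_normed_vector \<Rightarrow> 'b::complex_normed_vector) \<Rightarrow> bool"
  where "finite_rank F \<longleftrightarrow> (\<exists>xs. (\<forall>p\<in>set xs. bounded_functional (fst p)) \<and>
    (\<forall>u. F u = (\<Sum>p\<leftarrow>xs. fst p u *\<^sub>C snd p)))"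

lemma bounded_clinear_bound:
  assumes "bounded_clinear f"
  obtains K where "K > 0" "\<And>u. norm (f u) \<le> K * norm u"
proof -
  obtain K where K: "\<And>u. norm (f u) \<le> K * norm u"
    using assms unfolding bounded_clinear_def by blast
  have "norm (f u) \<le> (\<bar>K\<bar> + 1) * norm u" for u
    by (rule order_trans[OF K[of u]], rule mult_right_mono) auto
  then show thesis using that[of "\<bar>K\<bar> + 1"] by simp
qed

lemma bounded_clinear_compose:
  assumes f: "bounded_clinear f" and g: "bounded_clinear g"
  shows "bounded_clinear (\<lambda>u. f (g u))"
proof -
  obtain K where K: "K > 0" "\<And>u. norm (f u) \<le> K * norm u" using bounded_clinear_bound[OF f] by blast
  obtain L where L: "\<And>u. norm (g u) \<le> L * norm u" using bounded_clinear_bound[OF g] by blast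
  have "norm (f (g u)) \<le> (K * L) * norm u" for u
    unfolding mult.assoc by (rule order_trans[OF K(2)[of "g u"]], rule mult_left_mono[OF L]) (use K(1) in simp)
  then show ?thesis using f g unfolding bounded_clinear_def by auto
qed

lemma bounded_functional_compose:
  assumes f: "bounded_functional f" and g: "bounded_clinear g"
  shows "bounded_functional (\<lambda>u. f (g u))"
proof -
  obtain K where K: "\<And>u. cmod (f u) \<le> K * norm u" using f unfolding bounded_functional_def by blast
  obtain L where L: "L > 0" "\<And>u. norm (g u) \<le> L * norm u" using bounded_clinear_bound[OF g] by blast
  have "cmod (f (g u)) \<le> (\<bar>K\<bar> * L) * norm u" for u
  proof -
    have "cmod (f (g u)) \<le> \<bar>K\<bar> * norm (g u)"
      by (rule order_trans[OF K[of "g u"]], rule mult_right_mono) auto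
    also have "\<dots> \<le> \<bar>K\<bar> * (L * norm u)" by (rule mult_left_mono[OF L(2)]) simp
    finally show ?thesis by (simp add: mult.assoc)
  qed
  then show ?thesis using f g unfolding bounded_functional_def bounded_clinear_def by auto
qed

lemma finite_rank_compose:
  assumes F: "finite_rank F" and g: "bounded_clinear g"
  shows "finite_rank (\<lambda>u. F (g u))"
proof -
  obtain xs where xs: "\<forall>p\<in>set xs. bounded_functional (fst p)" "\<And>u. F u = (\<Sum>p\<leftarrow>xs. fst p u *\<^sub>C snd p)"
    using F unfolding finite_rank_def by blast
  show ?thesis
    unfolding finite_rank_def
    by (intro exI[of _ "map (\<lambda>p. (\<lambda>u. fst p (g u), snd p)) xs"])
      (use xs bounded_functional_compose[OF _ g] in \<open>auto simp: o_def\<close>)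
qed

lemma finite_rank_add:
  assumes "finite_rank F" "finite_rank G"
  shows "finite_rank (\<lambda>u. F u + G u)"
proof -
  obtain xs where xs: "\<forall>p\<in>set xs. bounded_functional (fst p)" "\<And>u. F u = (\<Sum>p\<leftarrow>xs. fst p u *\<^sub>C snd p)"
    using assms(1) unfolding finite_rank_def by blast
  obtain ys where ys: "\<forall>p\<in>set ys. bounded_functional (fst p)" "\<And>u. G u = (\<Sum>p\<leftarrow>ys. fst p u *\<^sub>C snd p)"
    using assms(2) unfolding finite_rank_def by blast
  show ?thesis
    unfolding finite_rank_def by (intro exI[of _ "xs @ ys"]) (use xs ys in auto)
qed

lemma scaleC_sum_list: "c *\<^sub>C (\<Sum>x\<leftarrow>xs. f x) = (\<Sum>x\<leftarrow>xs. c *\<^sub>C f x)"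
  by (induction xs) (auto simp: scaleC_add_right)

lemma finite_rank_scaleC:
  assumes "finite_rank F"
  shows "finite_rank (\<lambda>u. c *\<^sub>C F u)"
proof -
  obtain xs where xs: "\<forall>p\<in>set xs. bounded_functional (fst p)" "\<And>u. F u = (\<Sum>p\<leftarrow>xs. fst p u *\<^sub>C snd p)"
    using assms unfolding finite_rank_def by blast
  show ?thesis
    unfolding finite_rank_def
    by (intro exI[of _ "map (\<lambda>p. (fst p, c *\<^sub>C snd p)) xs"])
      (use xs in \<open>auto simp: o_def scaleC_sum_list scaleC_scaleC mult.commute\<close>)
qed

lemma finite_rank_linear:
  assumes "finite_rank F"
  shows "F (u + v) = F u + F v" "F (c *\<^sub>C u) = c *\<^sub>C F u"
proof -
  obtain xs where xs: "\<forall>p\<in>set xs. bounded_functional (fst p)" "\<And>u. F u = (\<Sum>p\<leftarrow>xs. fst p u *\<^sub>C snd p)"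
    using assms unfolding finite_rank_def by blast
  have "(\<Sum>p\<leftarrow>xs. fst p (u + v) *\<^sub>C snd p) = (\<Sum>p\<leftarrow>xs. fst p u *\<^sub>C snd p) + (\<Sum>p\<leftarrow>xs. fst p v *\<^sub>C snd p)"
    using xs(1) by (induction xs) (auto simp: bounded_functional_def scaleC_add_left algebra_simps)
  then show "F (u + v) = F u + F v" by (simp add: xs(2))
  have "(\<Sum>p\<leftarrow>xs. fst p (c *\<^sub>C u) *\<^sub>C snd p) = c *\<^sub>C (\<Sum>p\<leftarrow>xs. fst p u *\<^sub>C snd p)"
    using xs(1) by (induction xs) (auto simp: bounded_functional_def scaleC_add_right scaleC_scaleC)
  then show "F (c *\<^sub>C u) = c *\<^sub>C F u" by (simp add: xs(2))
qed

section \<open>Closed subspaces enlarged by finitely many vectors\<close>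

lemma tendsto_scaleC_left:
  fixes v :: "'a::complex_normed_vector"
  assumes "c \<longlonglongrightarrow> l"
  shows "(\<lambda>n. c n *\<^sub>C v) \<longlonglongrightarrow> l *\<^sub>C v"
proof (rule LIM_zero_cancel, rule tendsto_norm_zero_cancel)
  have "norm (c n *\<^sub>C v - l *\<^sub>C v) = cmod (c n - l) * norm v" for n
    by (simp add: norm_scaleC flip: complex_vector.scale_left_diff_distrib)
  moreover have "(\<lambda>n. cmod (c n - l) * norm v) \<longlonglongrightarrow> 0 * norm v"
    by (intro tendsto_mult tendsto_const tendsto_norm_zero LIM_zero assms)
  ultimately show "(\<lambda>n. norm (c n *\<^sub>C v - l *\<^sub>C v)) \<longlonglongrightarrow> 0" by simp
qed

text \<open>A vector v outside the closed subspace M has positive distance \<delta> from it, so |c|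
  \<delta> is at most the norm of x + c v for x in M. The coefficients of a convergent sequence are
  therefore Cauchy, and both summands converge.\<close>

lemma closed_add_line:
  fixes M :: "'a::complex_normed_vector set"
  assumes M: "complex_vector.subspace M" "closed M"
  shows "closed {x + c *\<^sub>C v | x c. x \<in> M}"
proof (cases "v \<in> M")
  case True
  have "{x + c *\<^sub>C v | x c. x \<in> M} = M"
  proof (intro equalityI subsetI)
    fix x assume "x \<in> M"
    then show "x \<in> {x + c *\<^sub>C v | x c. x \<in> M}"
      by (intro CollectI exI[of _ x] exI[of _ 0]) simp
  qed (use M(1) True in \<open>auto intro: complex_vector.subspace_add complex_vector.subspace_scale\<close>)
  then show ?thesis using M(2) by simp
next
  case False
  then obtain \<delta> where \<delta>: "\<delta> > 0" "\<And>y. dist y v < \<delta> \<Longrightarrow> y \<notin> M"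
    using M(2) unfolding closed_def open_dist by (metis ComplD ComplI)
  have lower: "cmod c * \<delta> \<le> norm (x + c *\<^sub>C v)" if "x \<in> M" for x c
  proof (cases "c = 0")
    case False
    have "(- inverse c) *\<^sub>C x \<in> M" using M(1) that by (rule complex_vector.subspace_scale)
    then have "\<delta> \<le> norm ((- inverse c) *\<^sub>C x - v)"
      using \<delta>(2)[of "(- inverse c) *\<^sub>C x"] by (force simp: dist_norm)
    then have "cmod c * \<delta> \<le> cmod c * norm ((- inverse c) *\<^sub>C x - v)"
      by (rule mult_left_mono) simp
    also have "\<dots> = norm ((- c) *\<^sub>C ((- inverse c) *\<^sub>C x - v))"
      by (simp only: norm_scaleC norm_minus_cancel)
    also have "(- c) *\<^sub>C ((- inverse c) *\<^sub>C x - v) = x + c *\<^sub>C v"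
      using False by (simp add: complex_vector.scale_right_diff_distrib scaleC_scaleC scaleC_one)
    finally show ?thesis .
  qed simp
  show ?thesis
    unfolding closed_sequential_limits
  proof (intro allI impI)
    fix y l assume y: "(\<forall>n. y n \<in> {x + c *\<^sub>C v | x c. x \<in> M}) \<and> y \<longlonglongrightarrow> l"
    then have "\<forall>n. \<exists>x c. y n = x + c *\<^sub>C v \<and> x \<in> M" by auto
    then obtain x c where xc: "\<And>n. y n = x n + c n *\<^sub>C v" "\<And>n. x n \<in> M" by metis
    have "Cauchy c"
    proof (rule metric_CauchyI)
      fix e :: real assume "e > 0"
      then obtain N where N: "\<forall>m\<ge>N. \<forall>n\<ge>N. dist (y m) (y n) < e * \<delta>"
        using LIMSEQ_imp_Cauchy[of y l] y \<delta>(1) unfolding Cauchy_def by (meson mult_pos_pos)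
      have "dist (c m) (c n) < e" if "m \<ge> N" "n \<ge> N" for m n
      proof -
        have "y m - y n = (x m - x n) + (c m - c n) *\<^sub>C v"
          by (simp add: xc complex_vector.scale_left_diff_distrib)
        moreover have "x m - x n \<in> M" using M(1) xc(2) by (intro complex_vector.subspace_diff)
        ultimately have "cmod (c m - c n) * \<delta> \<le> norm (y m - y n)" using lower by metis
        also have "\<dots> < e * \<delta>" using N that by (simp add: dist_norm)
        finally show ?thesis using \<delta>(1) by (simp add: dist_norm)
      qed
      then show "\<exists>M. \<forall>m\<ge>M. \<forall>n\<ge>M. dist (c m) (c n) < e" by blast
    qed
    then obtain k where k: "c \<longlonglongrightarrow> k" using Cauchy_convergent convergent_def by blast
    have "(\<lambda>n. y n - c n *\<^sub>C v) \<longlonglongrightarrow> l - k *\<^sub>C v"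
      using y by (intro tendsto_diff tendsto_scaleC_left k) simp
    moreover have "(\<lambda>n. y n - c n *\<^sub>C v) = x" by (simp add: xc(1))
    ultimately have "l - k *\<^sub>C v \<in> M"
      using M(2) xc(2) closed_sequentially by metis
    then show "l \<in> {x + c *\<^sub>C v | x c. x \<in> M}"
      by (intro CollectI exI[of _ "l - k *\<^sub>C v"] exI[of _ k]) simp
  qed
qed

lemma closed_add_span:
  fixes M :: "'a::complex_normed_vector set"
  assumes M: "complex_vector.subspace M" "closed M" and "finite S"
  shows "closed {x + y | x y. x \<in> M \<and> y \<in> complex_vector.span S}"
  using \<open>finite S\<close>
proof induction
  case empty
  have "{x + y | x y. x \<in> M \<and> y \<in> complex_vector.span {}} = M" by auto
  then show ?case using M(2) by simp
next
  case (insert v S)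
  let ?N = "{x + y | x y. x \<in> M \<and> y \<in> complex_vector.span S}"
  have "complex_vector.subspace ?N"
    using complex_vector.subspace_sums[OF M(1) complex_vector.subspace_span] .
  moreover have "{x + y | x y. x \<in> M \<and> y \<in> complex_vector.span (insert v S)} = {x + c *\<^sub>C v | x c. x \<in> ?N}"
  proof (intro equalityI subsetI)
    fix z assume "z \<in> {x + y | x y. x \<in> M \<and> y \<in> complex_vector.span (insert v S)}"
    then obtain x y where xy: "z = x + y" "x \<in> M" "y \<in> complex_vector.span (insert v S)" by blast
    obtain k where "y - k *\<^sub>C v \<in> complex_vector.span S"
      using xy(3) complex_vector.span_breakdown_eq by blast
    then show "z \<in> {x + c *\<^sub>C v | x c. x \<in> ?N}"
      using xy by (intro CollectI exI[of _ "x + (y - k *\<^sub>C v)"] exI[of _ k]) auto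
  next
    fix z assume "z \<in> {x + c *\<^sub>C v | x c. x \<in> ?N}"
    then obtain x y c where xy: "z = (x + y) + c *\<^sub>C v" "x \<in> M" "y \<in> complex_vector.span S" by blast
    have "y + c *\<^sub>C v \<in> complex_vector.span (insert v S)"
      using xy(3) by (intro complex_vector.span_add complex_vector.span_scale)
        (auto intro: complex_vector.span_base complex_vector.span_mono[THEN subsetD])
    then show "z \<in> {x + y | x y. x \<in> M \<and> y \<in> complex_vector.span (insert v S)}"
      using xy by (intro CollectI exI[of _ x] exI[of _ "y + c *\<^sub>C v"]) (simp add: add.assoc)
  qed
  ultimately show ?case using closed_add_line[OF _ insert.IH] by simp
qed

text \<open>Each y is congruent modulo S to some f y in the span of B. Vectors independent modulo S
  keep independent images under f, and those lie in a span of m vectors. By symmetry the codimension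
  is unique, which gives meaning to the description in \<open>deficiency\<close>.\<close>

lemma has_codim_le:
  assumes S: "complex_vector.subspace S" and "has_codim S m" "has_codim S n"
  shows "n \<le> m"
proof -
  obtain B where B: "finite B" "card B = m" "\<And>c. (\<Sum>b\<in>B. c b *\<^sub>C b) \<in> S \<Longrightarrow> (\<forall>b\<in>B. c b = 0)"
    "\<And>y. \<exists>c. y - (\<Sum>b\<in>B. c b *\<^sub>C b) \<in> S"
    using assms(2) unfolding has_codim_def by blast
  obtain B' where B': "finite B'" "card B' = n" "\<And>c. (\<Sum>b\<in>B'. c b *\<^sub>C b) \<in> S \<Longrightarrow> (\<forall>b\<in>B'. c b = 0)"
    using assms(3) unfolding has_codim_def by blast
  obtain k where k: "\<And>y. y - (\<Sum>b\<in>B. k y b *\<^sub>C b) \<in> S" using B(4) by metis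
  define f where "f y = (\<Sum>b\<in>B. k y b *\<^sub>C b)" for y
  have comb: "(\<forall>b\<in>B'. c b = 0)" if "(\<Sum>b\<in>B'. c b *\<^sub>C f b) = 0" for c
  proof (rule B'(3))
    have "(\<Sum>b\<in>B'. c b *\<^sub>C (b - f b)) \<in> S"
      using k unfolding f_def
      by (intro complex_vector.subspace_sum[OF S] complex_vector.subspace_scale[OF S])
    then show "(\<Sum>b\<in>B'. c b *\<^sub>C b) \<in> S"
      using that by (simp add: complex_vector.scale_right_diff_distrib sum_subtractf)
  qed
  have inj: "inj_on f B'"
  proof (rule inj_onI, rule ccontr)
    fix x y assume xy: "x \<in> B'" "y \<in> B'" "f x = f y" "x \<noteq> y"
    \<comment> \<open>Equal images of distinct x and y would yield the nontrivial relation f x - f y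
      = 0.\<close>
    define c :: "_ \<Rightarrow> complex" where "c b = (if b = x then 1 else if b = y then -1 else 0)" for b
    have "(\<Sum>b\<in>B'. c b *\<^sub>C f b) = (\<Sum>b\<in>{x, y}. c b *\<^sub>C f b)"
      using xy by (intro sum.mono_neutral_right B') (auto simp: c_def)
    also have "\<dots> = 0" using xy by (simp add: c_def scaleC_one)
    finally have "c x = 0" using comb xy by blast
    then show False by (simp add: c_def)
  qed
  have "complex_vector.independent (f ` B')"
  proof (rule complex_vector.independent_if_scalars_zero)
    show "finite (f ` B')" using B' by simp
    fix c x assume "(\<Sum>x\<in>f ` B'. c x *\<^sub>C x) = 0" "x \<in> f ` B'"
    then show "c x = 0"
      using comb[of "\<lambda>b. c (f b)"] by (auto simp: sum.reindex[OF inj])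
  qed
  moreover have "f ` B' \<subseteq> complex_vector.span B"
    unfolding f_def by (auto intro!: complex_vector.span_sum complex_vector.span_scale intro: complex_vector.span_base)
  ultimately have "card (f ` B') \<le> card B"
    using complex_vector.independent_span_bound[OF B(1)] by blast
  then show ?thesis using B B' card_image[OF inj] by simp
qed

lemma deficiency_eqI:
  assumes "complex_vector.subspace (T ` D)" "has_codim (T ` D) n"
  shows "deficiency D T = n"
  unfolding deficiency_def
  by (rule the_equality) (use assms has_codim_le in \<open>auto intro!: antisym\<close>)

text \<open>Induction on the list. If some e in the common kernel of the other functionals has f e
  \<noteq> 0, a multiple of e corrects f without disturbing them; otherwise f vanishes wherever they
  all do.\<close>

lemma finite_rank_kernel_codim:
  fixes fs :: "('a::complex_normed_vector \<Rightarrow> complex) list"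
  assumes "\<forall>f\<in>set fs. bounded_functional f"
  shows "\<exists>H. finite H \<and> (\<forall>y. \<exists>h\<in>complex_vector.span H. \<forall>f\<in>set fs. f (y - h) = 0)"
  using assms
proof (induction fs)
  case Nil
  then show ?case by (intro exI[of _ "{}"]) auto
next
  case (Cons f fs)
  then obtain H where H: "finite H" "\<And>y. \<exists>h\<in>complex_vector.span H. \<forall>f\<in>set fs. f (y - h) = 0"
    by auto
  have lin: "g (u - v) = g u - g v" "g (c *\<^sub>C u) = c * g u" if "g \<in> set (f # fs)" for g u v c
  proof -
    have b: "bounded_functional g" using Cons.prems that by blast
    then show "g (c *\<^sub>C u) = c * g u" by (simp add: bounded_functional_def)
    have "g (u - v + v) = g (u - v) + g v" using b unfolding bounded_functional_def by blast
    then show "g (u - v) = g u - g v" by simp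
  qed
  show ?case
  proof (cases "\<exists>e. f e \<noteq> 0 \<and> (\<forall>g\<in>set fs. g e = 0)")
    case True
    then obtain e where e: "f e \<noteq> 0" "\<forall>g\<in>set fs. g e = 0" by blast
    show ?thesis
    proof (intro exI[of _ "insert e H"] conjI allI)
      fix y
      obtain h where h: "h \<in> complex_vector.span H" "\<forall>g\<in>set fs. g (y - h) = 0" using H(2) by blast
      define k where "k = f (y - h) / f e"
      show "\<exists>h\<in>complex_vector.span (insert e H). \<forall>g\<in>set (f # fs). g (y - h) = 0"
      proof (intro bexI ballI)
        show "h + k *\<^sub>C e \<in> complex_vector.span (insert e H)"
          using h(1) by (intro complex_vector.span_add complex_vector.span_scale)
            (auto intro: complex_vector.span_base complex_vector.span_mono[THEN subsetD])
        fix g assume g: "g \<in> set (f # fs)"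
        have "g (y - (h + k *\<^sub>C e)) = g (y - h) - k * g e"
          using lin[OF g] by (simp only: diff_diff_eq[symmetric])
        then show "g (y - (h + k *\<^sub>C e)) = 0"
          using g h(2) e by (auto simp: k_def)
      qed
    qed (use H in simp)
  next
    case False
    have "\<exists>h\<in>complex_vector.span H. \<forall>g\<in>set (f # fs). g (y - h) = 0" for y
      using H(2)[of y] False by auto
    then show ?thesis using H(1) by blast
  qed
qed

lemma finite_rank_range:
  assumes "finite_rank F"
  obtains G where "finite G" "\<And>u. F u \<in> complex_vector.span G"
proof -
  obtain xs where xs: "\<And>u. F u = (\<Sum>p\<leftarrow>xs. fst p u *\<^sub>C snd p)"
    using assms unfolding finite_rank_def by blast
  have "(\<Sum>p\<leftarrow>xs. fst p u *\<^sub>C snd p) \<in> complex_vector.span (snd ` set xs)" for u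
  proof (induction xs)
    case (Cons p xs)
    have "(\<Sum>p\<leftarrow>xs. fst p u *\<^sub>C snd p) \<in> complex_vector.span (snd ` set (p # xs))"
      using Cons complex_vector.span_mono[of "snd ` set xs" "snd ` set (p # xs)"] by auto
    moreover have "fst p u *\<^sub>C snd p \<in> complex_vector.span (snd ` set (p # xs))"
      by (intro complex_vector.span_scale complex_vector.span_base) simp
    ultimately show ?case by (simp add: complex_vector.span_add)
  qed simp
  then show thesis using that[of "snd ` set xs"] xs by simp
qed

text \<open>On the closed common kernel N of the functionals, 1 + F is the identity. As N and a
  finite set H together span the space, the range is N plus the span of the images of H.\<close>

lemma closed_range_one_plus_finite_rank:
  fixes F :: "'a::complex_normed_vector \<Rightarrow> 'a"
  assumes F: "finite_rank F"
  shows "closed (range (\<lambda>y. y + F y))"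
proof -
  obtain xs where xs: "\<forall>p\<in>set xs. bounded_functional (fst p)" "\<And>u. F u = (\<Sum>p\<leftarrow>xs. fst p u *\<^sub>C snd p)"
    using F unfolding finite_rank_def by blast
  define N where "N = {y. \<forall>f\<in>fst ` set xs. f y = 0}"
  have zero: "F y = 0" if "y \<in> N" for y
  proof -
    have "(\<Sum>p\<leftarrow>ps. fst p y *\<^sub>C snd p) = 0" if "set ps \<subseteq> set xs" for ps
      using that \<open>y \<in> N\<close> by (induction ps) (auto simp: N_def)
    then show ?thesis by (simp add: xs(2))
  qed
  have bf: "bounded_functional f" if "f \<in> fst ` set xs" for f using xs(1) that by auto
  have sub: "complex_vector.subspace N"
  proof (rule complex_vector.subspaceI)
    have "f 0 = 0" if "f \<in> fst ` set xs" for f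
    proof -
      have "f (0 *\<^sub>C 0) = 0 * f 0" using bf[OF that] unfolding bounded_functional_def by blast
      then show ?thesis by simp
    qed
    then show "0 \<in> N" unfolding N_def by blast
  next
    have hom: "f (x + y) = f x + f y" "f (c *\<^sub>C x) = c * f x" if "f \<in> fst ` set xs" for f c x y
      using bf[OF that] unfolding bounded_functional_def by blast+
    have N: "f x = 0" if "x \<in> N" "f \<in> fst ` set xs" for f x
      using that unfolding N_def by blast
    show "x + y \<in> N" if "x \<in> N" "y \<in> N" for x y
      unfolding N_def by (intro CollectI ballI) (simp only: hom(1) N that add_0)
    show "c *\<^sub>C x \<in> N" if "x \<in> N" for c x
      unfolding N_def by (intro CollectI ballI) (simp only: hom(2) N that mult_zero_right)
  qed
  have "closed N"
    unfolding closed_sequential_limits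
  proof (intro allI impI)
    fix y l assume y: "(\<forall>n. y n \<in> N) \<and> y \<longlonglongrightarrow> l"
    have "f l = 0" if f: "f \<in> fst ` set xs" for f
    proof -
      obtain K where K: "\<And>u. cmod (f u) \<le> K * norm u" using bf[OF f] unfolding bounded_functional_def by blast
      have add: "f (u + v) = f u + f v" for u v using bf[OF f] unfolding bounded_functional_def by blast
      have "cmod (f l) \<le> K * norm (l - y n)" for n
      proof -
        have "f (y n) = 0" using y f unfolding N_def by blast
        then have "f l = f (l - y n)" using add[of "l - y n" "y n"] by simp
        then show ?thesis using K[of "l - y n"] by simp
      qed
      moreover have "(\<lambda>n. K * norm (l - y n)) \<longlonglongrightarrow> K * norm (l - l)"
        using y by (intro tendsto_intros) auto
      ultimately have "cmod (f l) \<le> K * norm (l - l)"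
        by (intro LIMSEQ_le_const) auto
      then show ?thesis by simp
    qed
    then show "l \<in> N" unfolding N_def by blast
  qed
  obtain H where H: "finite H" "\<And>y. \<exists>h\<in>complex_vector.span H. \<forall>f\<in>fst ` set xs. f (y - h) = 0"
    using finite_rank_kernel_codim[of "map fst xs"] xs(1) by auto
  have lin: "Vector_Spaces.linear (*\<^sub>C) (*\<^sub>C) (\<lambda>y. y + F y)"
    by unfold_locales (simp_all add: finite_rank_linear[OF F] scaleC_add_right)
  interpret vp: vector_space_pair "scaleC :: complex \<Rightarrow> 'a \<Rightarrow> 'a" "scaleC :: complex \<Rightarrow> 'a \<Rightarrow> 'a" ..
  have "range (\<lambda>y. y + F y) = {x + y | x y. x \<in> N \<and> y \<in> complex_vector.span ((\<lambda>y. y + F y) ` H)}"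
  proof (intro equalityI subsetI)
    fix z assume "z \<in> range (\<lambda>y. y + F y)"
    then obtain y where y: "z = y + F y" by blast
    obtain h where h: "h \<in> complex_vector.span H" "y - h \<in> N" using H(2)[of y] unfolding N_def by blast
    have "z = (y - h) + (h + F h)"
      using zero[OF h(2)] finite_rank_linear(1)[OF F, of "y - h" h] by (simp add: y)
    moreover have "h + F h \<in> complex_vector.span ((\<lambda>y. y + F y) ` H)"
      using vp.linear_span_image[OF lin, of H] h(1) by (metis imageI)
    ultimately show "z \<in> {x + y | x y. x \<in> N \<and> y \<in> complex_vector.span ((\<lambda>y. y + F y) ` H)}"
      using h(2) by blast
  next
    fix z assume "z \<in> {x + y | x y. x \<in> N \<and> y \<in> complex_vector.span ((\<lambda>y. y + F y) ` H)}"
    then obtain x h where "z = x + (h + F h)" "x \<in> N"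
      using vp.linear_span_image[OF lin, of H] by auto
    then have "z = (x + h) + F (x + h)"
      using zero[of x] by (simp add: finite_rank_linear[OF F])
    then show "z \<in> range (\<lambda>y. y + F y)" by blast
  qed
  then show ?thesis
    using closed_add_span[OF sub \<open>closed N\<close>] H(1) by simp
qed

text \<open>The coordinates of v in the joint basis are supported in A and in B at once.\<close>

lemma span_disjoint_independent:
  assumes ind: "complex_vector.independent (A \<union> B)" and disj: "A \<inter> B = {}"
    and v: "v \<in> complex_vector.span A" "v \<in> complex_vector.span B"
  shows "v = 0"
proof -
  have "complex_vector.representation (A \<union> B) v b = 0" for b
  proof (cases "b \<in> A")
    case True
    then have "complex_vector.representation B v b = 0"
      using complex_vector.representation_ne_zero[of B v b] disj by blast
    then show ?thesis
      using complex_vector.representation_extend[OF ind v(2)] by simp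
  next
    case False
    then have "complex_vector.representation A v b = 0"
      using complex_vector.representation_ne_zero[of A v b] by blast
    then show ?thesis
      using complex_vector.representation_extend[OF ind v(1)] by simp
  qed
  moreover have "v \<in> complex_vector.span (A \<union> B)"
    using v(1) complex_vector.span_mono[of A "A \<union> B"] by auto
  ultimately show ?thesis
    using complex_vector.sum_nonzero_representation_eq[OF ind] by fastforce
qed

lemma sum_scaled_in_span:
  "(\<Sum>b\<in>B. c b *\<^sub>C b) \<in> complex_vector.span B"
  by (intro complex_vector.span_sum complex_vector.span_scale complex_vector.span_base)

text \<open>Range and kernel of \<open>1 + F\<close> are compared inside a finite-dimensional space \<open>Z\<close> containing
  the range of \<open>F\<close>: the kernel lies in \<open>Z\<close>, and \<open>1 + F\<close> is the identity modulo \<open>Z\<close>.\<close>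

lemma one_plus_finite_rank_index:
  fixes F :: "'a::complex_normed_vector \<Rightarrow> 'a"
  assumes F: "finite_rank F"
  obtains B where "finite B" "complex_vector.independent B"
    "complex_vector.span B = {y. y + F y = 0}"
    "has_codim (range (\<lambda>y. y + F y)) (card B)"
proof -
  define A where "A y = y + F y" for y
  interpret vp: vector_space_pair "scaleC :: complex \<Rightarrow> 'a \<Rightarrow> 'a" "scaleC :: complex \<Rightarrow> 'a \<Rightarrow> 'a" ..
  have lin: "Vector_Spaces.linear (*\<^sub>C) (*\<^sub>C) A"
    unfolding A_def[abs_def] by unfold_locales (simp_all add: finite_rank_linear[OF F] scaleC_add_right)
  obtain G where G: "finite G" "\<And>u. F u \<in> complex_vector.span G" using finite_rank_range[OF F] by blast
  define Z where "Z = complex_vector.span G"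
  have Zsub: "complex_vector.subspace Z" unfolding Z_def by (rule complex_vector.subspace_span)
  have FZ: "F u \<in> Z" for u unfolding Z_def by (rule G(2))
  have AZ: "A z \<in> Z \<longleftrightarrow> z \<in> Z" for z
    using complex_vector.subspace_add[OF Zsub _ FZ[of z]] complex_vector.subspace_diff[OF Zsub _ FZ[of z], of "A z"]
    by (auto simp: A_def)
  have fin: "finite T" if "complex_vector.independent T" "T \<subseteq> Z" for T
    using complex_vector.independent_span_bound[OF G(1) that(1)] that(2) unfolding Z_def by blast
  define Ker where "Ker = {y. A y = 0}"
  have KerZ: "Ker \<subseteq> Z"
    using AZ complex_vector.subspace_0[OF Zsub] unfolding Ker_def by force
  have Kersub: "complex_vector.subspace Ker"
    unfolding Ker_def by (rule vp.linear_subspace_kernel[OF lin])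
  obtain B1 where B1: "B1 \<subseteq> Ker" "complex_vector.independent B1" "Ker \<subseteq> complex_vector.span B1"
    using complex_vector.maximal_independent_subset[of Ker] by blast
  have sB1: "complex_vector.span B1 = Ker"
    using B1 complex_vector.span_minimal[OF B1(1) Kersub] by blast
  obtain E where E: "B1 \<subseteq> E" "E \<subseteq> Z" "complex_vector.independent E" "Z \<subseteq> complex_vector.span E"
    using complex_vector.maximal_independent_subset_extend[of B1 Z] B1 KerZ by blast
  have sE: "complex_vector.span E = Z"
    using E complex_vector.span_minimal[OF E(2) Zsub] by blast
  \<comment> \<open>Rank-nullity in Z with its parts named: B1 spans the kernel, B2 completes it to
    a basis E, A is injective on the span of B2, and C completes the image of B2 to another basis
    E'. Comparing cardinalities, C has as many elements as B1.\<close>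
  define B2 where "B2 = E - B1"
  have EU: "E = B1 \<union> B2" "B1 \<inter> B2 = {}" using E(1) by (auto simp: B2_def)
  have fE: "finite E" "finite B1" "finite B2" using fin[OF E(3,2)] EU by auto
  have indB2: "complex_vector.independent B2"
    using E(3) by (rule complex_vector.independent_mono) (auto simp: B2_def)
  have inj: "inj_on A (complex_vector.span B2)"
  proof (rule inj_onI)
    fix u v assume uv: "u \<in> complex_vector.span B2" "v \<in> complex_vector.span B2" "A u = A v"
    have "A (u - v) = A u - A v" by (rule vp.linear_diff[OF lin])
    then have "u - v \<in> complex_vector.span B1" using uv(3) unfolding sB1 Ker_def by simp
    moreover have "u - v \<in> complex_vector.span B2" using uv by (intro complex_vector.span_diff)
    ultimately have "u - v = 0"
      using span_disjoint_independent[of B1 B2] E(3) EU by metis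
    then show "u = v" by simp
  qed
  have indA: "complex_vector.independent (A ` B2)"
    by (rule vp.linear_independent_injective_image[OF lin indB2 inj])
  have cardA: "card (A ` B2) = card B2"
    by (rule card_image[OF inj_on_subset[OF inj complex_vector.span_superset]])
  have "A ` B2 \<subseteq> Z" using E(2) AZ by (auto simp: B2_def)
  then obtain E' where E': "A ` B2 \<subseteq> E'" "E' \<subseteq> Z" "complex_vector.independent E'" "Z \<subseteq> complex_vector.span E'"
    using complex_vector.maximal_independent_subset_extend[of "A ` B2" Z] indA by blast
  have sE': "complex_vector.span E' = Z"
    using E' complex_vector.span_minimal[OF E'(2) Zsub] by blast
  define C where "C = E' - A ` B2"
  have EU': "E' = A ` B2 \<union> C" "A ` B2 \<inter> C = {}" using E'(1) by (auto simp: C_def)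
  have fC: "finite E'" "finite C" using fin[OF E'(3,2)] EU' by auto
  have "card E = card E'"
    using complex_vector.dim_eq_card[of E Z] complex_vector.dim_eq_card[of E' Z] E(3) E'(3) sE sE'
      complex_vector.span_span[of E] by (metis (no_types))
  moreover have "card E = card B1 + card B2" "card E' = card B2 + card C"
    using EU EU' fE fC cardA by (auto simp: card_Un_disjoint)
  ultimately have cardC: "card C = card B1" by simp
  have span_split: "\<exists>u\<in>complex_vector.span S. \<exists>v\<in>complex_vector.span T. y = u + v"
    if "y \<in> complex_vector.span (S \<union> T)" for y :: 'a and S T
    using that unfolding complex_vector.span_Un by auto
  have indC: "complex_vector.independent C"
    using E'(3) by (rule complex_vector.independent_mono) (auto simp: C_def)
  have "has_codim (range A) (card B1)"
    unfolding has_codim_def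
  proof (intro exI[of _ C] conjI allI impI)
    fix c assume c: "(\<Sum>b\<in>C. c b *\<^sub>C b) \<in> range A"
    then obtain y where y: "(\<Sum>b\<in>C. c b *\<^sub>C b) = A y" by blast
    have sC: "(\<Sum>b\<in>C. c b *\<^sub>C b) \<in> complex_vector.span C" by (rule sum_scaled_in_span)
    then have "A y \<in> Z"
      unfolding y sE'[symmetric] using complex_vector.span_mono[of C E'] EU' by auto
    then have "y \<in> complex_vector.span (B1 \<union> B2)" using AZ sE EU by simp
    then obtain u v where uv: "u \<in> complex_vector.span B1" "v \<in> complex_vector.span B2" "y = u + v"
      using span_split by blast
    have "A y = A v"
      using uv(1) unfolding uv(3) sB1 Ker_def by (simp add: vp.linear_add[OF lin])
    then have "A y \<in> complex_vector.span (A ` B2)"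
      using vp.linear_span_image[OF lin, of B2] uv(2) by (metis imageI)
    then have "A y = 0"
      using span_disjoint_independent[of "A ` B2" C "A y"] sC[unfolded y] E'(3) EU' by metis
    then show "\<forall>b\<in>C. c b = 0"
      using complex_vector.independentD[OF indC fC(2) subset_refl] y by metis
  next
    fix y
    \<comment> \<open>Since y = A y - F y, modulo the range y is congruent to -F y, an element of Z;
      the component of it along the image of B2 is again in the range, and only the component along
      C survives.\<close>
    have "- F y \<in> complex_vector.span (A ` B2 \<union> C)"
      using complex_vector.subspace_neg[OF Zsub FZ[of y]] sE' EU' by simp
    then obtain u v where uv: "u \<in> complex_vector.span (A ` B2)" "v \<in> complex_vector.span C" "- F y = u + v"
      using span_split by blast
    obtain z where z: "u = A z"
      using uv(1) vp.linear_span_image[OF lin, of B2] by (metis imageE)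
    obtain c where c: "v = (\<Sum>b\<in>C. c b *\<^sub>C b)"
      using uv(2) complex_vector.span_finite[OF fC(2)] by auto
    have "y = A y + (- F y)" by (simp add: A_def)
    then have "y - v = A (y + z)"
      unfolding uv(3) z vp.linear_add[OF lin] by (simp add: algebra_simps)
    then show "\<exists>c. y - (\<Sum>b\<in>C. c b *\<^sub>C b) \<in> range A"
      using c by blast
  qed (use fC cardC in auto)
  then show thesis
    using that[of B1] fE B1(2) sB1 unfolding Ker_def A_def[abs_def] by blast
qed

text \<open>T is 1 + F composed with the bijection J: its range is that of 1 + F, and the linear
  inverse of J carries the kernel of 1 + F onto the null space of T, so both dimensions are those
  found for 1 + F.\<close>

theorem bijective_plus_finite_rank:
  fixes J :: "'x::complex_normed_vector \<Rightarrow> 'y::complex_normed_vector"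
  assumes D: "complex_vector.subspace D" and J: "bij_betw J D UNIV"
    and add: "\<And>u v. u \<in> D \<Longrightarrow> v \<in> D \<Longrightarrow> J (u + v) = J u + J v"
    and scale: "\<And>c u. u \<in> D \<Longrightarrow> J (c *\<^sub>C u) = c *\<^sub>C J u"
    and F: "finite_rank F" and T: "\<And>u. u \<in> D \<Longrightarrow> T u = J u + F (J u)"
  shows "closed (T ` D)" "\<exists>n. has_codim (T ` D) n" "finite_dim (null_space D T)"
    "deficiency D T = nullity D T"
proof -
  have TD: "T ` D = range (\<lambda>y. y + F y)"
  proof -
    have "T ` D = (\<lambda>y. y + F y) ` (J ` D)" using T by (simp add: image_image)
    then show ?thesis using J by (simp add: bij_betw_def)
  qed
  show "closed (T ` D)" unfolding TD by (rule closed_range_one_plus_finite_rank[OF F])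
  obtain B where B: "finite B" "complex_vector.independent B"
    "complex_vector.span B = {y. y + F y = 0}" "has_codim (range (\<lambda>y. y + F y)) (card B)"
    using one_plus_finite_rank_index[OF F] by blast
  then show "\<exists>n. has_codim (T ` D) n" unfolding TD by blast
  define I where "I = the_inv_into D J"
  have I: "I y \<in> D" "J (I y) = y" for y
    unfolding I_def using J f_the_inv_into_f_bij_betw[OF J] the_inv_into_into[of J D] by (auto simp: bij_betw_def)
  have IJ: "I (J u) = u" if "u \<in> D" for u
    unfolding I_def using that J by (auto simp: bij_betw_def intro: the_inv_into_f_f)
  have I_eqI: "I y = u" if "u \<in> D" "J u = y" for u y using IJ that by blast
  interpret vp: vector_space_pair "scaleC :: complex \<Rightarrow> 'y \<Rightarrow> 'y" "scaleC :: complex \<Rightarrow> 'x \<Rightarrow> 'x" ..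
  have lin: "Vector_Spaces.linear (*\<^sub>C) (*\<^sub>C) I"
  proof
    show "I (x + y) = I x + I y" for x y
      by (rule I_eqI) (simp_all add: complex_vector.subspace_add[OF D] I add)
    show "I (c *\<^sub>C x) = c *\<^sub>C I x" for c x
      by (rule I_eqI) (simp_all add: complex_vector.subspace_scale[OF D] I scale)
  qed
  have inj: "inj I" by (rule inj_on_inverseI[of _ J]) (rule I(2))
  have "null_space D T = I ` {y. y + F y = 0}"
  proof (intro equalityI subsetI)
    fix u assume "u \<in> null_space D T"
    then have "u = I (J u)" "J u + F (J u) = 0" using T IJ by (auto simp: null_space_def)
    then show "u \<in> I ` {y. y + F y = 0}" by blast
  qed (use T I in \<open>auto simp: null_space_def\<close>)
  then have ns: "null_space D T = complex_vector.span (I ` B)"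
    using vp.linear_span_image[OF lin, of B] B(3) by simp
  then show "finite_dim (null_space D T)" using B(1) unfolding finite_dim_def by blast
  have ind: "complex_vector.independent (I ` B)"
    by (rule vp.linear_independent_injective_image[OF lin B(2) inj_on_subset[OF inj]]) simp
  then have "nullity D T = card B"
    unfolding nullity_def ns
    using complex_vector.dim_span_eq_card_independent[OF ind] card_image[OF inj_on_subset[OF inj], of B] by simp
  moreover have "deficiency D T = card B"
  proof (rule deficiency_eqI)
    interpret vp': vector_space_pair "scaleC :: complex \<Rightarrow> 'y \<Rightarrow> 'y" "scaleC :: complex \<Rightarrow> 'y \<Rightarrow> 'y" ..
    have "Vector_Spaces.linear (*\<^sub>C) (*\<^sub>C) (\<lambda>y. y + F y)"
      by unfold_locales (simp_all add: finite_rank_linear[OF F] scaleC_add_right)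
    then show "complex_vector.subspace (T ` D)"
      unfolding TD by (rule vp'.linear_subspace_image) (rule complex_vector.subspace_UNIV)
  qed (use B(4) TD in simp)
  ultimately show "deficiency D T = nullity D T" by simp
qed

section \<open>Decaying multipliers\<close>

definition bounded_multiplier :: "real \<Rightarrow> (real \<Rightarrow> real) \<Rightarrow> bool"
  where "bounded_multiplier M m \<longleftrightarrow> M \<ge> 0 \<and> m \<in> borel_measurable half_line \<and> (\<forall>x>0. \<bar>m x\<bar> \<le> M)"

lemma square_integrable_mult_bounded:
  assumes m: "bounded_multiplier M m" and f: "square_integrable f"
  shows "square_integrable (\<lambda>x. complex_of_real (m x) * f x)"
    "norm (abs_l2 (\<lambda>x. complex_of_real (m x) * f x)) \<le> M * norm (abs_l2 f)"
proof -
  have [measurable]: "m \<in> borel_measurable half_line" "f \<in> borel_measurable half_line"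
    using m f by (auto simp: bounded_multiplier_def square_integrable_def)
  have "(\<integral>\<^sup>+x. ennreal ((cmod (complex_of_real (m x) * f x))\<^sup>2) \<partial>half_line)
      \<le> (\<integral>\<^sup>+x. ennreal (M\<^sup>2) * ennreal ((cmod (f x))\<^sup>2) \<partial>half_line)"
  proof (rule nn_integral_mono_AE, use AE_half_line_pos in eventually_elim)
    case (elim x)
    have "(cmod (complex_of_real (m x) * f x))\<^sup>2 = \<bar>m x\<bar>\<^sup>2 * (cmod (f x))\<^sup>2"
      by (simp add: norm_mult power_mult_distrib)
    also have "\<dots> \<le> M\<^sup>2 * (cmod (f x))\<^sup>2"
      using m elim by (intro mult_right_mono power_mono) (auto simp: bounded_multiplier_def)
    finally show ?case by (simp flip: ennreal_mult)
  qed
  also have "\<dots> = ennreal (M\<^sup>2) * (\<integral>\<^sup>+x. ennreal ((cmod (f x))\<^sup>2) \<partial>half_line)"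
    by (rule nn_integral_cmult) measurable
  also have "\<dots> = ennreal ((M * norm (abs_l2 f))\<^sup>2)"
    unfolding nn_integral_abs_l2[OF f] by (simp add: power_mult_distrib ennreal_mult)
  finally have le: "(\<integral>\<^sup>+x. ennreal ((cmod (complex_of_real (m x) * f x))\<^sup>2) \<partial>half_line)
      \<le> ennreal ((M * norm (abs_l2 f))\<^sup>2)" .
  have M: "M * norm (abs_l2 f) \<ge> 0" using m by (simp add: bounded_multiplier_def)
  have meas: "(\<lambda>x. complex_of_real (m x) * f x) \<in> borel_measurable half_line" by measurable
  show "square_integrable (\<lambda>x. complex_of_real (m x) * f x)"
    "norm (abs_l2 (\<lambda>x. complex_of_real (m x) * f x)) \<le> M * norm (abs_l2 f)"
    using norm_l2_leI[OF meas le M] by auto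
qed

lemma AE_rep_mult_by:
  assumes "bounded_multiplier M m"
  shows "AE x in half_line. rep_l2 (mult_by m u) x = complex_of_real (m x) * rep_l2 u x"
  unfolding mult_by_def by (rule AE_rep_abs_l2[OF square_integrable_mult_bounded(1)[OF assms square_integrable_rep_l2]])

lemma norm_mult_by:
  assumes "bounded_multiplier M m"
  shows "norm (mult_by m u) \<le> M * norm u"
  unfolding mult_by_def using square_integrable_mult_bounded(2)[OF assms square_integrable_rep_l2, of u]
  by (simp add: abs_rep_l2)

lemma bounded_clinear_mult_by:
  assumes m: "bounded_multiplier M m"
  shows "bounded_clinear (mult_by m)"
  unfolding bounded_clinear_def
proof (intro conjI allI exI)
  show "mult_by m (u + v) = mult_by m u + mult_by m v" for u v
  proof (rule l2_eqI)
    show "AE x in half_line. rep_l2 (mult_by m (u + v)) x = rep_l2 (mult_by m u + mult_by m v) x"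
      using AE_rep_mult_by[OF m, of "u + v"] AE_rep_mult_by[OF m, of u] AE_rep_mult_by[OF m, of v]
        AE_rep_l2_add[of u v] AE_rep_l2_add[of "mult_by m u" "mult_by m v"]
      by eventually_elim (simp add: distrib_left)
  qed
  show "mult_by m (c *\<^sub>C u) = c *\<^sub>C mult_by m u" for c u
  proof (rule l2_eqI)
    show "AE x in half_line. rep_l2 (mult_by m (c *\<^sub>C u)) x = rep_l2 (c *\<^sub>C mult_by m u) x"
      using AE_rep_mult_by[OF m, of "c *\<^sub>C u"] AE_rep_mult_by[OF m, of u]
        AE_rep_l2_scaleC[of c u] AE_rep_l2_scaleC[of c "mult_by m u"]
      by eventually_elim simp
  qed
  show "norm (mult_by m u) \<le> M * norm u" for u by (rule norm_mult_by[OF m])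
qed

lemma bounded_clinear_causal_inv: "Re \<kappa> > 0 \<Longrightarrow> bounded_clinear (causal_inv \<kappa>)"
  and bounded_clinear_anticausal_inv: "Re \<kappa> > 0 \<Longrightarrow> bounded_clinear (anticausal_inv \<kappa>)"
  unfolding bounded_clinear_def using causal_inv_add causal_inv_scaleC norm_causal_inv anticausal_inv_add anticausal_inv_scaleC norm_anticausal_inv by blast+

lemma bounded_functional_pair: "bounded_functional (pair u)"
  unfolding bounded_functional_def using pair_add_right pair_scaleC_right Cauchy_Schwarz_l2 by blast

text \<open>The kernel depends continuously on its first variable as an element of \<open>l2\<close>, uniformly on
  compact intervals. Freezing that variable on the cells of a fine partition of \<open>[0, N]\<close> and
  discarding the rest, where the multiplier is small, leaves an operator of finite rank.\<close>

theorem finite_rank_approximation: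
  assumes m: "bounded_multiplier M m" and lim: "(m \<longlongrightarrow> 0) at_top"
    and \<kappa>: "Re \<kappa> > 0" and \<epsilon>: "\<epsilon> > 0"
  obtains F where "finite_rank F" "\<And>g. norm (mult_by m (anticausal_inv \<kappa> g) - F g) \<le> \<epsilon> * norm g"
proof -
  note k = decaying_anticausal[OF \<kappa>]
  define E where "E x = abs_l2 (anticausal \<kappa> x)" for x
  have cont: "continuous_on {0..} E" unfolding E_def[abs_def] by (rule continuous_kernel[OF k])
  have M0: "M \<ge> 0" using m by (simp add: bounded_multiplier_def)
  \<comment> \<open>C bounds the norm of the anticausal inverse; the tail where |m| \<le> \<epsilon>
    / (2 C) then accounts for \<epsilon>/2.\<close>
  define C where "C = 2 / Re \<kappa>"
  have C: "C > 0" using \<kappa> by (simp add: C_def)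
  have "\<forall>\<^sub>F x in at_top. dist (m x) 0 < \<epsilon> / (2 * C)"
    using tendstoD[OF lim, of "\<epsilon> / (2 * C)"] \<epsilon> C by simp
  then obtain N0 where N0: "\<And>x. x \<ge> N0 \<Longrightarrow> \<bar>m x\<bar> < \<epsilon> / (2 * C)"
    unfolding eventually_at_top_linorder by (auto simp: dist_real_def)
  define N where "N = max N0 1"
  have N: "N > 0" "\<And>x. x > N \<Longrightarrow> \<bar>m x\<bar> \<le> \<epsilon> / (2 * C)"
    using N0 by (auto simp: N_def intro: less_imp_le)
  \<comment> \<open>A pointwise error M \<eta> times the norm of g, on an interval of length N,
    costs M \<eta> sqrt N in L2, hence at most \<epsilon>/2. Using M + 1 keeps the denominator
    positive when M = 0.\<close>
  define \<eta> where "\<eta> = \<epsilon> / (2 * (M + 1) * sqrt N)"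
  have \<eta>: "\<eta> > 0" using \<epsilon> M0 N by (simp add: \<eta>_def)
  have "uniformly_continuous_on {0..N} E"
    by (intro compact_uniformly_continuous continuous_on_subset[OF cont]) auto
  then obtain \<delta> where \<delta>: "\<delta> > 0" "\<And>x y. x \<in> {0..N} \<Longrightarrow> y \<in> {0..N} \<Longrightarrow> dist x y < \<delta> \<Longrightarrow> dist (E x) (E y) < \<eta>"
    unfolding uniformly_continuous_on_def using \<eta> by metis
  obtain n :: nat where n: "N / \<delta> < real n" using reals_Archimedean2 by blast
  have n0: "n > 0" using n N(1) \<delta>(1) by (metis divide_pos_pos gr0I of_nat_0 order_less_asym)
  define h where "h = N / real n"
  have h: "h > 0" "h < \<delta>" "real n * h = N"
    using n n0 N(1) \<delta>(1) by (auto simp: h_def field_simps)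
  \<comment> \<open>The cells tile (0, N]; on each one the kernel slice is frozen at the left
    end.\<close>
  define cell where "cell j = {real j * h<..real (Suc j) * h}" for j
  define b where "b j x = complex_of_real (m x) * complex_of_real (indicator (cell j) x)" for j x
  have sq_ind: "square_integrable (\<lambda>x. complex_of_real (indicator (cell j) x))" for j
  proof (rule norm_l2_bounded_support(1)[of _ 1 "real j * h" "real (Suc j) * h"])
    have "(\<lambda>x. indicator (cell j) x :: real) \<in> borel_measurable half_line"
      unfolding cell_def by (intro measurable_restrict_space1 borel_measurable_indicator) simp
    then show "(\<lambda>x. complex_of_real (indicator (cell j) x)) \<in> borel_measurable half_line"
      by measurable
  qed (use h in \<open>auto simp: indicator_def cell_def\<close>)
  have sq_b: "square_integrable (b j)" for j
    unfolding b_def by (rule square_integrable_mult_bounded(1)[OF m sq_ind])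
  define F where "F g = (\<Sum>j\<leftarrow>[0..<n]. pair (E (real j * h)) g *\<^sub>C abs_l2 (b j))" for g
  have "finite_rank F"
    unfolding finite_rank_def F_def
    by (intro exI[of _ "map (\<lambda>j. (pair (E (real j * h)), abs_l2 (b j))) [0..<n]"])
      (auto simp: o_def bounded_functional_pair)
  moreover have "norm (mult_by m (anticausal_inv \<kappa> g) - F g) \<le> \<epsilon> * norm g" for g
  proof -
    define s where "s x = (\<Sum>j\<leftarrow>[0..<n]. pair (E (real j * h)) g * b j x)" for x
    have s: "square_integrable s \<and> abs_l2 s = F g"
    proof -
      have "square_integrable (\<lambda>x. \<Sum>j\<leftarrow>js. pair (E (real j * h)) g * b j x) \<and>
          abs_l2 (\<lambda>x. \<Sum>j\<leftarrow>js. pair (E (real j * h)) g * b j x)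
          = (\<Sum>j\<leftarrow>js. pair (E (real j * h)) g *\<^sub>C abs_l2 (b j))" for js
      proof (induction js)
        case Nil
        then show ?case by (simp add: square_integrable_zero zero_l2_def)
      next
        case (Cons j js)
        then show ?case
          by (simp add: square_integrable_add square_integrable_mult_const sq_b abs_l2_add abs_l2_scaleC)
      qed
      then show ?thesis unfolding s_def[abs_def] F_def by blast
    qed
    define q where "q = kernel_fun (anticausal \<kappa>) g"
    have q: "square_integrable q" "abs_l2 q = anticausal_inv \<kappa> g"
      unfolding q_def anticausal_inv_def kernel_op_def using square_integrable_kernel_fun[OF k] by auto
    have s_val: "s x = complex_of_real (m x) * pair (E (real j * h)) g"
      if "j < n" "x \<in> cell j" for x j
    proof -
      have "indicator (cell i) x = (if i = j then 1 else 0 :: real)" for i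
      proof -
        have "i = j" if "x \<in> cell i"
        proof -
          have "real j * h < real (Suc i) * h" "real i * h < real (Suc j) * h"
            using that \<open>x \<in> cell j\<close> by (auto simp: cell_def)
          then have "j < Suc i" "i < Suc j" using h(1) by (simp_all only: mult_less_cancel_right_pos of_nat_less_iff)
          then show ?thesis by simp
        qed
        then show ?thesis using \<open>x \<in> cell j\<close> by (cases "i = j") (simp, metis indicator_simps(2))
      qed
      then have "s x = (\<Sum>i\<leftarrow>[0..<n]. if i = j then pair (E (real i * h)) g * complex_of_real (m x) else 0)"
        unfolding s_def b_def by (intro arg_cong[where f = sum_list] map_cong) auto
      also have "\<dots> = (\<Sum>i<n. if i = j then pair (E (real i * h)) g * complex_of_real (m x) else 0)"
        by (simp add: interv_sum_list_conv_sum_set_nat atLeast0LessThan)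
      also have "\<dots> = pair (E (real j * h)) g * complex_of_real (m x)"
        using that by simp
      finally show ?thesis by simp
    qed
    have s_out: "s x = 0" if "x > N" for x
    proof -
      have "x \<notin> cell j" if "j < n" for j
      proof -
        have "real (Suc j) * h \<le> real n * h" using that h(1) by (intro mult_right_mono) auto
        then show ?thesis using \<open>x > N\<close> h(3) by (auto simp: cell_def)
      qed
      then have "s x = (\<Sum>j\<leftarrow>[0..<n]. 0)"
        unfolding s_def b_def by (intro arg_cong[where f = sum_list] map_cong) auto
      then show ?thesis by simp
    qed
    have in_cell: "\<exists>j<n. x \<in> cell j" if "0 < x" "x \<le> N" for x
    proof -
      \<comment> \<open>Ceiling minus 1, because a common end point belongs to the cell on its
        left.\<close>
      define j where "j = nat (\<lceil>x / h\<rceil> - 1)"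
      have pos: "x / h > 0" using that h by simp
      have j: "real j = real_of_int \<lceil>x / h\<rceil> - 1"
        using pos by (simp add: j_def)
      have "real j < x / h" "x / h \<le> real j + 1" unfolding j by linarith+
      then have "x \<in> cell j" using h(1) by (simp add: cell_def field_simps)
      moreover have "x / h \<le> real n" using that h by (simp add: field_simps)
      then have "real j < real n" using \<open>real j < x / h\<close> by linarith
      then have "j < n" by simp
      ultimately show ?thesis by blast
    qed
    \<comment> \<open>The error splits into the freezing error on (0, N] and the discarded tail; the
      latter is written as multiplication by m2 so that the multiplier bound applies.\<close>
    define d1 where "d1 x = (if x \<le> N then complex_of_real (m x) * q x - s x else 0)" for x
    define m2 where "m2 x = (if x \<le> N then 0 else m x)" for x
    have [measurable]: "m \<in> borel_measurable half_line" "q \<in> borel_measurable half_line" "s \<in> borel_measurable half_line"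
      "(\<lambda>x. x) \<in> borel_measurable half_line"
      using m q s measurable_ident_half_line by (auto simp: bounded_multiplier_def square_integrable_def)
    have m2: "bounded_multiplier (\<epsilon> / (2 * C)) m2"
      unfolding bounded_multiplier_def
    proof (intro conjI allI impI)
      show "m2 \<in> borel_measurable half_line" unfolding m2_def[abs_def] by measurable
    qed (use N(2) \<epsilon> C in \<open>auto simp: m2_def\<close>)
    have d1: "square_integrable d1" "norm (abs_l2 d1) \<le> (M * (\<eta> * norm g)) * sqrt (N - 0)"
    proof -
      have meas: "d1 \<in> borel_measurable half_line" unfolding d1_def[abs_def] by measurable
      have le: "cmod (d1 x) \<le> M * (\<eta> * norm g)" if "x > 0" for x
      proof (cases "x \<le> N")
        case True
        obtain j where j: "j < n" "x \<in> cell j" using in_cell[OF \<open>x > 0\<close> True] by blast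
        have jh: "0 \<le> real j * h" "real j * h < x" "x \<le> real j * h + h"
          using j h by (auto simp: cell_def algebra_simps)
        have "d1 x = complex_of_real (m x) * pair (E x - E (real j * h)) g"
          using True by (simp add: d1_def s_val[OF j] q_def kernel_fun_def E_def pair_diff_left right_diff_distrib)
        then have "cmod (d1 x) = \<bar>m x\<bar> * cmod (pair (E x - E (real j * h)) g)"
          by (simp add: norm_mult)
        also have "\<dots> \<le> M * (\<eta> * norm g)"
        proof (rule mult_mono)
          show "\<bar>m x\<bar> \<le> M" using m that by (simp add: bounded_multiplier_def)
          have "dist (E x) (E (real j * h)) < \<eta>"
            using jh h True that by (intro \<delta>(2)) (auto simp: dist_real_def)
          then have "norm (E x - E (real j * h)) * norm g \<le> \<eta> * norm g"
            by (intro mult_right_mono) (auto simp: dist_norm)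
          then show "cmod (pair (E x - E (real j * h)) g) \<le> \<eta> * norm g"
            using Cauchy_Schwarz_l2 order_trans by blast
        qed (use M0 in auto)
        finally show ?thesis .
      next
        case False
        then show ?thesis using M0 \<eta> by (simp add: d1_def)
      qed
      have "M * (\<eta> * norm g) \<ge> 0" using M0 \<eta> by simp
      moreover have "d1 x = 0" if "x > 0" "x \<notin> {0..N}" for x
        using that by (auto simp: d1_def)
      ultimately show "square_integrable d1" "norm (abs_l2 d1) \<le> (M * (\<eta> * norm g)) * sqrt (N - 0)"
        using norm_l2_bounded_support[OF meas le, of 0 N] N(1) by auto
    qed
    have "mult_by m (anticausal_inv \<kappa> g) - F g = abs_l2 d1 + mult_by m2 (anticausal_inv \<kappa> g)"
    proof (rule l2_eqI)
      show "AE x in half_line. rep_l2 (mult_by m (anticausal_inv \<kappa> g) - F g) x = rep_l2 (abs_l2 d1 + mult_by m2 (anticausal_inv \<kappa> g)) x"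
        using AE_rep_l2_diff[of "mult_by m (anticausal_inv \<kappa> g)" "F g"] AE_rep_mult_by[OF m, of "anticausal_inv \<kappa> g"]
          AE_rep_abs_l2[OF conjunct1[OF s], unfolded conjunct2[OF s]] AE_rep_l2_add[of "abs_l2 d1" "mult_by m2 (anticausal_inv \<kappa> g)"]
          AE_rep_mult_by[OF m2, of "anticausal_inv \<kappa> g"] AE_rep_abs_l2[OF d1(1)] AE_rep_abs_l2[OF q(1), unfolded q(2)]
      proof eventually_elim
        case (elim x)
        then show ?case using s_out[of x] by (simp add: d1_def m2_def)
      qed
    qed
    then have "norm (mult_by m (anticausal_inv \<kappa> g) - F g) \<le> norm (abs_l2 d1) + norm (mult_by m2 (anticausal_inv \<kappa> g))"
      by (simp add: norm_triangle_ineq)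
    also have "norm (mult_by m2 (anticausal_inv \<kappa> g)) \<le> \<epsilon> / (2 * C) * (C * norm g)"
      by (rule order_trans[OF norm_mult_by[OF m2]], rule mult_left_mono[OF norm_anticausal_inv[OF \<kappa>, of g, folded C_def]])
        (use \<epsilon> C in simp)
    also have "\<dots> = \<epsilon> / 2 * norm g" using C by simp
    also have "norm (abs_l2 d1) \<le> \<epsilon> / 2 * norm g"
    proof -
      have "M * \<eta> * sqrt N = M / (M + 1) * (\<epsilon> / 2)"
        using N(1) by (simp add: \<eta>_def)
      also have "\<dots> \<le> 1 * (\<epsilon> / 2)"
        using M0 \<epsilon> by (intro mult_right_mono) auto
      finally have "M * \<eta> * sqrt N \<le> \<epsilon> / 2" by simp
      then have "M * \<eta> * sqrt N * norm g \<le> \<epsilon> / 2 * norm g" by (rule mult_right_mono) simp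
      then show ?thesis using d1(2) by (simp add: mult_ac)
    qed
    finally show ?thesis by (simp add: field_simps)
  qed
  ultimately show thesis using that by blast
qed

text \<open>Solving y + E y = z means finding a fixed point of y \<mapsto> z - E y, a contraction
  with factor 1/2 on a complete space. The lower bound makes the inverse bounded by 2.\<close>

lemma Neumann_bij:
  fixes E :: "l2 \<Rightarrow> l2"
  assumes E: "bounded_clinear E" and half: "\<And>y. norm (E y) \<le> 1/2 * norm y"
  shows "bij (\<lambda>y. y + E y)" "norm y \<le> 2 * norm (y + E y)"
proof -
  have diff: "E (x - y) = E x - E y" for x y
  proof -
    have "E (x - y + y) = E (x - y) + E y" using E unfolding bounded_clinear_def by blast
    then show ?thesis by simp
  qed
  have "\<exists>!y. z - E y = y" for z
  proof (rule banach_fix_type)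
    show "\<forall>x y. dist (z - E x) (z - E y) \<le> 1/2 * dist x y"
    proof (intro allI)
      fix x y
      have "(z - E x) - (z - E y) = - E (x - y)" by (simp add: diff)
      then show "dist (z - E x) (z - E y) \<le> 1/2 * dist x y"
        using half[of "x - y"] by (simp only: dist_norm norm_minus_cancel)
    qed
  qed auto
  moreover have "z - E y = y \<longleftrightarrow> y + E y = z" for z y by (auto simp: diff_eq_eq)
  ultimately have "\<exists>!y. y + E y = z" for z by simp
  then show "bij (\<lambda>y. y + E y)" by (simp add: bij_iff)
  have "norm y \<le> norm (y + E y) + norm (E y)"
    using norm_triangle_ineq4[of "y + E y" "E y"] by simp
  then show "norm y \<le> 2 * norm (y + E y)" using half[of y] by simp
qed

section \<open>The constant-coefficient problem\<close>

lemma weak_deriv_2: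
  assumes "is_weak_deriv 1 u u1" "is_weak_deriv 1 u1 u2"
  shows "weak_deriv 2 u = u2"
  using weak_deriv_Suc[OF assms(1), of 1] weak_deriv_eqI[OF assms(2)] by (simp add: numeral_2_eq_2)

lemma helm_eq:
  assumes "is_weak_deriv 1 u u1" "is_weak_deriv 1 u1 u2"
  shows "helm a u = complex_of_real (a\<^sup>2) *\<^sub>C u - u2"
  unfolding helm_def weak_deriv_2[OF assms] by simp

lemma sobolev_2: "u \<in> sobolev 2 \<longleftrightarrow> (\<exists>u1 u2. is_weak_deriv 1 u u1 \<and> is_weak_deriv 1 u1 u2)"
  unfolding numeral_2_eq_2 sobolev_Suc sobolev_0 by blast

lemma sobolev_4: "u \<in> sobolev 4 \<longleftrightarrow> (\<exists>u1 u2 u3 u4. is_weak_deriv 1 u u1 \<and> is_weak_deriv 1 u1 u2 \<and>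
    is_weak_deriv 1 u2 u3 \<and> is_weak_deriv 1 u3 u4)"
proof -
  have 4: "4 = Suc (Suc (Suc (Suc 0)))" by simp
  show ?thesis unfolding 4 sobolev_Suc sobolev_0 by blast
qed

section \<open>The domain as chains of first-order derivatives with two zero traces\<close>

lemma OS_domI:
  assumes "is_weak_deriv 1 u u1" "is_weak_deriv 1 u1 u2" "is_weak_deriv 1 u2 u3" "is_weak_deriv 1 u3 u4"
    and "zero_trace u" "zero_trace u1"
  shows "u \<in> OS_dom"
proof -
  have "zero_trace (weak_deriv j u)" if "j < 2" for j
    using less_2_cases[OF that] assms(5,6) weak_deriv_eqI[OF assms(1)] weak_deriv_0[of u] by auto
  moreover have "u \<in> sobolev 4" "u \<in> sobolev 2"
    unfolding sobolev_4 sobolev_2 using assms(1-4) by blast+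
  ultimately show ?thesis
    unfolding OS_dom_def sobolev0_def by blast
qed

lemma OS_domE:
  assumes "u \<in> OS_dom"
  obtains u1 u2 u3 u4 where "is_weak_deriv 1 u u1" "is_weak_deriv 1 u1 u2" "is_weak_deriv 1 u2 u3"
    "is_weak_deriv 1 u3 u4" "zero_trace u" "zero_trace u1"
proof -
  obtain u1 u2 u3 u4 where u: "is_weak_deriv 1 u u1" "is_weak_deriv 1 u1 u2" "is_weak_deriv 1 u2 u3"
    "is_weak_deriv 1 u3 u4"
    using assms sobolev_4[of u] unfolding OS_dom_def by blast
  have "zero_trace (weak_deriv 0 u)" "zero_trace (weak_deriv 1 u)"
    using assms unfolding OS_dom_def sobolev0_def by auto
  then have "zero_trace u" "zero_trace u1"
    unfolding weak_deriv_0 weak_deriv_eqI[OF u(1)] .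
  then show thesis using that u by blast
qed

lemma OS_dom_subspace: "complex_vector.subspace OS_dom"
proof (rule complex_vector.subspaceI)
  \<comment> \<open>Obtained as the zero multiple of a function already known to have a weak
    derivative.\<close>
  have w: "is_weak_deriv 1 0 0"
    using is_weak_deriv_scaleC[OF weak_deriv_causal_inv[of 1 0], of 0] by simp
  moreover have "zero_trace 0"
    using zero_trace_scaleC[OF zero_trace_causal_inv[of 1 0], of 0] by simp
  ultimately show "0 \<in> OS_dom" by (intro OS_domI[of 0 0 0 0 0])
next
  fix u v assume "u \<in> OS_dom" "v \<in> OS_dom"
  obtain u1 u2 u3 u4 where "is_weak_deriv 1 u u1" "is_weak_deriv 1 u1 u2" "is_weak_deriv 1 u2 u3"
    "is_weak_deriv 1 u3 u4" "zero_trace u" "zero_trace u1"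
    using \<open>u \<in> OS_dom\<close> by (rule OS_domE)
  moreover obtain v1 v2 v3 v4 where "is_weak_deriv 1 v v1" "is_weak_deriv 1 v1 v2" "is_weak_deriv 1 v2 v3"
    "is_weak_deriv 1 v3 v4" "zero_trace v" "zero_trace v1"
    using \<open>v \<in> OS_dom\<close> by (rule OS_domE)
  ultimately show "u + v \<in> OS_dom"
    by (intro OS_domI[of _ "u1 + v1" "u2 + v2" "u3 + v3" "u4 + v4"] is_weak_deriv_add zero_trace_add)
next
  fix c u assume "u \<in> OS_dom"
  obtain u1 u2 u3 u4 where "is_weak_deriv 1 u u1" "is_weak_deriv 1 u1 u2" "is_weak_deriv 1 u2 u3"
    "is_weak_deriv 1 u3 u4" "zero_trace u" "zero_trace u1"
    using \<open>u \<in> OS_dom\<close> by (rule OS_domE)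
  then show "c *\<^sub>C u \<in> OS_dom"
    by (intro OS_domI[of _ "c *\<^sub>C u1" "c *\<^sub>C u2" "c *\<^sub>C u3" "c *\<^sub>C u4"] is_weak_deriv_scaleC zero_trace_scaleC)
qed

lemma OS_dom_sobolev_2: "u \<in> OS_dom \<Longrightarrow> u \<in> sobolev 2"
  unfolding OS_dom_def sobolev0_def by blast

lemma OS_dom_subset_X: "OS_dom \<subseteq> OS_X"
proof
  fix u assume u: "u \<in> OS_dom"
  have "zero_trace u"
    using u by (rule OS_domE) 
  moreover have "u \<in> sobolev 1"
    using OS_dom_sobolev_2[OF u] unfolding sobolev_def by auto
  ultimately show "u \<in> OS_X"
    using OS_dom_sobolev_2[OF u] unfolding OS_X_def sobolev0_def by (auto simp: weak_deriv_0)
qed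

lemma helm_linear:
  assumes "u \<in> sobolev 2" "v \<in> sobolev 2"
  shows "helm a (u + v) = helm a u + helm a v" "helm a (c *\<^sub>C u) = c *\<^sub>C helm a u"
    "helm a (u - v) = helm a u - helm a v" "c *\<^sub>C u \<in> sobolev 2" "u + v \<in> sobolev 2" "u - v \<in> sobolev 2"
proof -
  obtain u1 u2 where u: "is_weak_deriv 1 u u1" "is_weak_deriv 1 u1 u2" using assms(1) unfolding sobolev_2 by blast
  obtain v1 v2 where v: "is_weak_deriv 1 v v1" "is_weak_deriv 1 v1 v2" using assms(2) unfolding sobolev_2 by blast
  note add = is_weak_deriv_add[OF u(1) v(1)] is_weak_deriv_add[OF u(2) v(2)]
  note sub = is_weak_deriv_diff[OF u(1) v(1)] is_weak_deriv_diff[OF u(2) v(2)]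
  note scale = is_weak_deriv_scaleC[OF u(1), of c] is_weak_deriv_scaleC[OF u(2), of c]
  show "helm a (u + v) = helm a u + helm a v"
    unfolding helm_eq[OF u] helm_eq[OF v] helm_eq[OF add] by (simp add: scaleC_add_right)
  show "helm a (u - v) = helm a u - helm a v"
    unfolding helm_eq[OF u] helm_eq[OF v] helm_eq[OF sub] by (simp add: complex_vector.scale_right_diff_distrib)
  show "helm a (c *\<^sub>C u) = c *\<^sub>C helm a u"
    unfolding helm_eq[OF u] helm_eq[OF scale]
    by (simp add: complex_vector.scale_right_diff_distrib scaleC_scaleC mult.commute)
  show "c *\<^sub>C u \<in> sobolev 2" "u + v \<in> sobolev 2" "u - v \<in> sobolev 2"
    using add sub scale unfolding sobolev_2 by blast+
qed

lemma helm_OS_dom_sobolev: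
  assumes "u \<in> OS_dom"
  shows "helm a u \<in> sobolev 2"
proof -
  obtain u1 u2 u3 u4 where u: "is_weak_deriv 1 u u1" "is_weak_deriv 1 u1 u2" "is_weak_deriv 1 u2 u3"
    "is_weak_deriv 1 u3 u4"
    using assms by (rule OS_domE)
  show ?thesis
    unfolding helm_eq[OF u(1,2)] sobolev_2
    using is_weak_deriv_diff[OF is_weak_deriv_scaleC[OF u(1)] u(3)]
      is_weak_deriv_diff[OF is_weak_deriv_scaleC[OF u(2)] u(4)] by blast
qed

section \<open>Algebra of bounded complex-linear maps\<close>

lemma bounded_clinear_ident: "bounded_clinear (\<lambda>u. u)"
  unfolding bounded_clinear_def by (auto intro: exI[of _ 1])

lemma bounded_clinear_add:
  assumes "bounded_clinear f" "bounded_clinear g"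
  shows "bounded_clinear (\<lambda>u. f u + g u)"
proof -
  obtain K where K: "\<And>u. norm (f u) \<le> K * norm u" using bounded_clinear_bound[OF assms(1)] by blast
  obtain L where L: "\<And>u. norm (g u) \<le> L * norm u" using bounded_clinear_bound[OF assms(2)] by blast
  have "norm (f u + g u) \<le> (K + L) * norm u" for u
    using norm_triangle_ineq[of "f u" "g u"] K[of u] L[of u] by (simp add: distrib_right)
  then show ?thesis using assms unfolding bounded_clinear_def by (auto simp: scaleC_add_right)
qed

lemma bounded_clinear_scaleC:
  assumes "bounded_clinear f"
  shows "bounded_clinear (\<lambda>u. c *\<^sub>C f u)"
proof -
  obtain K where K: "\<And>u. norm (f u) \<le> K * norm u" using bounded_clinear_bound[OF assms(1)] by blast
  have "norm (c *\<^sub>C f u) \<le> (cmod c * K) * norm u" for u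
    using mult_left_mono[OF K[of u], of "cmod c"] by (simp add: norm_scaleC mult.assoc)
  moreover have "\<forall>u v. c *\<^sub>C f (u + v) = c *\<^sub>C f u + c *\<^sub>C f v" "\<forall>d u. c *\<^sub>C f (d *\<^sub>C u) = d *\<^sub>C c *\<^sub>C f u"
    using assms unfolding bounded_clinear_def by (auto simp: scaleC_add_right scaleC_scaleC mult.commute)
  ultimately show ?thesis unfolding bounded_clinear_def by blast
qed

lemma bounded_clinear_diff:
  assumes "bounded_clinear f" "bounded_clinear g"
  shows "bounded_clinear (\<lambda>u. f u - g u)"
proof -
  have "f u - g u = f u + (-1) *\<^sub>C g u" for u by (metis diff_conv_add_uminus uminus_scaleC)
  then show ?thesis using bounded_clinear_add[OF assms(1) bounded_clinear_scaleC[OF assms(2), of "-1"]] by simp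
qed

lemma bounded_clinear_tendsto:
  assumes f: "bounded_clinear f" and u: "u \<longlonglongrightarrow> l"
  shows "(\<lambda>n. f (u n)) \<longlonglongrightarrow> f l"
proof -
  obtain K where K: "\<And>u. norm (f u) \<le> K * norm u" using bounded_clinear_bound[OF f] by blast
  have "f (x - y + y) = f (x - y) + f y" for x y using f unfolding bounded_clinear_def by blast
  from this[symmetric] have diff: "f (x - y) = f x - f y" for x y by (simp add: eq_diff_eq)
  have "(\<lambda>n. K * norm (u n - l)) \<longlonglongrightarrow> K * 0"
    by (intro tendsto_mult tendsto_const tendsto_norm_zero LIM_zero u)
  then have lim: "(\<lambda>n. K * norm (u n - l)) \<longlonglongrightarrow> 0" by simp
  have "norm (f (u n) - f l) \<le> K * norm (u n - l)" for n
    unfolding diff[symmetric] by (rule K)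
  then have "(\<lambda>n. f (u n) - f l) \<longlonglongrightarrow> 0"
    by (intro Lim_null_comparison[OF always_eventually lim] allI)
  then show ?thesis by (rule LIM_zero_cancel)
qed

text \<open>This is A - \<lambda> B for V = 1, with the coefficient iaR - \<lambda> written as
  \<nu>^2 - a^2; as a differential expression it equals (a^2 - D^2)(\<nu>^2 - D^2).\<close>

definition OS_const :: "real \<Rightarrow> complex \<Rightarrow> l2 \<Rightarrow> l2"
  where "OS_const a \<nu> u = helm a (helm a u) + (\<nu>\<^sup>2 - complex_of_real (a\<^sup>2)) *\<^sub>C helm a u"

lemma OS_const_linear:
  assumes "u \<in> OS_dom" "v \<in> OS_dom"
  shows "OS_const a \<nu> (u + v) = OS_const a \<nu> u + OS_const a \<nu> v" "OS_const a \<nu> (c *\<^sub>C u) = c *\<^sub>C OS_const a \<nu> u"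
proof -
  note u = OS_dom_sobolev_2[OF assms(1)] and v = OS_dom_sobolev_2[OF assms(2)]
  note hu = helm_OS_dom_sobolev[OF assms(1), of a] and hv = helm_OS_dom_sobolev[OF assms(2), of a]
  show "OS_const a \<nu> (u + v) = OS_const a \<nu> u + OS_const a \<nu> v"
    unfolding OS_const_def helm_linear(1)[OF u v] helm_linear(1)[OF hu hv] by (simp add: scaleC_add_right)
  show "OS_const a \<nu> (c *\<^sub>C u) = c *\<^sub>C OS_const a \<nu> u"
    unfolding OS_const_def helm_linear(2)[OF u v] helm_linear(2)[OF hu hv]
    by (simp add: scaleC_add_right scaleC_scaleC mult.commute)
qed

text \<open>Since \<open>(-D\<^sup>2 + a\<^sup>2)\<^sup>2 + (\<nu>\<^sup>2 - a\<^sup>2) (-D\<^sup>2 + a\<^sup>2) = (\<nu> - D) (a - D) (\<nu> + D) (a + D)\<close>, with the boundary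
  conditions absorbed by the last two factors, the inverse is a product of four first-order inverses.\<close>

definition OS_inv :: "real \<Rightarrow> complex \<Rightarrow> l2 \<Rightarrow> l2"
  where "OS_inv a \<nu> f = causal_inv (complex_of_real a) (causal_inv \<nu> (anticausal_inv (complex_of_real a) (anticausal_inv \<nu> f)))"

context
  fixes a :: real and \<nu> :: complex
  assumes a: "a > 0" and \<nu>: "Re \<nu> > 0"
begin

lemma Re_a_pos: "Re (complex_of_real a) > 0" using a by simp

lemma bounded_clinear_OS_inv: "bounded_clinear (OS_inv a \<nu>)"
  unfolding OS_inv_def[abs_def]
  by (rule bounded_clinear_compose[OF bounded_clinear_causal_inv[OF Re_a_pos] bounded_clinear_compose[OF bounded_clinear_causal_inv[OF \<nu>]
      bounded_clinear_compose[OF bounded_clinear_anticausal_inv[OF Re_a_pos] bounded_clinear_anticausal_inv[OF \<nu>]]]])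

text \<open>The factors are undone one at a time, with p = (a + D) u, q = (\<nu> + D) p and r = (a -
  D) q. The outer causal inverse uses the zero trace of u; the inner one uses that of p, for which
  u(0) and u'(0) both have to vanish.\<close>

lemma OS_inv_OS_const:
  assumes "u \<in> OS_dom"
  shows "OS_inv a \<nu> (OS_const a \<nu> u) = u"
proof -
  obtain u1 u2 u3 u4 where u: "is_weak_deriv 1 u u1" "is_weak_deriv 1 u1 u2" "is_weak_deriv 1 u2 u3"
    "is_weak_deriv 1 u3 u4" "zero_trace u" "zero_trace u1"
    using assms by (rule OS_domE)
  let ?a = "complex_of_real a"
  define p where "p = u1 + ?a *\<^sub>C u"
  define p1 where "p1 = u2 + ?a *\<^sub>C u1"
  define q where "q = p1 + \<nu> *\<^sub>C p"
  define q1 where "q1 = (u3 + ?a *\<^sub>C u2) + \<nu> *\<^sub>C p1"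
  define q2 where "q2 = (u4 + ?a *\<^sub>C u3) + \<nu> *\<^sub>C (u3 + ?a *\<^sub>C u2)"
  define r where "r = ?a *\<^sub>C q - q1"
  define r1 where "r1 = ?a *\<^sub>C q1 - q2"
  have W: "is_weak_deriv 1 p p1" "is_weak_deriv 1 q q1" "is_weak_deriv 1 r r1"
    unfolding p_def p1_def q_def q1_def q2_def r_def r1_def
    by (intro is_weak_deriv_add is_weak_deriv_scaleC is_weak_deriv_diff u)+
  have "zero_trace p" unfolding p_def by (intro zero_trace_add zero_trace_scaleC u)
  have "causal_inv ?a p = u" unfolding p_def by (rule causal_inv_weak_deriv[OF Re_a_pos u(1,5)])
  moreover have "causal_inv \<nu> q = p" unfolding q_def by (rule causal_inv_weak_deriv[OF \<nu> W(1) \<open>zero_trace p\<close>])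
  moreover have "anticausal_inv ?a r = q" unfolding r_def by (rule anticausal_inv_weak_deriv[OF Re_a_pos W(2)])
  moreover have "anticausal_inv \<nu> (\<nu> *\<^sub>C r - r1) = r" by (rule anticausal_inv_weak_deriv[OF \<nu> W(3)])
  moreover have "OS_const a \<nu> u = \<nu> *\<^sub>C r - r1"
  proof -
    have h1: "is_weak_deriv 1 (helm a u) (complex_of_real (a\<^sup>2) *\<^sub>C u1 - u3)"
      "is_weak_deriv 1 (complex_of_real (a\<^sup>2) *\<^sub>C u1 - u3) (complex_of_real (a\<^sup>2) *\<^sub>C u2 - u4)"
      unfolding helm_eq[OF u(1,2)] by (intro is_weak_deriv_diff is_weak_deriv_scaleC u)+
    show ?thesis
      unfolding OS_const_def helm_eq[OF h1] unfolding helm_eq[OF u(1,2)]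
      unfolding r1_def r_def q2_def q1_def q_def p1_def p_def
    \<comment> \<open>Pairing with a test function turns an identity between linear combinations in
      \<open>l2\<close> into a polynomial identity between complex numbers.\<close>
    proof (rule l2_eq_if_pair_emb_eq, goal_cases)
      case (1 \<phi>)
      show ?case
        by (simp add: pair_add_left pair_diff_left pair_scaleC_left power2_eq_square algebra_simps)
    qed
  qed
  ultimately show ?thesis by (simp add: OS_inv_def)
qed

text \<open>Each intermediate function has its derivative expressed by the next one, so four
  derivatives and both traces can be read off. The last two claims write \<open>helm a u\<close> =
  (a - D) p and its derivative through p, q and r, all of which depend boundedly on f.\<close>

lemma OS_inv_derivatives:
  fixes f :: l2
  defines "r \<equiv> anticausal_inv \<nu> f" 
  defines "q \<equiv> anticausal_inv (complex_of_real a) r"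
  defines "p \<equiv> causal_inv \<nu> q"
  defines "u \<equiv> OS_inv a \<nu> f"
  defines "u1 \<equiv> p - complex_of_real a *\<^sub>C u"
  shows "u \<in> OS_dom" "is_weak_deriv 1 u u1"
    "helm a u = (complex_of_real a + \<nu>) *\<^sub>C p - q"
    "is_weak_deriv 1 (helm a u) ((complex_of_real a + \<nu>) *\<^sub>C (q - \<nu> *\<^sub>C p) - (complex_of_real a *\<^sub>C q - r))"
proof -
  let ?a = "complex_of_real a"
  have W: "is_weak_deriv 1 u u1" "is_weak_deriv 1 p (q - \<nu> *\<^sub>C p)" "is_weak_deriv 1 q (?a *\<^sub>C q - r)"
    "is_weak_deriv 1 r (\<nu> *\<^sub>C r - f)"
    unfolding u_def u1_def OS_inv_def p_def q_def r_def
    by (rule weak_deriv_causal_inv[OF Re_a_pos] weak_deriv_causal_inv[OF \<nu>] weak_deriv_anticausal_inv[OF Re_a_pos] weak_deriv_anticausal_inv[OF \<nu>])+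
  show "is_weak_deriv 1 u u1" by (rule W)
  define u2 where "u2 = (q - \<nu> *\<^sub>C p) - ?a *\<^sub>C u1"
  define u3 where "u3 = ((?a *\<^sub>C q - r) - \<nu> *\<^sub>C (q - \<nu> *\<^sub>C p)) - ?a *\<^sub>C u2"
  have W2: "is_weak_deriv 1 u1 u2"
    unfolding u1_def u2_def by (intro is_weak_deriv_diff is_weak_deriv_scaleC W[unfolded u1_def])
  have W3: "is_weak_deriv 1 u2 u3"
    unfolding u2_def u3_def using W2[unfolded u2_def] by (intro is_weak_deriv_diff is_weak_deriv_scaleC W)
  have W4: "is_weak_deriv 1 u3 (((?a *\<^sub>C (?a *\<^sub>C q - r) - (\<nu> *\<^sub>C r - f)) - \<nu> *\<^sub>C ((?a *\<^sub>C q - r) - \<nu> *\<^sub>C (q - \<nu> *\<^sub>C p))) - ?a *\<^sub>C u3)"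
    using W3 by (subst u3_def) (intro is_weak_deriv_diff is_weak_deriv_scaleC W)
  have z: "zero_trace u" unfolding u_def OS_inv_def by (rule zero_trace_causal_inv[OF Re_a_pos])
  have "zero_trace u1"
    unfolding u1_def using zero_trace_causal_inv[OF \<nu>] by (intro zero_trace_diff zero_trace_scaleC z) (simp add: p_def)
  then show "u \<in> OS_dom" by (rule OS_domI[OF W(1) W2 W3 W4 z])
  show h: "helm a u = (?a + \<nu>) *\<^sub>C p - q"
    unfolding helm_eq[OF W(1) W2] u2_def u1_def
  proof (rule l2_eq_if_pair_emb_eq, goal_cases)
    case (1 \<phi>)
    show ?case
      by (simp add: pair_add_left pair_diff_left pair_scaleC_left power2_eq_square algebra_simps)
  qed
  show "is_weak_deriv 1 (helm a u) ((?a + \<nu>) *\<^sub>C (q - \<nu> *\<^sub>C p) - (?a *\<^sub>C q - r))"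
    unfolding h by (intro is_weak_deriv_diff is_weak_deriv_scaleC W)
qed

text \<open>If a first-order inverse maps g to 0, then the weak derivative of the image is both 0
  and, up to sign, g.\<close>

lemma OS_inv_inj:
  assumes "OS_inv a \<nu> f = 0"
  shows "f = 0"
proof -
  have P0: "g = 0" if "causal_inv \<kappa> g = 0" "Re \<kappa> > 0" for \<kappa> g
    using weak_deriv_causal_inv[OF that(2), of g] that(1) weak_deriv_unique is_weak_deriv_scaleC[OF weak_deriv_causal_inv[OF that(2), of g], of 0]
    by (metis complex_vector.scale_zero_left complex_vector.scale_zero_right diff_zero)
  have Q0: "g = 0" if "anticausal_inv \<kappa> g = 0" "Re \<kappa> > 0" for \<kappa> g
    using weak_deriv_anticausal_inv[OF that(2), of g] that(1) weak_deriv_unique is_weak_deriv_scaleC[OF weak_deriv_anticausal_inv[OF that(2), of g], of 0]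
    by (metis complex_vector.scale_zero_left complex_vector.scale_zero_right diff_zero diff_0 neg_equal_0_iff_equal)
  show ?thesis using assms P0 Q0 Re_a_pos \<nu> unfolding OS_inv_def by blast
qed

text \<open>\<open>OS_inv\<close> maps into the domain, is a left inverse there and is injective,
  hence is also a right inverse; the four-fold inverse does not have to be differentiated through to
  fourth order.\<close>

lemma OS_const_OS_inv: "OS_const a \<nu> (OS_inv a \<nu> f) = f"
proof -
  let ?g = "OS_const a \<nu> (OS_inv a \<nu> f)"
  have "OS_inv a \<nu> ?g = OS_inv a \<nu> f" by (rule OS_inv_OS_const[OF OS_inv_derivatives(1)])
  moreover have "OS_inv a \<nu> (?g - f + f) = OS_inv a \<nu> (?g - f) + OS_inv a \<nu> f"
    using bounded_clinear_OS_inv unfolding bounded_clinear_def by blast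
  ultimately have "OS_inv a \<nu> (?g - f) = 0" by simp
  then have "?g - f = 0" by (rule OS_inv_inj)
  then show ?thesis by simp
qed

lemma OS_const_bij: "bij_betw (OS_const a \<nu>) OS_dom UNIV"
  by (rule bij_betwI[where g = "OS_inv a \<nu>"])
    (auto simp: OS_inv_OS_const OS_const_OS_inv OS_inv_derivatives(1))

end

section \<open>Outside the ray\<close>

lemma bounded_multiplier_continuous:
  assumes m: "continuous_on {0..} m" and lim: "(m \<longlongrightarrow> l) at_top"
  obtains M where "bounded_multiplier M m"
proof -
  have "\<forall>\<^sub>F x in at_top. dist (m x) l < 1"
    using tendstoD[OF lim, of 1] by simp
  then obtain N where N: "\<And>x. x \<ge> N \<Longrightarrow> \<bar>m x - l\<bar> < 1"
    unfolding eventually_at_top_linorder by (auto simp: dist_real_def)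
  have "bounded (m ` {0..N})"
    by (intro compact_imp_bounded compact_continuous_image continuous_on_subset[OF m]) auto
  then obtain B where B: "\<forall>x\<in>{0..N}. \<bar>m x\<bar> \<le> B" "B > 0"
    unfolding bounded_pos by auto
  have "\<bar>m x\<bar> \<le> B + \<bar>l\<bar> + 1" if "x > 0" for x
  proof (cases "x \<le> N")
    case True
    then have "\<bar>m x\<bar> \<le> B" using B(1) that by auto
    then show ?thesis by simp
  next
    case False
    then show ?thesis using N[of x] B(2) by simp
  qed
  moreover have "m \<in> borel_measurable half_line"
    by (rule borel_measurable_half_line_continuous[OF continuous_on_subset[OF m]]) auto
  ultimately have "bounded_multiplier (B + \<bar>l\<bar> + 1) m"
    using B(2) by (simp add: bounded_multiplier_def)
  then show thesis using that by blast
qed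

definition OS_pert :: "real \<Rightarrow> real \<Rightarrow> (real \<Rightarrow> real) \<Rightarrow> (real \<Rightarrow> real) \<Rightarrow> l2 \<Rightarrow> l2"
  where "OS_pert a R V V2 u = (\<i> * complex_of_real a * complex_of_real R) *\<^sub>C
    (mult_by (\<lambda>x. V x - 1) (helm a u) + mult_by V2 u)"

lemma mult_by_diff_one:
  assumes V: "bounded_multiplier M V" and V': "bounded_multiplier M' (\<lambda>x. V x - 1)"
  shows "mult_by V w = mult_by (\<lambda>x. V x - 1) w + w"
proof (rule l2_eqI)
  show "AE x in half_line. rep_l2 (mult_by V w) x = rep_l2 (mult_by (\<lambda>x. V x - 1) w + w) x"
    using AE_rep_mult_by[OF V, of w] AE_rep_mult_by[OF V', of w] AE_rep_l2_add[of "mult_by (\<lambda>x. V x - 1) w" w]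
    by eventually_elim (simp add: algebra_simps)
qed

text \<open>V is split as (V - 1) + 1: the constant part joins the constant-coefficient operator,
  where the spectral parameter enters only through \<nu>^2, and what remains involves only the
  multipliers V - 1 and V2.\<close>

lemma OS_decomposition:
  assumes "bounded_multiplier M V" "bounded_multiplier M' (\<lambda>x. V x - 1)"
    and \<nu>: "\<nu>\<^sup>2 = complex_of_real (a\<^sup>2) + \<i> * complex_of_real a * complex_of_real R - z"
  shows "OS_A a R V V2 u - z *\<^sub>C OS_B a u = OS_const a \<nu> u + OS_pert a R V V2 u"
proof -
  have "(\<nu>\<^sup>2 - complex_of_real (a\<^sup>2)) *\<^sub>C helm a u
      = (\<i> * complex_of_real a * complex_of_real R) *\<^sub>C helm a u - z *\<^sub>C helm a u"
    unfolding \<nu> by (simp flip: complex_vector.scale_left_diff_distrib)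
  then show ?thesis
    unfolding OS_A_def OS_B_def OS_const_def OS_pert_def mult_by_diff_one[OF assms(1,2)]
    by (simp add: scaleC_add_right algebra_simps)
qed

context
  fixes a R M1 M2 :: real and V V2 :: "real \<Rightarrow> real" and \<nu> :: complex
  assumes a: "a > 0" and \<nu>: "Re \<nu> > 0"
    and m1: "bounded_multiplier M1 (\<lambda>x. V x - 1)" and m2: "bounded_multiplier M2 V2"
    and lim1: "((\<lambda>x. V x - 1) \<longlongrightarrow> 0) at_top" and lim2: "(V2 \<longlongrightarrow> 0) at_top"
begin

lemma OS_pert_add:
  assumes "u \<in> sobolev 2" "v \<in> sobolev 2"
  shows "OS_pert a R V V2 (u + v) = OS_pert a R V V2 u + OS_pert a R V V2 v"
    "OS_pert a R V V2 (c *\<^sub>C u) = c *\<^sub>C OS_pert a R V V2 u"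
proof -
  have add: "mult_by (\<lambda>x. V x - 1) (u + v) = mult_by (\<lambda>x. V x - 1) u + mult_by (\<lambda>x. V x - 1) v"
      "mult_by V2 (u + v) = mult_by V2 u + mult_by V2 v"
      "mult_by (\<lambda>x. V x - 1) (c *\<^sub>C u) = c *\<^sub>C mult_by (\<lambda>x. V x - 1) u" "mult_by V2 (c *\<^sub>C u) = c *\<^sub>C mult_by V2 u" for u v c
    using bounded_clinear_mult_by[OF m1] bounded_clinear_mult_by[OF m2] unfolding bounded_clinear_def by blast+
  show "OS_pert a R V V2 (u + v) = OS_pert a R V V2 u + OS_pert a R V V2 v"
    unfolding OS_pert_def helm_linear(1)[OF assms] add by (simp add: scaleC_add_right)
  show "OS_pert a R V V2 (c *\<^sub>C u) = c *\<^sub>C OS_pert a R V V2 u"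
    unfolding OS_pert_def helm_linear(2)[OF assms] add by (simp add: scaleC_add_right scaleC_scaleC mult.commute)
qed

text \<open>The inverse gains derivatives: for u = \<open>OS_inv a \<nu> f\<close>, both w = u and w
  = \<open>helm a u\<close> have a derivative w' depending boundedly on f, and w is the anticausal
  inverse of w - w'. Each multiplier is thus preceded by an anticausal kernel operator, and the
  approximation applies.\<close>

lemma OS_pert_approximation:
  obtains F where "finite_rank F" "bounded_clinear (\<lambda>f. OS_pert a R V V2 (OS_inv a \<nu> f) - F f)"
    "\<And>f. norm (OS_pert a R V V2 (OS_inv a \<nu> f) - F f) \<le> 1/2 * norm f"
proof -
  note Re_a_pos = Re_a_pos[OF a \<nu>]
  have one: "Re 1 > 0" by simp
  let ?a = "complex_of_real a"
  define r where "r f = anticausal_inv \<nu> f" for f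
  define q where "q f = anticausal_inv ?a (r f)" for f
  define p where "p f = causal_inv \<nu> (q f)" for f
  define u where "u f = OS_inv a \<nu> f" for f
  have br: "bounded_clinear r" unfolding r_def[abs_def] by (rule bounded_clinear_anticausal_inv[OF \<nu>])
  have bq: "bounded_clinear q" unfolding q_def[abs_def] by (rule bounded_clinear_compose[OF bounded_clinear_anticausal_inv[OF Re_a_pos] br])
  have bp: "bounded_clinear p" unfolding p_def[abs_def] by (rule bounded_clinear_compose[OF bounded_clinear_causal_inv[OF \<nu>] bq])
  have bu: "bounded_clinear u" unfolding u_def[abs_def] by (rule bounded_clinear_OS_inv[OF a \<nu>])
  \<comment> \<open>L1 f and L2 f are the combinations w - w' for w = \<open>helm a u\<close> and w
    = u; the exponent 1 of the anticausal inverse is one choice among those with positive real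
    part.\<close>
  define L1 where "L1 f = ((?a + \<nu>) *\<^sub>C p f - q f)
      - ((?a + \<nu>) *\<^sub>C (q f - \<nu> *\<^sub>C p f) - (?a *\<^sub>C q f - r f))" for f
  define L2 where "L2 f = u f - (p f - ?a *\<^sub>C u f)" for f
  have bL1: "bounded_clinear L1" unfolding L1_def[abs_def]
    by (intro bounded_clinear_diff bounded_clinear_scaleC bp bq br)
  have bL2: "bounded_clinear L2" unfolding L2_def[abs_def]
    by (intro bounded_clinear_diff bounded_clinear_scaleC bp bu)
  note D = OS_inv_derivatives[OF a \<nu>]
  have Q1: "helm a (OS_inv a \<nu> f) = anticausal_inv 1 (L1 f)" for f
    using anticausal_inv_weak_deriv[OF one D(4)[of f]] unfolding D(3)
    by (simp add: L1_def p_def q_def r_def scaleC_one)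
  have Q2: "OS_inv a \<nu> f = anticausal_inv 1 (L2 f)" for f
    using anticausal_inv_weak_deriv[OF one D(2)[of f]] by (simp add: L2_def u_def p_def q_def r_def scaleC_one)
  define c where "c = \<i> * complex_of_real a * complex_of_real R"
  obtain K1 where K1: "K1 > 0" "\<And>f. norm (L1 f) \<le> K1 * norm f" using bounded_clinear_bound[OF bL1] by blast
  obtain K2 where K2: "K2 > 0" "\<And>f. norm (L2 f) \<le> K2 * norm f" using bounded_clinear_bound[OF bL2] by blast
  \<comment> \<open>Makes (|c| + 1) (K1 + K2) \<epsilon> equal to 1/2, the bound under which 1 + E
    is inverted; the summand 1 covers c = 0.\<close>
  define \<epsilon> where "\<epsilon> = 1 / (2 * (cmod c + 1) * (K1 + K2))"
  have c1: "cmod c + 1 > 0" using norm_ge_zero[of c] by linarith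
  have \<epsilon>: "\<epsilon> > 0" unfolding \<epsilon>_def using c1 K1 K2 by simp
  obtain F1 where F1: "finite_rank F1" "\<And>g. norm (mult_by (\<lambda>x. V x - 1) (anticausal_inv 1 g) - F1 g) \<le> \<epsilon> * norm g"
    using finite_rank_approximation[OF m1 lim1 one \<epsilon>] by blast
  obtain F2 where F2: "finite_rank F2" "\<And>g. norm (mult_by V2 (anticausal_inv 1 g) - F2 g) \<le> \<epsilon> * norm g"
    using finite_rank_approximation[OF m2 lim2 one \<epsilon>] by blast
  define F where "F f = c *\<^sub>C (F1 (L1 f) + F2 (L2 f))" for f
  have fF: "finite_rank F"
    unfolding F_def[abs_def]
    by (intro finite_rank_scaleC finite_rank_add finite_rank_compose[OF F1(1) bL1] finite_rank_compose[OF F2(1) bL2])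
  define K where "K f = OS_pert a R V V2 (OS_inv a \<nu> f)" for f
  have K_eq: "K f = c *\<^sub>C (mult_by (\<lambda>x. V x - 1) (anticausal_inv 1 (L1 f)) + mult_by V2 (anticausal_inv 1 (L2 f)))" for f
    unfolding K_def OS_pert_def Q1 Q2[symmetric] c_def by simp
  have bK: "bounded_clinear K"
    unfolding K_eq[abs_def]
    by (intro bounded_clinear_scaleC bounded_clinear_add
        bounded_clinear_compose[OF bounded_clinear_mult_by[OF m1] bounded_clinear_compose[OF bounded_clinear_anticausal_inv[OF one] bL1]]
        bounded_clinear_compose[OF bounded_clinear_mult_by[OF m2] bounded_clinear_compose[OF bounded_clinear_anticausal_inv[OF one] bL2]])
  have bound: "norm (K f - F f) \<le> 1/2 * norm f" for f
  proof -
    have "K f - F f = c *\<^sub>C ((mult_by (\<lambda>x. V x - 1) (anticausal_inv 1 (L1 f)) - F1 (L1 f)) + (mult_by V2 (anticausal_inv 1 (L2 f)) - F2 (L2 f)))"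
      unfolding K_eq F_def complex_vector.scale_right_diff_distrib[symmetric] by (simp add: algebra_simps)
    then have "norm (K f - F f) \<le> cmod c *
        (norm (mult_by (\<lambda>x. V x - 1) (anticausal_inv 1 (L1 f)) - F1 (L1 f)) + norm (mult_by V2 (anticausal_inv 1 (L2 f)) - F2 (L2 f)))"
      by (simp add: norm_scaleC norm_triangle_ineq mult_left_mono)
    also have "\<dots> \<le> (cmod c + 1) * (\<epsilon> * (K1 * norm f) + \<epsilon> * (K2 * norm f))"
    proof (intro mult_mono add_mono)
      show "norm (mult_by (\<lambda>x. V x - 1) (anticausal_inv 1 (L1 f)) - F1 (L1 f)) \<le> \<epsilon> * (K1 * norm f)"
        by (rule order_trans[OF F1(2)], rule mult_left_mono[OF K1(2)]) (use \<epsilon> in simp)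
      show "norm (mult_by V2 (anticausal_inv 1 (L2 f)) - F2 (L2 f)) \<le> \<epsilon> * (K2 * norm f)"
        by (rule order_trans[OF F2(2)], rule mult_left_mono[OF K2(2)]) (use \<epsilon> in simp)
    qed (use c1 in auto)
    also have "\<dots> = ((cmod c + 1) * \<epsilon> * (K1 + K2)) * norm f" by (simp add: algebra_simps)
    also have "(cmod c + 1) * \<epsilon> * (K1 + K2) = 1/2"
    proof -
      have "A * (1 / (2 * A * B)) * B = 1/2" if "A \<noteq> 0" "B \<noteq> 0" for A B :: real
        using that by simp
      from this[of "cmod c + 1" "K1 + K2"] show ?thesis
        unfolding \<epsilon>_def using c1 K1(1) K2(1) by simp
    qed
    finally show ?thesis .
  qed
  have "bounded_clinear (\<lambda>f. K f - F f)"
    unfolding bounded_clinear_def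
  proof (intro conjI allI exI)
    show "norm (K f - F f) \<le> 1/2 * norm f" for f by (rule bound)
    have Kadd: "K (f + g) = K f + K g" "K (d *\<^sub>C f) = d *\<^sub>C K f" for f g d
      using bK unfolding bounded_clinear_def by blast+
    show "K (f + g) - F (f + g) = (K f - F f) + (K g - F g)" for f g
      unfolding Kadd finite_rank_linear[OF fF] by simp
    show "K (d *\<^sub>C f) - F (d *\<^sub>C f) = d *\<^sub>C (K f - F f)" for d f
      unfolding Kadd finite_rank_linear[OF fF] by (simp add: complex_vector.scale_right_diff_distrib)
  qed
  then show thesis using that[OF fF] bound unfolding K_def by blast
qed

text \<open>With S the constant-coefficient operator, T = (1 + E + F) S and E has norm at most 1/2.
  Put G = 1 + E and J = G S, a bijection of the domain onto L2; then T = J + F (inv G) J is a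
  bijection plus finite rank. Closedness holds because the perturbation is continuous in the H2 norm
  and S has a bounded inverse.\<close>

lemma OS_fredholm:
  assumes T: "\<And>u. T u = OS_const a \<nu> u + OS_pert a R V V2 u"
  shows "fredholm_operator OS_X (sobolev_norm 2) OS_dom T" "deficiency OS_dom T = nullity OS_dom T"
proof -
  define S where "S = OS_const a \<nu>"
  obtain F where F: "finite_rank F" "bounded_clinear (\<lambda>f. OS_pert a R V V2 (OS_inv a \<nu> f) - F f)"
    "\<And>f. norm (OS_pert a R V V2 (OS_inv a \<nu> f) - F f) \<le> 1/2 * norm f"
    using OS_pert_approximation by blast
  define E where "E f = OS_pert a R V V2 (OS_inv a \<nu> f) - F f" for f
  have E: "bounded_clinear E" "\<And>f. norm (E f) \<le> 1/2 * norm f"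
    using F(2,3) unfolding E_def[abs_def] by auto
  define G where "G y = y + E y" for y
  have bijG: "bij G" unfolding G_def[abs_def] by (rule Neumann_bij(1)[OF E])
  have bG: "bounded_clinear G" unfolding G_def[abs_def] by (intro bounded_clinear_add bounded_clinear_ident E(1))
  have Glin: "G (x + y) = G x + G y" "G (c *\<^sub>C x) = c *\<^sub>C G x" for x y c
    using bG unfolding bounded_clinear_def by blast+
  have invG: "G (inv G y) = y" "inv G (G y) = y" for y
    using bijG by (simp_all add: bij_is_surj surj_f_inv_f bij_is_inj)
  have binv: "bounded_clinear (inv G)"
    unfolding bounded_clinear_def
  proof (intro conjI allI exI)
    show "inv G (x + y) = inv G x + inv G y" for x y
      using invG(2)[of "inv G x + inv G y"] by (simp add: Glin invG)
    show "inv G (c *\<^sub>C x) = c *\<^sub>C inv G x" for c x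
      using invG(2)[of "c *\<^sub>C inv G x"] by (simp add: Glin invG)
    show "norm (inv G x) \<le> 2 * norm x" for x
      using Neumann_bij(2)[OF E, of "inv G x"] invG(1)[of x] unfolding G_def by simp
  qed
  define J where "J u = G (S u)" for u
  have bijJ: "bij_betw J OS_dom UNIV"
    using bij_betw_trans[OF OS_const_bij[OF a \<nu>] bijG] unfolding J_def[abs_def] S_def comp_def .
  have TJ: "T u = J u + F (inv G (J u))" if "u \<in> OS_dom" for u
  proof -
    have "inv G (J u) = S u" unfolding J_def by (rule invG(2))
    moreover have "J u = OS_const a \<nu> u + (OS_pert a R V V2 u - F (S u))"
      unfolding J_def G_def E_def S_def OS_inv_OS_const[OF a \<nu> that] ..
    ultimately show ?thesis unfolding T by simp
  qed
  have Slin: "S (u + v) = S u + S v" "S (c *\<^sub>C u) = c *\<^sub>C S u" if "u \<in> OS_dom" "v \<in> OS_dom" for u v c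
    unfolding S_def by (rule OS_const_linear[OF that])+
  have Jlin: "J (u + v) = J u + J v" if "u \<in> OS_dom" "v \<in> OS_dom" for u v
    unfolding J_def Slin[OF that] Glin ..
  have Jscale: "J (c *\<^sub>C u) = c *\<^sub>C J u" if "u \<in> OS_dom" for u c
    unfolding J_def Slin(2)[OF that that] Glin ..
  note main = bijective_plus_finite_rank[OF OS_dom_subspace bijJ Jlin Jscale finite_rank_compose[OF F(1) binv] TJ]
  show "deficiency OS_dom T = nullity OS_dom T" by (rule main(4))
  have closed: "closed_operator OS_X (sobolev_norm 2) OS_dom T"
    unfolding closed_operator_def
  proof (intro conjI ballI allI impI)
    show "complex_vector.subspace OS_dom" by (rule OS_dom_subspace)
    show "OS_dom \<subseteq> OS_X" by (rule OS_dom_subset_X)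
    show "T (u + v) = T u + T v" if "u \<in> OS_dom" "v \<in> OS_dom" for u v
      unfolding T OS_const_linear(1)[OF that] OS_pert_add(1)[OF OS_dom_sobolev_2[OF that(1)] OS_dom_sobolev_2[OF that(2)]]
      by simp
    show "T (c *\<^sub>C u) = c *\<^sub>C T u" if "u \<in> OS_dom" for c u
      unfolding T OS_const_linear(2)[OF that that] OS_pert_add(2)[OF OS_dom_sobolev_2[OF that] OS_dom_sobolev_2[OF that]]
      by (simp add: scaleC_add_right)
  next
    fix u :: "nat \<Rightarrow> l2" and x y
    assume u: "\<forall>n. u n \<in> OS_dom" and x: "x \<in> OS_X"
      and lim: "(\<lambda>n. sobolev_norm 2 (u n - x)) \<longlonglongrightarrow> 0" and Tlim: "(\<lambda>n. T (u n)) \<longlonglongrightarrow> y"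
    have x2: "x \<in> sobolev 2" using x unfolding OS_X_def by blast
    have u2: "u n \<in> sobolev 2" for n using u OS_dom_sobolev_2 by blast
    \<comment> \<open>Convergence in the H2 norm gives L2 convergence of each weak derivative up to
      order 2, hence of \<open>helm a\<close> and of the perturbation.\<close>
    have le: "norm (weak_deriv j v) \<le> sobolev_norm 2 v" if "j \<le> 2" for j v
    proof -
      have "(norm (weak_deriv j v))\<^sup>2 \<le> (\<Sum>j\<le>2. (norm (weak_deriv j v))\<^sup>2)"
        using that by (intro member_le_sum) auto
      then show ?thesis unfolding sobolev_norm_def by (rule real_le_rsqrt)
    qed
    have conv: "(\<lambda>n. weak_deriv j (u n - x)) \<longlonglongrightarrow> 0" if "j \<le> 2" for j
      by (rule Lim_null_comparison[OF always_eventually lim]) (use le[OF that] in blast)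
    have "(\<lambda>n. u n - x) \<longlonglongrightarrow> 0"
      using conv[of 0] by (simp add: weak_deriv_0)
    then have u_lim: "u \<longlonglongrightarrow> x" by (rule LIM_zero_cancel)
    have "(\<lambda>n. helm a (u n - x)) \<longlonglongrightarrow> - 0 + complex_of_real (a\<^sup>2) *\<^sub>C (x - x)"
      unfolding helm_def
      by (intro tendsto_add[OF tendsto_minus[OF conv] bounded_clinear_tendsto[OF bounded_clinear_scaleC[OF
          bounded_clinear_ident] tendsto_diff[OF u_lim tendsto_const]]]) simp
    then have "(\<lambda>n. helm a (u n) - helm a x) \<longlonglongrightarrow> 0"
      by (simp add: helm_linear(3)[OF u2 x2])
    then have h_lim: "(\<lambda>n. helm a (u n)) \<longlonglongrightarrow> helm a x" by (rule LIM_zero_cancel)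
    have p_lim: "(\<lambda>n. OS_pert a R V V2 (u n)) \<longlonglongrightarrow> OS_pert a R V V2 x"
      unfolding OS_pert_def
      by (rule bounded_clinear_tendsto[OF bounded_clinear_scaleC[OF bounded_clinear_ident] tendsto_add[OF
          bounded_clinear_tendsto[OF bounded_clinear_mult_by[OF m1] h_lim]
          bounded_clinear_tendsto[OF bounded_clinear_mult_by[OF m2] u_lim]]])
    have "(\<lambda>n. T (u n) - OS_pert a R V V2 (u n)) \<longlonglongrightarrow> y - OS_pert a R V V2 x"
      by (rule tendsto_diff[OF Tlim p_lim])
    then have "(\<lambda>n. S (u n)) \<longlonglongrightarrow> y - OS_pert a R V V2 x"
      unfolding T S_def by simp
    \<comment> \<open>The bounded inverse turns convergence of S (u n) into convergence of u n;
      comparing the two limits exhibits x as an element of the domain with the right image.\<close>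
    then have "(\<lambda>n. OS_inv a \<nu> (S (u n))) \<longlonglongrightarrow> OS_inv a \<nu> (y - OS_pert a R V V2 x)"
      by (rule bounded_clinear_tendsto[OF bounded_clinear_OS_inv[OF a \<nu>]])
    then have "u \<longlonglongrightarrow> OS_inv a \<nu> (y - OS_pert a R V V2 x)"
      unfolding S_def using u OS_inv_OS_const[OF a \<nu>] by simp
    then have x_eq: "x = OS_inv a \<nu> (y - OS_pert a R V V2 x)"
      using u_lim LIMSEQ_unique by blast
    show "x \<in> OS_dom"
      by (subst x_eq) (rule OS_inv_derivatives(1)[OF a \<nu>])
    have "OS_const a \<nu> x = y - OS_pert a R V V2 x"
      by (subst x_eq) (rule OS_const_OS_inv[OF a \<nu>])
    then show "T x = y" unfolding T by simp
  qed
  then show "fredholm_operator OS_X (sobolev_norm 2) OS_dom T"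
    unfolding fredholm_operator_def using main(1-3) by blast
qed

end

section \<open>On the ray\<close>

lemma deriv_scaled:
  assumes "smooth_fun f"
  shows "deriv (\<lambda>x. f (x / L)) = (\<lambda>x. deriv f (x / L) / L)"
proof
  fix x
  have "((\<lambda>x. x / L) has_real_derivative 1 / L) (at x)"
    using DERIV_cdivide[OF DERIV_ident] .
  from DERIV_chain2[OF smooth_fun_has_derivative[OF assms] this]
  show "deriv (\<lambda>x. f (x / L)) x = deriv f (x / L) / L"
    by (intro DERIV_imp_deriv) simp
qed

lemma test_function_scaled_bump:
  assumes "L > 0"
  shows "test_function (\<lambda>x. bump 1 2 (x / L))"
proof (rule test_functionI[of _ L "2 * L"])
  have "smooth_fun (\<lambda>x. bump 1 2 (inverse L * x))"
    by (rule smooth_fun_intros(9)[OF smooth_fun_bump smooth_fun_cmult[OF smooth_fun_intros(3)]])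
  then show "smooth_fun (\<lambda>x. bump 1 2 (x / L))" by (simp add: field_class.field_divide_inverse mult.commute)
  show "bump 1 2 (x / L) = 0" if "x \<notin> {L..2 * L}" for x
    using that assms by (intro bump_zero) (auto simp: field_simps)
qed (use assms in auto)

definition osc :: "real \<Rightarrow> real \<Rightarrow> real \<Rightarrow> complex"
  where "osc \<theta> L x = exp (\<i> * complex_of_real \<theta> * complex_of_real x) * complex_of_real (bump 1 2 (x / L))"

lemma complex_test_osc: "L > 0 \<Longrightarrow> complex_test_function (osc \<theta> L)"
  unfolding osc_def[abs_def] by (rule complex_test_function_exp[OF test_function_scaled_bump])

lemma square_integrable_osc: "L > 0 \<Longrightarrow> square_integrable (osc \<theta> L)"
  by (rule complex_test_function_emb(1)[OF complex_test_osc])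

lemma cmod_osc: "cmod (osc \<theta> L x) = bump 1 2 (x / L)"
  using bump_nonneg[of 1 2 "x / L"] by (simp add: osc_def norm_mult norm_exp_eq_Re)

lemma osc_zero: "L > 0 \<Longrightarrow> \<not> (L < x \<and> x < 2 * L) \<Longrightarrow> osc \<theta> L x = 0"
  using bump_zero[of 1 "x / L" 2] by (auto simp: osc_def field_simps)

text \<open>On the middle half [5L/4, 7L/4], of length L/2, both factors of the bump are at least
  exp (-4), because 1/t \<le> 4 for t \<ge> 1/4; their product gives exp (-8).\<close>

lemma norm_osc_lower:
  assumes L: "L > 0"
  shows "exp (-8) * sqrt (L / 2) \<le> norm (abs_l2 (osc \<theta> L))"
proof -
  have "ennreal ((exp (-8))\<^sup>2) * ennreal (L / 2)
      = (\<integral>\<^sup>+x. ennreal ((exp (-8))\<^sup>2) * indicator {5/4 * L..7/4 * L} x \<partial>lebesgue)"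
    using L by (subst nn_integral_cmult_indicator) auto
  also have "\<dots> \<le> (\<integral>\<^sup>+x. ennreal ((cmod (osc \<theta> L x))\<^sup>2) * indicator {0<..} x \<partial>lebesgue)"
  proof (rule nn_integral_mono)
    fix x
    show "ennreal ((exp (-8))\<^sup>2) * indicator {5/4 * L..7/4 * L} x
        \<le> ennreal ((cmod (osc \<theta> L x))\<^sup>2) * indicator {0<..} x"
    proof (cases "x \<in> {5/4 * L..7/4 * L}")
      case True
      have y: "1/4 \<le> x / L - 1" "1/4 \<le> 2 - x / L" using True L by (auto simp: field_simps)
      have flat: "exp (-4) \<le> flat_fun 0 t" if "1/4 \<le> t" for t
      proof -
        have "inverse t \<le> 4" using le_imp_inverse_le[OF that] by simp
        then show ?thesis using that by (simp add: flat_fun_def)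
      qed
      have "exp (-8) = exp (-4) * exp (-4 :: real)" by (simp flip: exp_add)
      also have "\<dots> \<le> bump 1 2 (x / L)"
        unfolding bump_def by (intro mult_mono flat y) (auto simp: flat_fun_def)
      finally have "(exp (-8))\<^sup>2 \<le> (cmod (osc \<theta> L x))\<^sup>2"
        unfolding cmod_osc by (intro power_mono) auto
      moreover have "0 < 5/4 * L" "5/4 * L \<le> x" using True L by auto
      then have "x > 0" by linarith
      ultimately show ?thesis using True by (simp add: ennreal_leI)
    qed simp
  qed
  also have "\<dots> = ennreal ((norm (abs_l2 (osc \<theta> L)))\<^sup>2)"
    unfolding nn_integral_abs_l2[OF square_integrable_osc[OF L], symmetric] by (simp add: nn_integral_restrict_space)
  finally have "(exp (-8))\<^sup>2 * (L / 2) \<le> (norm (abs_l2 (osc \<theta> L)))\<^sup>2"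
    using L by (simp flip: ennreal_mult)
  then have "(exp (-8) * sqrt (L / 2))\<^sup>2 \<le> (norm (abs_l2 (osc \<theta> L)))\<^sup>2"
    using L by (simp add: power_mult_distrib)
  then show ?thesis by (rule power2_le_imp_le) simp
qed

definition weyl :: "real \<Rightarrow> real \<Rightarrow> l2"
  where "weyl \<theta> L = complex_of_real (inverse (norm (abs_l2 (osc \<theta> L)))) *\<^sub>C abs_l2 (osc \<theta> L)"

lemma norm_osc_pos: "L > 0 \<Longrightarrow> norm (abs_l2 (osc \<theta> L)) > 0"
  by (rule less_le_trans[OF _ norm_osc_lower]) simp_all

text \<open>Each derivative falling on the envelope costs a factor 1/L, so apart from the exact term
  with -\<theta>^2 the second derivative has sup norm of order 1/L on an interval of length L. The
  packet itself has norm of order sqrt L, so the ratio of the norms is of order 1/L.\<close>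

lemma osc_second_derivative:
  obtains C where "C \<ge> 0"
    "\<And>L. L \<ge> 1 \<Longrightarrow> \<exists>\<Phi>' \<Phi>'' \<Psi>. (\<forall>x. (osc \<theta> L has_vector_derivative \<Phi>' x) (at x)) \<and>
      (\<forall>x. (\<Phi>' has_vector_derivative \<Phi>'' x) (at x)) \<and> square_integrable \<Psi> \<and>
      (\<forall>x. \<Phi>'' x = \<Psi> x - complex_of_real (\<theta>\<^sup>2) * osc \<theta> L x) \<and>
      norm (abs_l2 \<Psi>) \<le> C / L * norm (abs_l2 (osc \<theta> L))"
proof -
  let ?\<rho> = "bump 1 2"
  have t: "test_function ?\<rho>" by (rule test_function_bump) auto
  note t1 = test_function_deriv[OF t] and t2 = test_function_deriv[OF test_function_deriv[OF t]]
  have sm: "smooth_fun ?\<rho>" "smooth_fun (deriv ?\<rho>)"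
    using t t1 unfolding test_function_iff by auto
  obtain B1 where B1: "B1 > 0" "\<And>x. \<bar>deriv ?\<rho> x\<bar> \<le> B1" using test_function_bounded[OF t1] by blast
  obtain B2 where B2: "B2 > 0" "\<And>x. \<bar>deriv (deriv ?\<rho>) x\<bar> \<le> B2" using test_function_bounded[OF t2] by blast
  \<comment> \<open>2 |\<theta>| B1 + B2 bounds L |\<Psi>|, and sqrt 2 exp 8 is the ratio of sqrt L
    to the lower bound for the norm of the packet.\<close>
  define C where "C = (2 * \<bar>\<theta>\<bar> * B1 + B2) * sqrt 2 * exp 8"
  have C: "C \<ge> 0" using B1 B2 by (simp add: C_def)
  show thesis
  proof (rule that[OF C])
    fix L :: real assume L: "L \<ge> 1"
    then have L0: "L > 0" by simp
    define c where "c = \<i> * complex_of_real \<theta>"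
    define e where "e x = exp (c * complex_of_real x)" for x
    define \<phi> where "\<phi> x = ?\<rho> (x / L)" for x
    have t\<phi>: "test_function \<phi>" unfolding \<phi>_def by (rule test_function_scaled_bump[OF L0])
    have d\<phi>: "deriv \<phi> = (\<lambda>x. deriv ?\<rho> (x / L) / L)"
      unfolding \<phi>_def[abs_def] by (rule deriv_scaled[OF sm(1)])
    have sm1: "smooth_fun (\<lambda>x. deriv ?\<rho> (x / L))"
    proof -
      have "smooth_fun (\<lambda>x. deriv ?\<rho> (inverse L * x))"
        by (rule smooth_fun_intros(9)[OF sm(2) smooth_fun_cmult[OF smooth_fun_intros(3)]])
      then show ?thesis by (simp add: field_class.field_divide_inverse mult.commute)
    qed
    have d2\<phi>: "deriv (deriv \<phi>) = (\<lambda>x. deriv (deriv ?\<rho>) (x / L) / L / L)"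
    proof
      fix x
      have "((\<lambda>x. deriv ?\<rho> (x / L)) has_real_derivative deriv (deriv ?\<rho>) (x / L) / L) (at x)"
        using smooth_fun_has_derivative[OF sm1, of x] unfolding deriv_scaled[OF sm(2)] .
      from DERIV_cdivide[OF this, of L]
      show "deriv (deriv \<phi>) x = deriv (deriv ?\<rho>) (x / L) / L / L"
        unfolding d\<phi> by (rule DERIV_imp_deriv)
    qed
    note td\<phi> = test_function_deriv[OF t\<phi>]
    define \<Phi>' where "\<Phi>' x = c * (e x * complex_of_real (\<phi> x)) + e x * complex_of_real (deriv \<phi> x)" for x
    define \<Phi>'' where "\<Phi>'' x = c * \<Phi>' x + (c * (e x * complex_of_real (deriv \<phi> x)) + e x * complex_of_real (deriv (deriv \<phi>) x))" for x
    define \<Psi> where "\<Psi> x = e x * (2 * c * complex_of_real (deriv \<phi> x) + complex_of_real (deriv (deriv \<phi>) x))" for x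
    have osc_eq: "osc \<theta> L = (\<lambda>x. e x * complex_of_real (\<phi> x))"
      by (simp add: fun_eq_iff osc_def e_def c_def \<phi>_def)
    have D1: "(osc \<theta> L has_vector_derivative \<Phi>' x) (at x)" for x
      unfolding osc_eq \<Phi>'_def e_def by (rule exp_test_function_has_derivative[OF t\<phi>])
    have D2: "(\<Phi>' has_vector_derivative \<Phi>'' x) (at x)" for x
    proof -
      have "((\<lambda>x. c * osc \<theta> L x + e x * complex_of_real (deriv \<phi> x)) has_vector_derivative
          c * \<Phi>' x + (c * (e x * complex_of_real (deriv \<phi> x)) + e x * complex_of_real (deriv (deriv \<phi>) x))) (at x)"
        by (intro has_vector_derivative_add has_vector_derivative_mult_right[OF D1])
          (unfold e_def, rule exp_test_function_has_derivative[OF td\<phi>])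
      then show ?thesis unfolding \<Phi>'_def[abs_def] \<Phi>''_def osc_eq .
    qed
    have eq: "\<Phi>'' x = \<Psi> x - complex_of_real (\<theta>\<^sup>2) * osc \<theta> L x" for x
    proof -
      have "c * c = - complex_of_real (\<theta>\<^sup>2)" by (simp add: c_def power2_eq_square complex_eq_iff)
      then have "complex_of_real (\<theta>\<^sup>2) = - (c * c)" by simp
      then show ?thesis unfolding \<Phi>''_def \<Psi>_def \<Phi>'_def osc_eq by (simp add: algebra_simps)
    qed
    have norm_e: "cmod (e x) = 1" for x by (simp add: e_def c_def norm_exp_eq_Re)
    have supp: "deriv \<phi> x = 0 \<and> deriv (deriv \<phi>) x = 0" if "x \<notin> {L..2 * L}" for x
    proof -
      have "deriv f x = 0" if f: "\<And>y. y \<notin> {L..2 * L} \<Longrightarrow> f y = 0" and x: "x \<notin> {L..2 * L}" for f :: "real \<Rightarrow> real" and x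
      proof -
        have "((\<lambda>x. 0) has_real_derivative 0) (at x)" by simp
        then have "(f has_real_derivative 0) (at x)"
          by (rule has_field_derivative_transform_within_open[of _ _ _ "- {L..2 * L}"]) (use f x in auto)
        then show ?thesis by (rule DERIV_imp_deriv)
      qed
      note z = this
      have "\<phi> y = 0" if "y \<notin> {L..2 * L}" for y
        unfolding \<phi>_def using that L0 by (intro bump_zero) (auto simp: field_simps)
      then have "deriv \<phi> y = 0" if "y \<notin> {L..2 * L}" for y using z that by blast
      then show ?thesis using z that by blast
    qed
    have bound: "cmod (\<Psi> x) \<le> (2 * \<bar>\<theta>\<bar> * B1 + B2) / L" for x
    proof -
      have "cmod (\<Psi> x) \<le> 2 * \<bar>\<theta>\<bar> * \<bar>deriv \<phi> x\<bar> + \<bar>deriv (deriv \<phi>) x\<bar>"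
        unfolding \<Psi>_def norm_mult norm_e
        using norm_triangle_ineq[of "2 * c * complex_of_real (deriv \<phi> x)" "complex_of_real (deriv (deriv \<phi>) x)"]
        by (simp add: norm_mult c_def)
      also have "\<dots> \<le> 2 * \<bar>\<theta>\<bar> * (B1 / L) + B2 / L"
      proof (intro add_mono mult_left_mono)
        show "\<bar>deriv \<phi> x\<bar> \<le> B1 / L"
          unfolding d\<phi> using B1(2)[of "x / L"] L0 by (simp add: abs_divide divide_right_mono)
        have "\<bar>deriv (deriv \<phi>) x\<bar> \<le> B2 / L / L"
          unfolding d2\<phi> using B2(2)[of "x / L"] L0 by (simp add: abs_divide divide_right_mono)
        \<comment> \<open>Here L \<ge> 1 weakens 1/L^2 to 1/L.\<close>
        also have "\<dots> \<le> B2 / L"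
          using L B2(1) by (simp add: divide_le_eq)
        finally show "\<bar>deriv (deriv \<phi>) x\<bar> \<le> B2 / L" .
      qed simp
      finally show ?thesis by (simp add: add_divide_distrib)
    qed
    have "continuous_on {0<..} \<Psi>"
      unfolding \<Psi>_def e_def
      by (intro continuous_intros test_function_continuous[OF td\<phi>] test_function_continuous[OF test_function_deriv[OF td\<phi>]])
    then have meas: "\<Psi> \<in> borel_measurable half_line" by (rule borel_measurable_half_line_continuous)
    have nonneg: "(2 * \<bar>\<theta>\<bar> * B1 + B2) / L \<ge> 0" using B1 B2 L0 by simp
    have "\<Psi> x = 0" if "x \<notin> {L..2 * L}" for x using supp[OF that] by (simp add: \<Psi>_def)
    then have \<Psi>: "square_integrable \<Psi>" "norm (abs_l2 \<Psi>) \<le> (2 * \<bar>\<theta>\<bar> * B1 + B2) / L * sqrt (2 * L - L)"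
      using norm_l2_bounded_support[OF meas bound nonneg, of L "2 * L"] L0 by auto
    have "sqrt L = sqrt 2 * exp 8 * (exp (-8) * sqrt (L / 2))"
      using L0 by (simp add: real_sqrt_divide exp_minus)
    also have "\<dots> \<le> sqrt 2 * exp 8 * norm (abs_l2 (osc \<theta> L))"
      by (rule mult_left_mono[OF norm_osc_lower[OF L0]]) simp
    finally have "(2 * \<bar>\<theta>\<bar> * B1 + B2) / L * sqrt L \<le> (2 * \<bar>\<theta>\<bar> * B1 + B2) / L * (sqrt 2 * exp 8 * norm (abs_l2 (osc \<theta> L)))"
      by (rule mult_left_mono[OF _ nonneg])
    then have "norm (abs_l2 \<Psi>) \<le> C / L * norm (abs_l2 (osc \<theta> L))"
      using \<Psi>(2) by (simp add: C_def mult.assoc)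
    then show "\<exists>\<Phi>' \<Phi>'' \<Psi>. (\<forall>x. (osc \<theta> L has_vector_derivative \<Phi>' x) (at x)) \<and>
      (\<forall>x. (\<Phi>' has_vector_derivative \<Phi>'' x) (at x)) \<and> square_integrable \<Psi> \<and>
      (\<forall>x. \<Phi>'' x = \<Psi> x - complex_of_real (\<theta>\<^sup>2) * osc \<theta> L x) \<and>
      norm (abs_l2 \<Psi>) \<le> C / L * norm (abs_l2 (osc \<theta> L))"
      using D1 D2 eq \<Psi>(1) by blast
  qed
qed

text \<open>With w = \<open>helm a u\<close> the operator reduces to -w'' - \<theta>^2 w. Moving
  both derivatives onto the packet cancels the resonant terms and leaves the remainder \<Psi>;
  compact support of the packet excludes boundary terms.\<close>

lemma pair_const_osc:
  assumes u: "u \<in> OS_dom" and \<nu>: "\<nu>\<^sup>2 = - complex_of_real (\<theta>\<^sup>2)" and L: "L > 0"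
    and d: "\<And>x. (osc \<theta> L has_vector_derivative \<Phi>' x) (at x)" "\<And>x. (\<Phi>' has_vector_derivative \<Phi>'' x) (at x)"
    and \<Psi>: "square_integrable \<Psi>" "\<And>x. \<Phi>'' x = \<Psi> x - complex_of_real (\<theta>\<^sup>2) * osc \<theta> L x"
  shows "pair (OS_const a \<nu> u) (abs_l2 (osc \<theta> L)) = - pair (helm a u) (abs_l2 \<Psi>)"
proof -
  define w where "w = helm a u"
  obtain w1 w2 where w: "is_weak_deriv 1 w w1" "is_weak_deriv 1 w1 w2"
    using helm_OS_dom_sobolev[OF u, of a] unfolding w_def sobolev_2 by blast
  note t = complex_test_osc[OF L, of \<theta>]
  note t1 = complex_test_function_derivative(1)[OF t d(1)]
  have "abs_l2 \<Phi>'' = abs_l2 \<Psi> - complex_of_real (\<theta>\<^sup>2) *\<^sub>C abs_l2 (osc \<theta> L)"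
    unfolding \<Psi>(2)[abs_def]
    by (simp only: abs_l2_diff[OF \<Psi>(1) square_integrable_mult_const[OF square_integrable_osc[OF L]]]
        abs_l2_scaleC[OF square_integrable_osc[OF L]])
  moreover have "pair w2 (abs_l2 (osc \<theta> L)) = pair w (abs_l2 \<Phi>'')"
    using weak_deriv_complex_test[OF w(2) t d(1)] weak_deriv_complex_test[OF w(1) t1 d(2)] by simp
  ultimately have w2: "pair w2 (abs_l2 (osc \<theta> L))
      = pair w (abs_l2 \<Psi>) - complex_of_real (\<theta>\<^sup>2) * pair w (abs_l2 (osc \<theta> L))"
    by (simp only: pair_diff_right pair_scaleC_right)
  show ?thesis
    unfolding OS_const_def w_def[symmetric] helm_eq[OF w] \<nu> pair_add_left pair_diff_left pair_scaleC_left w2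
    by (simp add: algebra_simps)
qed

text \<open>Only the values of m beyond L meet the support of f, so m may be truncated there, after
  which \<eta> bounds it everywhere.\<close>

lemma pair_mult_by_tail:
  assumes m: "bounded_multiplier M m" and \<eta>: "\<eta> \<ge> 0" "\<And>x. x > L \<Longrightarrow> \<bar>m x\<bar> \<le> \<eta>"
    and f: "square_integrable f" "\<And>x. x \<le> L \<Longrightarrow> f x = 0"
  shows "cmod (pair (mult_by m w) (abs_l2 f)) \<le> \<eta> * norm w * norm (abs_l2 f)"
proof -
  define m' where "m' x = (if x \<le> L then 0 else m x)" for x
  have [measurable]: "m \<in> borel_measurable half_line" "(\<lambda>x. x) \<in> borel_measurable half_line"
    using m measurable_ident_half_line by (auto simp: bounded_multiplier_def)
  have "m' \<in> borel_measurable half_line" unfolding m'_def[abs_def] by measurable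
  then have m': "bounded_multiplier \<eta> m'"
    using \<eta> by (auto simp: bounded_multiplier_def m'_def)
  have "pair (mult_by m w) (abs_l2 f) = pair (mult_by m' w) (abs_l2 f)"
    unfolding pair_abs_right[OF f(1)]
  proof (rule integral_cong_AE)
    show "AE x in half_line. rep_l2 (mult_by m w) x * f x = rep_l2 (mult_by m' w) x * f x"
      using AE_rep_mult_by[OF m, of w] AE_rep_mult_by[OF m', of w]
      by eventually_elim (use f(2) in \<open>auto simp: m'_def\<close>)
  qed (use f(1) in \<open>auto simp: square_integrable_def\<close>)
  also have "cmod \<dots> \<le> norm (mult_by m' w) * norm (abs_l2 f)" by (rule Cauchy_Schwarz_l2)
  also have "\<dots> \<le> \<eta> * norm w * norm (abs_l2 f)"
    by (intro mult_right_mono norm_mult_by[OF m']) simp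
  finally show ?thesis .
qed

lemma pair_scaled_le:
  assumes "L > 0" "cmod (pair v (abs_l2 (osc \<theta> L))) \<le> K * norm (abs_l2 (osc \<theta> L))"
  shows "cmod (pair v (weyl \<theta> L)) \<le> K"
proof -
  note n = norm_osc_pos[OF assms(1), of \<theta>]
  have "cmod (pair v (weyl \<theta> L)) = inverse (norm (abs_l2 (osc \<theta> L))) * cmod (pair v (abs_l2 (osc \<theta> L)))"
    unfolding weyl_def pair_scaleC_right norm_mult norm_of_real by simp
  also have "\<dots> \<le> inverse (norm (abs_l2 (osc \<theta> L))) * (K * norm (abs_l2 (osc \<theta> L)))"
    using n by (intro mult_left_mono assms) simp
  also have "\<dots> = K" using n by simp
  finally show ?thesis .
qed

text \<open>The constant-coefficient part contributes C / L by scaling, the multipliers contribute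
  their size beyond L. Measured against the norms of \<open>helm a u\<close> and u, one threshold
  for L serves all u in the domain.\<close>

lemma weyl_operator_small:
  assumes m1: "bounded_multiplier M1 (\<lambda>x. V x - 1)" and m2: "bounded_multiplier M2 V2"
    and lim1: "((\<lambda>x. V x - 1) \<longlongrightarrow> 0) at_top" and lim2: "(V2 \<longlongrightarrow> 0) at_top"
    and \<nu>: "\<nu>\<^sup>2 = - complex_of_real (\<theta>\<^sup>2)" and \<epsilon>: "\<epsilon> > 0"
  shows "\<forall>\<^sub>F L in at_top. \<forall>u\<in>OS_dom.
    cmod (pair (OS_const a \<nu> u + OS_pert a R V V2 u) (weyl \<theta> L)) \<le> \<epsilon> * (norm (helm a u) + norm u)"
proof -
  obtain C where C: "C \<ge> 0"
    "\<And>L. L \<ge> 1 \<Longrightarrow> \<exists>\<Phi>' \<Phi>'' \<Psi>. (\<forall>x. (osc \<theta> L has_vector_derivative \<Phi>' x) (at x)) \<and>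
      (\<forall>x. (\<Phi>' has_vector_derivative \<Phi>'' x) (at x)) \<and> square_integrable \<Psi> \<and>
      (\<forall>x. \<Phi>'' x = \<Psi> x - complex_of_real (\<theta>\<^sup>2) * osc \<theta> L x) \<and>
      norm (abs_l2 \<Psi>) \<le> C / L * norm (abs_l2 (osc \<theta> L))"
    using osc_second_derivative[of \<theta>] by blast
  define k where "k = cmod (\<i> * complex_of_real a * complex_of_real R)"
  have k0: "k \<ge> 0" by (simp add: k_def)
  \<comment> \<open>Chosen so that k \<eta> \<le> \<epsilon>/2, with k + 1 in the denominator so
    that k may be 0.\<close>
  define \<eta> where "\<eta> = \<epsilon> / (2 * (k + 1))"
  have \<eta>: "\<eta> > 0" using \<epsilon> k0 by (simp add: \<eta>_def)
  have k\<eta>: "k * \<eta> \<le> \<epsilon> / 2"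
  proof -
    have "k * \<eta> = k / (k + 1) * (\<epsilon> / 2)" by (simp add: \<eta>_def)
    also have "\<dots> \<le> 1 * (\<epsilon> / 2)" using k0 \<epsilon> by (intro mult_right_mono) auto
    finally show ?thesis by simp
  qed
  have "\<forall>\<^sub>F x in at_top. \<bar>V x - 1\<bar> < \<eta> \<and> \<bar>V2 x\<bar> < \<eta>"
    using tendstoD[OF lim1 \<eta>] tendstoD[OF lim2 \<eta>] by eventually_elim (simp add: dist_real_def)
  then obtain N where N: "\<And>x. x \<ge> N \<Longrightarrow> \<bar>V x - 1\<bar> < \<eta> \<and> \<bar>V2 x\<bar> < \<eta>"
    unfolding eventually_at_top_linorder by blast
  show ?thesis
    unfolding eventually_at_top_linorder
  proof (intro exI[of _ "max 1 (max N (2 * C / \<epsilon>))"] allI impI ballI)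
    fix L u assume "max 1 (max N (2 * C / \<epsilon>)) \<le> L" and u: "u \<in> OS_dom"
    then have L: "L \<ge> 1" "L \<ge> N" "2 * C / \<epsilon> \<le> L" by auto
    then have L0: "L > 0" by simp
    have CL: "C / L \<le> \<epsilon> / 2" using L(3) L0 \<epsilon> by (simp add: field_simps)
    let ?\<Phi> = "abs_l2 (osc \<theta> L)"
    obtain \<Phi>' \<Phi>'' \<Psi> where X: "\<And>x. (osc \<theta> L has_vector_derivative \<Phi>' x) (at x)"
      "\<And>x. (\<Phi>' has_vector_derivative \<Phi>'' x) (at x)" "square_integrable \<Psi>"
      "\<And>x. \<Phi>'' x = \<Psi> x - complex_of_real (\<theta>\<^sup>2) * osc \<theta> L x" "norm (abs_l2 \<Psi>) \<le> C / L * norm ?\<Phi>"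
      using C(2)[OF L(1)] by blast
    have "cmod (pair (OS_const a \<nu> u) ?\<Phi>) \<le> norm (helm a u) * norm (abs_l2 \<Psi>)"
      unfolding pair_const_osc[OF u \<nu> L0 X(1-4)] norm_minus_cancel by (rule Cauchy_Schwarz_l2)
    also have "\<dots> \<le> norm (helm a u) * (\<epsilon> / 2 * norm ?\<Phi>)"
      by (intro mult_left_mono order_trans[OF X(5)] mult_right_mono CL) auto
    finally have 1: "cmod (pair (OS_const a \<nu> u) ?\<Phi>) \<le> norm (helm a u) * (\<epsilon> / 2 * norm ?\<Phi>)" .
    have z: "osc \<theta> L x = 0" if "x \<le> L" for x using that by (intro osc_zero[OF L0]) auto
    have 2: "cmod (pair (mult_by (\<lambda>x. V x - 1) (helm a u)) ?\<Phi>) \<le> \<eta> * norm (helm a u) * norm ?\<Phi>"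
      using N L(2) \<eta> by (intro pair_mult_by_tail[OF m1 _ _ square_integrable_osc[OF L0] z]) (auto intro: less_imp_le)
    have 3: "cmod (pair (mult_by V2 u) ?\<Phi>) \<le> \<eta> * norm u * norm ?\<Phi>"
      using N L(2) \<eta> by (intro pair_mult_by_tail[OF m2 _ _ square_integrable_osc[OF L0] z]) (auto intro: less_imp_le)
    have "cmod (pair (OS_pert a R V V2 u) ?\<Phi>)
        = k * cmod (pair (mult_by (\<lambda>x. V x - 1) (helm a u)) ?\<Phi> + pair (mult_by V2 u) ?\<Phi>)"
      unfolding OS_pert_def pair_scaleC_left pair_add_left norm_mult k_def ..
    also have "\<dots> \<le> k * (\<eta> * norm (helm a u) * norm ?\<Phi> + \<eta> * norm u * norm ?\<Phi>)"
      by (intro mult_left_mono order_trans[OF norm_triangle_ineq] add_mono 2 3 k0)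
    also have "\<dots> = (k * \<eta>) * ((norm (helm a u) + norm u) * norm ?\<Phi>)" by (simp add: algebra_simps)
    also have "\<dots> \<le> (\<epsilon> / 2) * ((norm (helm a u) + norm u) * norm ?\<Phi>)"
      by (intro mult_right_mono k\<eta>) simp
    finally have 4: "cmod (pair (OS_pert a R V V2 u) ?\<Phi>) \<le> (\<epsilon> / 2) * ((norm (helm a u) + norm u) * norm ?\<Phi>)" .
    have "cmod (pair (OS_const a \<nu> u + OS_pert a R V V2 u) ?\<Phi>)
        \<le> norm (helm a u) * (\<epsilon> / 2 * norm ?\<Phi>) + (\<epsilon> / 2) * ((norm (helm a u) + norm u) * norm ?\<Phi>)"
      unfolding pair_add_left by (rule order_trans[OF norm_triangle_ineq add_mono[OF 1 4]])
    also have "\<dots> \<le> (\<epsilon> * (norm (helm a u) + norm u)) * norm ?\<Phi>"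
    proof -
      have "0 \<le> \<epsilon> * (norm u * norm ?\<Phi>)" using \<epsilon> by simp
      then show ?thesis by (simp add: algebra_simps)
    qed
    finally show "cmod (pair (OS_const a \<nu> u + OS_pert a R V V2 u) (weyl \<theta> L)) \<le> \<epsilon> * (norm (helm a u) + norm u)"
      by (rule pair_scaled_le[OF L0])
  qed
qed

text \<open>The packet has norm one and lives beyond L, so only the tail of b is seen, and the norm
  of that tail tends to 0 by dominated convergence.\<close>

lemma weyl_weakly_null:
  assumes \<epsilon>: "\<epsilon> > 0"
  shows "\<forall>\<^sub>F L in at_top. cmod (pair b (weyl \<theta> L)) \<le> \<epsilon>"
proof -
  define tail where "tail L x = (if x \<le> L then 0 else 1 :: real)" for L x :: real
  have [measurable]: "(\<lambda>x. x) \<in> borel_measurable half_line" by (rule measurable_ident_half_line)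
  have [measurable]: "tail L \<in> borel_measurable half_line" for L
    unfolding tail_def[abs_def] by measurable
  have m: "bounded_multiplier 1 (tail L)" for L
    unfolding bounded_multiplier_def by (auto simp: tail_def)
  have "((\<lambda>L. LINT x|half_line. (cmod (complex_of_real (tail L x) * rep_l2 b x))\<^sup>2) \<longlongrightarrow> (LINT x|half_line. 0)) at_top"
  proof (rule integral_dominated_convergence_at_top)
    show "integrable half_line (\<lambda>x. (cmod (rep_l2 b x))\<^sup>2)" by (rule integrable_rep_l2_sq)
    show "(\<lambda>x. (cmod (complex_of_real (tail L x) * rep_l2 b x))\<^sup>2) \<in> borel_measurable half_line" for L
      by measurable
    show "\<forall>\<^sub>F L in at_top. AE x in half_line. norm ((cmod (complex_of_real (tail L x) * rep_l2 b x))\<^sup>2) \<le> (cmod (rep_l2 b x))\<^sup>2"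
      by (simp add: tail_def)
    show "AE x in half_line. ((\<lambda>L. (cmod (complex_of_real (tail L x) * rep_l2 b x))\<^sup>2) \<longlongrightarrow> 0) at_top"
    proof (rule AE_I2)
      fix x
      have "\<forall>\<^sub>F L in at_top. (cmod (complex_of_real (tail L x) * rep_l2 b x))\<^sup>2 = 0"
        using eventually_ge_at_top[of x] by eventually_elim (simp add: tail_def)
      then show "((\<lambda>L. (cmod (complex_of_real (tail L x) * rep_l2 b x))\<^sup>2) \<longlongrightarrow> 0) at_top"
        by (rule tendsto_eventually)
    qed
  qed simp
  moreover have "(LINT x|half_line. (cmod (complex_of_real (tail L x) * rep_l2 b x))\<^sup>2) = (norm (mult_by (tail L) b))\<^sup>2" for L
    unfolding mult_by_def by (rule norm_abs_l2_sq[OF square_integrable_mult_bounded(1)[OF m square_integrable_rep_l2], symmetric])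
  ultimately have "((\<lambda>L. (norm (mult_by (tail L) b))\<^sup>2) \<longlongrightarrow> 0) at_top" by simp
  from tendstoD[OF this, of "\<epsilon>\<^sup>2"] \<epsilon>
  have "\<forall>\<^sub>F L in at_top. (norm (mult_by (tail L) b))\<^sup>2 < \<epsilon>\<^sup>2" by (simp add: dist_real_def)
  then show ?thesis
    using eventually_gt_at_top[of 0]
  proof eventually_elim
    case (elim L)
    have "norm (mult_by (tail L) b) \<le> \<epsilon>"
      using power2_less_imp_less[OF elim(1)] \<epsilon> by simp
    moreover have "pair b (abs_l2 (osc \<theta> L)) = pair (mult_by (tail L) b) (abs_l2 (osc \<theta> L))"
      unfolding pair_abs_right[OF square_integrable_osc[OF elim(2)]]
    proof (rule integral_cong_AE)
      show "AE x in half_line. rep_l2 b x * osc \<theta> L x = rep_l2 (mult_by (tail L) b) x * osc \<theta> L x"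
        using AE_rep_mult_by[OF m, of L b]
        by eventually_elim (use osc_zero[OF elim(2)] in \<open>auto simp: tail_def\<close>)
    qed (use square_integrable_osc[OF elim(2), of \<theta>] in \<open>auto simp: square_integrable_def\<close>)
    ultimately have "cmod (pair b (abs_l2 (osc \<theta> L))) \<le> \<epsilon> * norm (abs_l2 (osc \<theta> L))"
      using Cauchy_Schwarz_l2[of "mult_by (tail L) b" "abs_l2 (osc \<theta> L)"] mult_right_mono[of "norm (mult_by (tail L) b)" \<epsilon> "norm (abs_l2 (osc \<theta> L))"]
      by auto
    then show ?case by (rule pair_scaled_le[OF elim(2)])
  qed
qed

text \<open>As the pairing is bilinear, the vector dual to a packet is its complex conjugate; the
  product is then the squared modulus.\<close>

definition weyl_cnj :: "real \<Rightarrow> real \<Rightarrow> l2"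
  where "weyl_cnj \<theta> L = complex_of_real (inverse (norm (abs_l2 (osc \<theta> L)))) *\<^sub>C abs_l2 (\<lambda>x. cnj (osc \<theta> L x))"

lemma square_integrable_cnj: "square_integrable f \<Longrightarrow> square_integrable (\<lambda>x. cnj (f x))"
  unfolding square_integrable_def
  using borel_measurable_continuous_on[OF continuous_on_cnj[OF continuous_on_id]] by auto

lemma norm_weyl_cnj: "L > 0 \<Longrightarrow> norm (weyl_cnj \<theta> L) = 1"
proof -
  assume L: "L > 0"
  have "(norm (abs_l2 (\<lambda>x. cnj (osc \<theta> L x))))\<^sup>2 = (norm (abs_l2 (osc \<theta> L)))\<^sup>2"
    using square_integrable_osc[OF L] by (simp add: norm_abs_l2_sq square_integrable_cnj)
  then have "norm (abs_l2 (\<lambda>x. cnj (osc \<theta> L x))) = norm (abs_l2 (osc \<theta> L))" by simp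
  then show ?thesis using norm_osc_pos[OF L, of \<theta>] unfolding weyl_cnj_def norm_scaleC norm_of_real by simp
qed

lemma pair_weyl_same:
  assumes L: "L > 0"
  shows "pair (weyl \<theta> L) (weyl_cnj \<theta> L) = 1"
proof -
  note sq = square_integrable_osc[OF L, of \<theta>]
  have "pair (abs_l2 (osc \<theta> L)) (abs_l2 (\<lambda>x. cnj (osc \<theta> L x))) = (LINT x|half_line. complex_of_real ((cmod (osc \<theta> L x))\<^sup>2))"
    unfolding pair_abs[OF sq square_integrable_cnj[OF sq]] by (simp only: complex_norm_square)
  also have "\<dots> = complex_of_real ((norm (abs_l2 (osc \<theta> L)))\<^sup>2)"
    unfolding norm_abs_l2_sq[OF sq] by (rule integral_complex_of_real)
  finally show ?thesis
    using norm_osc_pos[OF L, of \<theta>] unfolding weyl_def weyl_cnj_def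
    by (simp add: pair_scaleC_left pair_scaleC_right power2_eq_square field_simps)
qed

text \<open>Packets live on (L, 2L), so doubling the scale separates their supports.\<close>

lemma pair_weyl_disjoint:
  assumes L: "L > 0" "L' > 0" and disj: "2 * L \<le> L' \<or> 2 * L' \<le> L"
  shows "pair (weyl \<theta> L) (weyl_cnj \<theta> L') = 0"
proof -
  have "osc \<theta> L x * cnj (osc \<theta> L' x) = 0" for x
  proof (cases "L < x \<and> x < 2 * L")
    case True
    then have "osc \<theta> L' x = 0" using disj by (intro osc_zero[OF L(2)]) auto
    then show ?thesis by simp
  qed (simp add: osc_zero[OF L(1)])
  then have "(\<lambda>x. osc \<theta> L x * cnj (osc \<theta> L' x)) = (\<lambda>x. 0)" by (rule ext)
  then have "pair (abs_l2 (osc \<theta> L)) (abs_l2 (\<lambda>x. cnj (osc \<theta> L' x))) = 0"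
    unfolding pair_abs[OF square_integrable_osc[OF L(1)] square_integrable_cnj[OF square_integrable_osc[OF L(2)]]]
    by (simp only: Bochner_Integration.integral_zero)
  then show ?thesis
    unfolding weyl_def weyl_cnj_def by (simp add: pair_scaleC_left pair_scaleC_right)
qed

text \<open>Pairing with the Weyl sequence \<open>e n\<close> decays like \<open>4 ^ (-n)\<close> on the range of \<open>T\<close> and on any prescribed finite set,
  while the sum of \<open>2 ^ (-n)\<close> times the conjugate of \<open>e n\<close> has pairing \<open>2 ^ (-n)\<close>.\<close>

lemma OS_infinite_codim:
  assumes m1: "bounded_multiplier M1 (\<lambda>x. V x - 1)" and m2: "bounded_multiplier M2 V2"
    and lim1: "((\<lambda>x. V x - 1) \<longlongrightarrow> 0) at_top" and lim2: "(V2 \<longlongrightarrow> 0) at_top"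
    and \<nu>: "\<nu>\<^sup>2 = - complex_of_real (\<theta>\<^sup>2)"
    and T: "\<And>u. T u = OS_const a \<nu> u + OS_pert a R V V2 u"
  shows "\<not> has_codim (T ` OS_dom) N"
proof
  assume "has_codim (T ` OS_dom) N"
  then obtain B where B: "finite B" "\<And>y. \<exists>c. y - (\<Sum>b\<in>B. c b *\<^sub>C b) \<in> T ` OS_dom"
    unfolding has_codim_def by blast
  \<comment> \<open>Finiteness of B gives a common threshold for its elements, and the second clause
    is uniform over the domain. This lets the scales be fixed before u is known.\<close>
  have "\<exists>L0. \<forall>L\<ge>L0. (\<forall>b\<in>B. cmod (pair b (weyl \<theta> L)) \<le> \<epsilon>) \<and>
      (\<forall>u\<in>OS_dom. cmod (pair (T u) (weyl \<theta> L)) \<le> \<epsilon> * (norm (helm a u) + norm u))" if "\<epsilon> > 0" for \<epsilon>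
    unfolding eventually_at_top_linorder[symmetric] T
    by (intro eventually_conj eventually_ball_finite B(1) ballI weyl_weakly_null[OF that]
        weyl_operator_small[OF m1 m2 lim1 lim2 \<nu> that])
  then obtain L0 where L0: "\<And>\<epsilon> L b. \<epsilon> > 0 \<Longrightarrow> L \<ge> L0 \<epsilon> \<Longrightarrow> b \<in> B \<Longrightarrow> cmod (pair b (weyl \<theta> L)) \<le> \<epsilon>"
    "\<And>\<epsilon> L u. \<epsilon> > 0 \<Longrightarrow> L \<ge> L0 \<epsilon> \<Longrightarrow> u \<in> OS_dom \<Longrightarrow> cmod (pair (T u) (weyl \<theta> L)) \<le> \<epsilon> * (norm (helm a u) + norm u)"
    by metis
  \<comment> \<open>Doubling keeps the packets disjoint, the thresholds \<open>L0\<close> enforce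
    the rate 4^-n, and starting at 1 or above keeps every scale positive.\<close>
  define Ls where "Ls = rec_nat (max 1 (L0 1)) (\<lambda>n L. max (2 * L) (L0 ((1/4) ^ Suc n)))"
  have Ls_Suc: "Ls (Suc n) = max (2 * Ls n) (L0 ((1/4) ^ Suc n))" for n by (simp add: Ls_def)
  have Ls_ge: "Ls n \<ge> L0 ((1/4) ^ n)" for n
    by (cases n) (simp add: Ls_def, simp add: Ls_Suc del: power_Suc)
  have Ls_pos: "Ls n \<ge> 1" for n
    by (induction n) (auto simp: Ls_def)
  then have Ls0: "Ls n > 0" for n using less_le_trans[OF zero_less_one] by blast
  have double: "2 * Ls m \<le> Ls n" if "m < n" for m n
    using that
  proof (induction n)
    case (Suc n)
    show ?case
    proof (cases "m = n")
      case False
      then have "2 * Ls m \<le> Ls n" using Suc by simp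
      also have "\<dots> \<le> Ls (Suc n)" unfolding Ls_Suc using Ls0[of n] by simp
      finally show ?thesis .
    qed (simp add: Ls_Suc)
  qed simp
  have ortho: "pair (weyl \<theta> (Ls m)) (weyl_cnj \<theta> (Ls n)) = (if n = m then 1 else 0)" for m n
    using pair_weyl_same[OF Ls0] pair_weyl_disjoint[OF Ls0 Ls0, of m n \<theta>] double[of m n] double[of n m]
    by (cases m n rule: linorder_cases) auto
  \<comment> \<open>The weights 2^-n are summable, so the series converges in the complete space,
    yet they decay more slowly than the rate forced on B and on the range.\<close>
  define y where "y = (\<Sum>n. (1/2) ^ n *\<^sub>R weyl_cnj \<theta> (Ls n))"
  have "summable (\<lambda>n. norm ((1/2) ^ n *\<^sub>R weyl_cnj \<theta> (Ls n)))"
    by (simp add: norm_weyl_cnj[OF Ls0] summable_geometric)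
  then have sum: "summable (\<lambda>n. (1/2) ^ n *\<^sub>R weyl_cnj \<theta> (Ls n))"
    by (rule summable_norm_cancel)
  have py: "pair y (weyl \<theta> (Ls m)) = (1/2) ^ m" for m
  proof -
    have "pair (weyl \<theta> (Ls m)) y = (\<Sum>n. pair (weyl \<theta> (Ls m)) ((1/2) ^ n *\<^sub>R weyl_cnj \<theta> (Ls n)))"
      unfolding y_def by (rule bounded_linear.suminf[OF bounded_linear_pair sum])
    also have "(\<lambda>n. pair (weyl \<theta> (Ls m)) ((1/2) ^ n *\<^sub>R weyl_cnj \<theta> (Ls n))) = (\<lambda>n. if n = m then (1/2) ^ m else 0)"
      by (auto simp: fun_eq_iff scaleR_scaleC pair_scaleC_right ortho)
    also have "(\<Sum>n. if n = m then (1/2) ^ m else 0 :: complex) = (1/2) ^ m"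
      using sums_unique[OF sums_single[of m "\<lambda>_. (1/2) ^ m :: complex"]] by simp
    finally show ?thesis by (simp add: pair_commute)
  qed
  obtain c where "y - (\<Sum>b\<in>B. c b *\<^sub>C b) \<in> T ` OS_dom" using B(2) by blast
  then obtain u where u: "u \<in> OS_dom" "y - (\<Sum>b\<in>B. c b *\<^sub>C b) = T u" by blast
  then have y_eq: "y = (\<Sum>b\<in>B. c b *\<^sub>C b) + T u" by (simp add: algebra_simps)
  \<comment> \<open>Depends on y through the coefficients c and the preimage u, but not on
    m.\<close>
  define K where "K = (\<Sum>b\<in>B. cmod (c b)) + (norm (helm a u) + norm u)"
  have le: "(1/2) ^ m \<le> (1/4) ^ m * K" for m
  proof -
    let ?e = "weyl \<theta> (Ls m)"
    have p: "(0::real) < (1/4) ^ m" by simp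
    have "pair (\<Sum>b\<in>S. c b *\<^sub>C b) ?e = (\<Sum>b\<in>S. c b * pair b ?e)" for S
      by (induction S rule: infinite_finite_induct) (auto simp: pair_zero_left pair_add_left pair_scaleC_left)
    then have "cmod (pair y ?e) \<le> cmod (\<Sum>b\<in>B. c b * pair b ?e) + cmod (pair (T u) ?e)"
      unfolding y_eq pair_add_left by (simp add: norm_triangle_ineq)
    also have "\<dots> \<le> (\<Sum>b\<in>B. cmod (c b) * (1/4) ^ m) + (1/4) ^ m * (norm (helm a u) + norm u)"
    proof (rule add_mono)
      show "cmod (pair (T u) ?e) \<le> (1/4) ^ m * (norm (helm a u) + norm u)"
        by (rule L0(2)[OF p Ls_ge u(1)])
      show "cmod (\<Sum>b\<in>B. c b * pair b ?e) \<le> (\<Sum>b\<in>B. cmod (c b) * (1/4) ^ m)"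
        by (rule order_trans[OF norm_sum], rule sum_mono, unfold norm_mult, rule mult_left_mono[OF L0(1)[OF p Ls_ge]]) auto
    qed
    also have "\<dots> = (1/4) ^ m * K"
      unfolding K_def distrib_left sum_distrib_left by (simp only: mult.commute)
    finally show ?thesis unfolding py by (simp add: norm_power norm_divide)
  qed
  have "2 ^ m \<le> K" for m
  proof -
    have "(2::real) ^ m = 4 ^ m * (1/2) ^ m" by (simp flip: power_mult_distrib)
    also have "\<dots> \<le> 4 ^ m * ((1/4) ^ m * K)" by (rule mult_left_mono[OF le]) simp
    also have "\<dots> = K" by (simp flip: power_mult_distrib mult.assoc)
    finally show ?thesis .
  qed
  moreover obtain m where "K < 2 ^ m" using real_arch_pow[of 2 K] by auto
  ultimately show False by (meson not_le)
qed

theorem theorem2p1: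
  fixes a R :: real and V V1 V2 :: "real \<Rightarrow> real"
  assumes "a > 0" and "R > 0"
    and "\<And>x. x \<ge> 0 \<Longrightarrow> (V has_real_derivative V1 x) (at x within {0..})"
    and "\<And>x. x \<ge> 0 \<Longrightarrow> (V1 has_real_derivative V2 x) (at x within {0..})"
    and "continuous_on {0..} V2"
    and "(V \<longlongrightarrow> 1) at_top" and "(V2 \<longlongrightarrow> 0) at_top"
  shows "ess_spectrum OS_X (sobolev_norm 2) OS_dom (OS_A a R V V2) (OS_B a) =
    {complex_of_real \<mu> + complex_of_real (a\<^sup>2) + \<i> * complex_of_real a * complex_of_real R | \<mu>. \<mu> \<ge> 0}"
    (is "_ = ?ray")
proof -
  have contV: "continuous_on {0..} V"
    using assms(3) by (intro DERIV_continuous_on[of "{0..}" V V1]) auto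
  obtain M where M: "bounded_multiplier M V"
    using bounded_multiplier_continuous[OF contV assms(6)] by blast
  have lim1: "((\<lambda>x. V x - 1) \<longlongrightarrow> 0) at_top" by (rule LIM_zero[OF assms(6)])
  obtain M1 where M1: "bounded_multiplier M1 (\<lambda>x. V x - 1)"
    using bounded_multiplier_continuous[OF _ lim1] continuous_on_diff[OF contV continuous_on_const] by blast
  obtain M2 where M2: "bounded_multiplier M2 V2"
    using bounded_multiplier_continuous[OF assms(5,7)] by blast
  let ?w = "complex_of_real (a\<^sup>2) + \<i> * complex_of_real a * complex_of_real R"
  let ?T = "\<lambda>z u. OS_A a R V V2 u - z *\<^sub>C OS_B a u"
  have T: "?T z u = OS_const a \<nu> u + OS_pert a R V V2 u" if "\<nu>\<^sup>2 = ?w - z" for z \<nu> u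
    by (rule OS_decomposition[OF M M1 that])
  show ?thesis
  proof (intro equalityI subsetI)
    fix z assume "z \<in> ?ray"
    then obtain \<mu> where \<mu>: "\<mu> \<ge> 0" "z = complex_of_real \<mu> + ?w" by (auto simp: add.assoc)
    \<comment> \<open>On the ray \<nu> is purely imaginary, with wave number \<theta> = sqrt \<mu>;
      at the end point \<mu> = 0 the packets do not oscillate.\<close>
    define \<nu> where "\<nu> = \<i> * complex_of_real (sqrt \<mu>)"
    have \<nu>: "\<nu>\<^sup>2 = - complex_of_real ((sqrt \<mu>)\<^sup>2)" unfolding \<nu>_def power_mult_distrib by simp
    then have "\<nu>\<^sup>2 = ?w - z" using \<mu> by simp
    from OS_infinite_codim[OF M1 M2 lim1 assms(7) \<nu> T[OF this]]
    have "\<not> fredholm_operator OS_X (sobolev_norm 2) OS_dom (?T z)"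
      unfolding fredholm_operator_def by blast
    then show "z \<in> ess_spectrum OS_X (sobolev_norm 2) OS_dom (OS_A a R V V2) (OS_B a)"
      unfolding ess_spectrum_def by blast
  next
    fix z assume z: "z \<in> ess_spectrum OS_X (sobolev_norm 2) OS_dom (OS_A a R V V2) (OS_B a)"
    show "z \<in> ?ray"
    proof (rule ccontr)
      assume not_ray: "z \<notin> ?ray"
      \<comment> \<open>The principal root has nonnegative real part, and this part is 0 only if
        \<nu>^2 is real and nonpositive, which would put z on the ray.\<close>
      define \<nu> where "\<nu> = csqrt (?w - z)"
      have \<nu>2: "\<nu>\<^sup>2 = ?w - z" unfolding \<nu>_def by (rule power2_csqrt)
      have "Re \<nu> \<noteq> 0"
      proof
        assume "Re \<nu> = 0"
        then have "\<nu> = \<i> * complex_of_real (Im \<nu>)" by (simp add: complex_eq_iff)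
        then have "\<nu>\<^sup>2 = (\<i> * complex_of_real (Im \<nu>))\<^sup>2" by (rule arg_cong)
        also have "\<dots> = - complex_of_real ((Im \<nu>)\<^sup>2)" by (simp add: power_mult_distrib)
        finally have "\<nu>\<^sup>2 = - complex_of_real ((Im \<nu>)\<^sup>2)" .
        then have "z = complex_of_real ((Im \<nu>)\<^sup>2) + complex_of_real (a\<^sup>2) + \<i> * complex_of_real a * complex_of_real R"
          using \<nu>2 by (simp add: algebra_simps)
        moreover have "(Im \<nu>)\<^sup>2 \<ge> 0" by simp
        ultimately show False using not_ray by blast
      qed
      then have "Re \<nu> > 0" using csqrt_principal[of "?w - z"] unfolding \<nu>_def by auto
      from OS_fredholm[OF assms(1) this M1 M2 lim1 assms(7) T[OF \<nu>2]]
      show False using z unfolding ess_spectrum_def by blast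
    qed
  qed
qed

end
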